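(* Let $B\subset\mathbb{R}_+$ be any compact set, $\varrho\in\mathcal{Q}_p$, and $\ell\in\mathbf{W}_p$. Then the following hold for the Bayesian estimator $\widetilde\beta_N$ associated with $\varrho$ and $\ell$. (a) For any $\varepsilon>0$, $\lim_{N\to\infty}\sup_{\theta_0\in B}\mathbb{P}\big(|\widetilde\beta_N-\theta_0|>\varepsilon\big)=0$. (b) Uniformly in $\theta_0\in B$, $\sqrt{I_N}\big(\widetilde\beta_N-\theta_0\big)$ converges in distribution to $\mathcal{N}(0,1)$ as $N\to\infty$. (c) For any $\varepsilon>0$, $\lim_{N\to\infty}\sup_{\theta_0\in B}\mathbb{P}\big(\big|\sqrt{I_N}(\widetilde\beta_N-\theta_0)-\xi_N\big|>\varepsilon\big)=0$. (d) For any $\varpi\in\mathbf{W}_p$, $\widetilde\beta_N$ is asymptotically efficient in $B$ for the loss functions $\varpi_N(x):=\varpi(\sqrt{I_N}x)$; that is, for any $\theta_0\in B$, $$\lim_{\delta\to0+}\liminf_{N\to\infty}\sup_{|\theta-\theta_0|<\delta}\mathbb{E}\big(\varpi_N(\widetilde\beta_N-\theta)\big)=\mathbb{E}(\varpi(\xi)),$$ where $\xi\sim\mathcal{N}(0,1)$ under $\mathbb{P}$.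
   Context: $\mathbb{R}_+:=(0,\infty)$. $(\Omega,\mathscr{F},\{\mathscr{F}_t\},\mathbb{P})$ is a stochastic basis satisfying the usual assumptions, with independent standard Brownian motions $\{w_k\}_{k\in\mathbb{N}}$. $\{\mu_k\}\subset(0,\infty)$ with $\mu_k\to\infty$ (the eigenvalues of a positive definite self-adjoint operator $A$ on a separable Hilbert space), $\{q_k\}\subset(0,\infty)$, $\sigma>0$ and $T>0$ are fixed and known. For $\theta\in\mathbb{R}_+$, $u_k^\theta$ is the $k$-th Fourier mode of the solution of $du+\theta Au\,dt=\sigma\sum_ku_kh_kq_k\,dw_k$ ($h_k$ the eigenvectors of $A$), i.e. $du_k^\theta=-\theta\mu_ku_k^\theta\,dt+\sigma q_ku_k^\theta\,dw_k$, so $u_k^\theta(t)=u_k(0)\exp\big(-(\theta\mu_k+\tfrac12\sigma^2q_k^2)t+\sigma q_kw_k(t)\big)$, $t\in[0,T]$, with $\mathscr{F}_0$-measurable $u_k(0)\ne0$ not depending on $\theta$. Standing assumption: the well-posedness condition of the equation holds for at least one parameter value, i.e. there exist $\bar\theta>0$, $N_0\in\mathbb{N}$, $c>0$ with $2\bar\theta-\sigma^2q_k^2/\mu_k\ge c$ for all $k\ge N_0$. $\theta_0\in\mathbb{R}_+$ is the true parameter value and the observation is $U_N=U_N^{\theta_0}=(u_1,\dots,u_N)$ on $[0,T]$, $u_k:=u_k^{\theta_0}$. The Fisher information is $I_N:=\frac{T}{\sigma^2}\sum_{k=1}^N\mu_k^2q_k^{-2}$. Put $$\widehat\theta_N:=-\frac{\sum_{k=1}^N\mu_kq_k^{-2}\int_0^T\frac{du_k(t)}{u_k(t)}}{T\sum_{k=1}^N\mu_k^2q_k^{-2}},\qquad\xi_N:=-\frac{1}{\sigma\sqrt{I_N}}\sum_{k=1}^N\mu_kq_k^{-1}w_k(T).$$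 For a prior $\varrho$ (a non-negative, non-trivial Borel function on $\mathbb{R}_+$) the posterior density (likelihood times prior, normalized) is $$p(\theta\,|\,U_N)=\frac{e^{-I_N(\theta-\widehat\theta_N)^2/2}\varrho(\theta)}{\int_{\mathbb{R}_+}e^{-I_N(\eta-\widehat\theta_N)^2/2}\varrho(\eta)\,d\eta},\quad\theta\in\mathbb{R}_+,$$ it being understood that the denominator is finite and positive. For a loss function $\ell$, $$\widetilde\beta_N:=\operatorname*{arg\,min}_{\beta\in\mathbb{R}_+}\int_{\mathbb{R}_+}\ell\big(\sqrt{I_N}(\eta-\beta)\big)\,p(\eta\,|\,U_N)\,d\eta,$$ defined given that the minimum is strict and attained (this is assumed for every $N$). $\mathcal{Q}_p$ is the set of $\varrho:\mathbb{R}_+\to[0,\infty)$ that are continuous and positive on $\mathbb{R}_+$ and possess a polynomial majorant as $\theta\to\infty$. $\mathbf{W}$ is the set of Borel measurable $\ell:\mathbb{R}\to[0,\infty)$ that are symmetric, non-decreasing on $[0,\infty)$, with $\ell(0)=0$, continuous at $0$ and not identically $0$; $\mathbf{W}_p$ is the set of $\ell\in\mathbf{W}$ possessing a polynomial majorant as $|x|\to\infty$. In suprema over $\theta_0$ (resp. over $\theta$ in (d), where $\theta\in\mathbb{R}_+$), the estimator is computed from data generated under that parameter value. "Converges in distribution uniformly in $\theta_0\in B$" means that for every bounded continuous $g$, $\sup_{\theta_0\in B}|\mathbb{E}g(\cdot)-\mathbb{E}g(\xi)|\to0$, $\xi\sim\mathcal{N}(0,1)$. *)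

theory Defs
  imports "HOL-Probability.Probability" "HOL-Computational_Algebra.Polynomial"
begin

section \<open>Stochastic basis, Brownian motion, stochastic integral\<close>

text \<open>The time index set is \<open>[0, \<infinity>)\<close>; values of \<open>F\<close>, and of processes, at negative times
  are irrelevant.  Of each \<open>F t\<close> only the underlying \<open>\<sigma>\<close>-algebra matters.\<close>

definition stochastic_basis :: "'a measure \<Rightarrow> (real \<Rightarrow> 'a measure) \<Rightarrow> bool" where
  "stochastic_basis M F \<longleftrightarrow>
     prob_space M \<and> complete_measure M \<and>
     (\<forall>t\<ge>0. subalgebra M (F t)) \<and>
     (\<forall>s\<ge>0. \<forall>t\<ge>s. subalgebra (F t) (F s)) \<and>
     null_sets M \<subseteq> sets (F 0) \<and>
     (\<forall>t\<ge>0. sets (F t) = (\<Inter>s\<in>{t<..}. sets (F s)))"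

definition brownian_motion ::
    "'a measure \<Rightarrow> (real \<Rightarrow> 'a measure) \<Rightarrow> (real \<Rightarrow> 'a \<Rightarrow> real) \<Rightarrow> bool" where
  "brownian_motion M F W \<longleftrightarrow>
     (AE \<omega> in M. W 0 \<omega> = 0) \<and>
     (AE \<omega> in M. continuous_on {0..} (\<lambda>t. W t \<omega>)) \<and>
     (\<forall>t\<ge>0. W t \<in> borel_measurable (F t)) \<and>
     (\<forall>s\<ge>0. \<forall>t>s.
        distributed M lborel (\<lambda>\<omega>. W t \<omega> - W s \<omega>) (normal_density 0 (sqrt (t - s))) \<and>
        prob_space.indep_set M (sets (F s))
          (sets (vimage_algebra (space M) (\<lambda>\<omega>. W t \<omega> - W s \<omega>) borel)))"

definition independent_processes ::
    "'a measure \<Rightarrow> ('i \<Rightarrow> real \<Rightarrow> 'a \<Rightarrow> real) \<Rightarrow> 'i set \<Rightarrow> bool" where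
  "independent_processes M w K \<longleftrightarrow>
     prob_space.indep_vars M (\<lambda>_. PiM {0..} (\<lambda>_. borel)) (\<lambda>k \<omega>. \<lambda>t\<in>{0..}. w k t \<omega>) K"

text \<open>The stochastic integral \<open>\<integral>\<^sub>0\<^sup>T H dX\<close> of a continuous adapted integrand \<open>H\<close> against a
  continuous semimartingale \<open>X\<close>: the limit in probability of the left-point Riemann sums over
  deterministic partitions \<open>0 = \<tau> 0 \<le> \<dots> \<le> \<tau> m = T\<close> whose mesh tends to \<open>0\<close>.  The limit is
  determined up to almost sure equality, and \<open>stoch_integral\<close> selects a version.\<close>

definition has_stoch_integral ::
    "'a measure \<Rightarrow> real \<Rightarrow> (real \<Rightarrow> 'a \<Rightarrow> real) \<Rightarrow> (real \<Rightarrow> 'a \<Rightarrow> real) \<Rightarrow> ('a \<Rightarrow> real) \<Rightarrow> bool" where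
  "has_stoch_integral M T H X J \<longleftrightarrow>
     J \<in> borel_measurable M \<and>
     (\<forall>\<epsilon>>0. \<forall>\<eta>>0. \<exists>\<delta>>0. \<forall>(m::nat) \<tau>.
        \<tau> 0 = 0 \<and> \<tau> m = T \<and> (\<forall>i<m. \<tau> i \<le> \<tau> (Suc i) \<and> \<tau> (Suc i) - \<tau> i < \<delta>) \<longrightarrow>
        measure M {\<omega> \<in> space M.
          \<epsilon> < \<bar>(\<Sum>i<m. H (\<tau> i) \<omega> * (X (\<tau> (Suc i)) \<omega> - X (\<tau> i) \<omega>)) - J \<omega>\<bar>} < \<eta>)"

definition stoch_integral ::
    "'a measure \<Rightarrow> real \<Rightarrow> (real \<Rightarrow> 'a \<Rightarrow> real) \<Rightarrow> (real \<Rightarrow> 'a \<Rightarrow> real) \<Rightarrow> 'a \<Rightarrow> real" where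
  "stoch_integral M T H X = (SOME J. has_stoch_integral M T H X J)"


section \<open>Fisher information, maximum likelihood and Bayesian estimators\<close>

definition fisher_info :: "real \<Rightarrow> real \<Rightarrow> (nat \<Rightarrow> real) \<Rightarrow> (nat \<Rightarrow> real) \<Rightarrow> nat \<Rightarrow> real" where
  "fisher_info T \<sigma> \<mu> q N = T / \<sigma>\<^sup>2 * (\<Sum>k=1..N. (\<mu> k)\<^sup>2 / (q k)\<^sup>2)"

text \<open>In \<open>theta_hat\<close>, \<open>u\<close> is the observed data: \<open>u k t \<omega>\<close> is the value of the \<open>k\<close>-th Fourier
  mode at time \<open>t\<close>.\<close>

definition theta_hat ::
    "'a measure \<Rightarrow> real \<Rightarrow> (nat \<Rightarrow> real) \<Rightarrow> (nat \<Rightarrow> real) \<Rightarrow> (nat \<Rightarrow> real \<Rightarrow> 'a \<Rightarrow> real)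
      \<Rightarrow> nat \<Rightarrow> 'a \<Rightarrow> real" where
  "theta_hat M T \<mu> q u N \<omega> =
     - (\<Sum>k=1..N. \<mu> k / (q k)\<^sup>2 * stoch_integral M T (\<lambda>t \<omega>. 1 / u k t \<omega>) (u k) \<omega>)
       / (T * (\<Sum>k=1..N. (\<mu> k)\<^sup>2 / (q k)\<^sup>2))"

definition xi ::
    "real \<Rightarrow> real \<Rightarrow> (nat \<Rightarrow> real) \<Rightarrow> (nat \<Rightarrow> real) \<Rightarrow> (nat \<Rightarrow> real \<Rightarrow> 'a \<Rightarrow> real)
      \<Rightarrow> nat \<Rightarrow> 'a \<Rightarrow> real" where
  "xi T \<sigma> \<mu> q w N \<omega> =
     - (1 / (\<sigma> * sqrt (fisher_info T \<sigma> \<mu> q N))) * (\<Sum>k=1..N. \<mu> k / q k * w k T \<omega>)"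

text \<open>Below, \<open>I\<close> stands for the Fisher information and \<open>x\<close> for the realized value of
  \<open>theta_hat\<close>, through which the posterior depends on the data.  The non-negative integrals
  are taken in \<^typ>\<open>ennreal\<close>, so that divergence is not masked.\<close>

definition posterior_norm :: "(real \<Rightarrow> real) \<Rightarrow> real \<Rightarrow> real \<Rightarrow> ennreal" where
  "posterior_norm \<rho> I x =
     (\<integral>\<^sup>+\<eta>\<in>{0<..}. ennreal (exp (- (I * (\<eta> - x)\<^sup>2 / 2)) * \<rho> \<eta>) \<partial>lborel)"

definition posterior_density :: "(real \<Rightarrow> real) \<Rightarrow> real \<Rightarrow> real \<Rightarrow> real \<Rightarrow> ennreal" where
  "posterior_density \<rho> I x \<theta> =
     ennreal (exp (- (I * (\<theta> - x)\<^sup>2 / 2)) * \<rho> \<theta>) / posterior_norm \<rho> I x"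

definition posterior_risk ::
    "(real \<Rightarrow> real) \<Rightarrow> (real \<Rightarrow> real) \<Rightarrow> real \<Rightarrow> real \<Rightarrow> real \<Rightarrow> ennreal" where
  "posterior_risk \<rho> \<l> I x \<beta> =
     (\<integral>\<^sup>+\<eta>\<in>{0<..}. ennreal (\<l> (sqrt I * (\<eta> - \<beta>))) * posterior_density \<rho> I x \<eta> \<partial>lborel)"

definition bayes_estimator ::
    "(real \<Rightarrow> real) \<Rightarrow> (real \<Rightarrow> real) \<Rightarrow> real \<Rightarrow> real \<Rightarrow> real" where
  "bayes_estimator \<rho> \<l> I x = arg_min (posterior_risk \<rho> \<l> I x) (\<lambda>\<beta>. 0 < \<beta>)"


section \<open>Classes of priors and of loss functions\<close>

definition priors_Qp :: "(real \<Rightarrow> real) set" where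
  "priors_Qp = {\<rho>. continuous_on {0<..} \<rho> \<and> (\<forall>\<theta>>0. 0 < \<rho> \<theta>) \<and>
                  (\<exists>p :: real poly. \<forall>\<^sub>F \<theta> in at_top. \<rho> \<theta> \<le> poly p \<theta>)}"

definition losses_W :: "(real \<Rightarrow> real) set" where
  "losses_W = {\<l>. \<l> \<in> borel_measurable borel \<and> (\<forall>x. 0 \<le> \<l> x) \<and> (\<forall>x. \<l> (- x) = \<l> x) \<and>
                 mono_on {0..} \<l> \<and> \<l> 0 = 0 \<and> isCont \<l> 0 \<and> (\<exists>x. \<l> x \<noteq> 0)}"

definition losses_Wp :: "(real \<Rightarrow> real) set" where
  "losses_Wp = {\<l> \<in> losses_W. \<exists>p :: real poly. \<forall>\<^sub>F x in at_infinity. \<l> x \<le> poly p x}"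

end

theory Submission
  imports Defs "HOL-Real_Asymp.Real_Asymp"
begin

text \<open>The proof reduces the theorem to a deterministic statement about the Bayes estimator as a function
  of the maximum likelihood estimate.

  The reduction rests on Ito's formula. The integral of \<open>du\<^sub>k / u\<^sub>k\<close> over \<open>[0, T]\<close> is almost surely
  \<open>-\<theta> \<mu>\<^sub>k T + \<sigma> q\<^sub>k w\<^sub>k(T)\<close>, which is checked by an \<open>L\<^sup>2\<close> estimate for the Riemann sums
  (\<open>stoch_integral_log\<close>). Hence the maximum likelihood estimate equals \<open>\<theta> + \<xi>\<^sub>N / sqrt I\<^sub>N\<close> almost
  surely (\<open>theta_hat_eq\<close>), and \<open>\<xi>\<^sub>N\<close> is standard normal for every \<open>N\<close>, not only in the limit
  (\<open>Y_distributed\<close>). The well-posedness condition bounds \<open>q\<^sub>k\<^sup>2\<close> by a multiple of \<open>\<mu>\<^sub>k\<close> for large \<open>k\<close>, so that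
  \<open>I\<^sub>N\<close> tends to infinity. The posterior depends on the data only through the maximum likelihood
  estimate, so the Bayes estimate is a deterministic function \<open>b\<close> of \<open>I\<^sub>N\<close> and
  \<open>x = \<theta> + \<xi>\<^sub>N / sqrt I\<^sub>N\<close>.

  Three properties of \<open>b\<close> are needed.

  Monotonicity (\<open>b_mono\<close>): the Gaussian factors have monotone likelihood ratio in \<open>x\<close>, and the
  difference of the losses of two estimates changes sign once, so a larger \<open>x\<close> cannot favour a
  smaller estimate. This makes the estimator measurable and lets it be extended from the almost sure set of well-behaved \<open>x\<close> to the whole line.

  Concentration (\<open>b_close\<close>): in the variable \<open>v = sqrt I (\<eta> - x)\<close> the risk at
  \<open>x + h / sqrt I\<close> is close to \<open>\<rho>(x)\<close> times the expected loss of a shifted Gaussian. Anderson's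
  inequality, in a strict form (\<open>smoothed_loss_strict\<close>), says that the latter is smallest at
  \<open>h = 0\<close> only. Hence \<open>sqrt I (b(x) - x)\<close> tends to \<open>0\<close> uniformly for \<open>x\<close> in a compact subset of
  \<open>(0, \<infinity>)\<close>.

  Growth (\<open>b_le_6\<close>): \<open>b(x) \<le> 6 x\<close> for \<open>x\<close> bounded away from \<open>0\<close> and large information, because
  posterior mass beyond \<open>3 x\<close> is exponentially smaller than the mass near a fixed point.

  Put \<open>\<psi>(z) = sqrt I (b(\<theta> + z / sqrt I) - \<theta>)\<close>, the normalized error as a function of
  \<open>z = \<xi>\<^sub>N\<close>. Concentration gives \<open>\<psi>(z) \<rightarrow> z\<close> locally uniformly in \<open>z\<close> and \<open>\<theta>\<close>
  (\<open>\<psi>_limit\<close>); with monotonicity, the growth bound gives \<open>\<bar>\<psi>(z)\<bar> \<le> C (1 + \<bar>z\<bar>)\<close>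
  (\<open>\<psi>_growth\<close>). The first fact yields consistency and the approximation by \<open>\<xi>\<^sub>N\<close>. Dominated
  convergence under the fixed standard normal law (\<open>std_normal_uniform_limit\<close>) then yields
  asymptotic normality and efficiency, since a loss function is monotone on each half-line and so
  has at most countably many discontinuities.\<close>

section \<open>Polynomial growth and Gaussian tails\<close>

lemma poly_le_growth:
  fixes p :: "real poly"
  shows "\<exists>C\<ge>0. \<exists>k. \<forall>x. poly p x \<le> C * (1 + \<bar>x\<bar>) ^ k"
proof -
  define C where "C = (\<Sum>i\<le>degree p. \<bar>coeff p i\<bar>)"
  have "poly p x \<le> C * (1 + \<bar>x\<bar>) ^ degree p" for x
  proof -
    have "poly p x = (\<Sum>i\<le>degree p. coeff p i * x ^ i)"
      by (rule poly_altdef)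
    also have "\<dots> \<le> (\<Sum>i\<le>degree p. \<bar>coeff p i\<bar> * (1 + \<bar>x\<bar>) ^ degree p)"
    proof (rule sum_mono)
      fix i assume i: "i \<in> {..degree p}"
      have "coeff p i * x ^ i \<le> \<bar>coeff p i\<bar> * \<bar>x\<bar> ^ i"
        by (metis abs_ge_self abs_mult power_abs)
      also have "\<bar>x\<bar> ^ i \<le> (1 + \<bar>x\<bar>) ^ i"
        by (intro power_mono) auto
      also have "\<dots> \<le> (1 + \<bar>x\<bar>) ^ degree p"
        using i by (intro power_increasing) auto
      finally show "coeff p i * x ^ i \<le> \<bar>coeff p i\<bar> * (1 + \<bar>x\<bar>) ^ degree p"
        by (simp add: mult_left_mono)
    qed
    also have "\<dots> = C * (1 + \<bar>x\<bar>) ^ degree p"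
      by (simp add: C_def sum_distrib_right)
    finally show ?thesis .
  qed
  moreover have "0 \<le> C" by (simp add: C_def sum_nonneg)
  ultimately show ?thesis by blast
qed

text \<open>Monotonicity turns the majorant at infinity into one on the whole line.\<close>

lemma loss_growth:
  assumes "\<l> \<in> losses_Wp"
  shows "\<exists>A\<ge>0. \<exists>k. \<forall>x. \<l> x \<le> A * (1 + \<bar>x\<bar>) ^ k"
proof -
  have nn: "\<And>x. 0 \<le> \<l> x" and sym: "\<And>x. \<l> (- x) = \<l> x" and mono: "mono_on {0..} \<l>"
    using assms by (auto simp: losses_Wp_def losses_W_def)
  obtain p :: "real poly" where p: "\<forall>\<^sub>F x in at_infinity. \<l> x \<le> poly p x"
    using assms by (auto simp: losses_Wp_def)
  obtain X where X: "\<And>x. X \<le> norm x \<Longrightarrow> \<l> x \<le> poly p x"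
    using p unfolding eventually_at_infinity by blast
  obtain C k where C: "0 \<le> C" "\<And>x. poly p x \<le> C * (1 + \<bar>x\<bar>) ^ k"
    using poly_le_growth by blast
  have le: "\<l> x \<le> (C + \<l> \<bar>X\<bar>) * (1 + \<bar>x\<bar>) ^ k" for x
  proof (cases "X \<le> norm x")
    case True
    have "\<l> x \<le> C * (1 + \<bar>x\<bar>) ^ k" using X[OF True] C(2) order_trans by blast
    also have "\<dots> \<le> (C + \<l> \<bar>X\<bar>) * (1 + \<bar>x\<bar>) ^ k"
      using nn by (intro mult_right_mono) auto
    finally show ?thesis .
  next
    case False
    have "\<l> x = \<l> \<bar>x\<bar>" using sym[of x] by (simp add: abs_if)
    also have "\<dots> \<le> \<l> \<bar>X\<bar>" using False by (intro mono_onD[OF mono]) auto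
    also have "\<dots> \<le> (C + \<l> \<bar>X\<bar>) * 1" using C by simp
    also have "\<dots> \<le> (C + \<l> \<bar>X\<bar>) * (1 + \<bar>x\<bar>) ^ k"
      using nn C by (intro mult_left_mono) auto
    finally show ?thesis .
  qed
  show ?thesis using le C(1) nn[of "\<bar>X\<bar>"] by (intro exI[of _ "C + \<l> \<bar>X\<bar>"]) (auto intro!: exI[of _ k])
qed

text \<open>The prior may be unbounded near \<open>0\<close>, so a polynomial bound is available only away from \<open>0\<close>.\<close>

lemma prior_growth:
  assumes "\<rho> \<in> priors_Qp" "0 < a"
  shows "\<exists>C\<ge>0. \<exists>m. \<forall>x\<ge>a. \<rho> x \<le> C * (1 + \<bar>x\<bar>) ^ m"
proof -
  have cont: "continuous_on {0<..} \<rho>" and pos: "\<And>x. 0 < x \<Longrightarrow> 0 < \<rho> x"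
    using assms by (auto simp: priors_Qp_def)
  obtain p :: "real poly" where p: "\<forall>\<^sub>F x in at_top. \<rho> x \<le> poly p x"
    using assms by (auto simp: priors_Qp_def)
  obtain X where X: "\<And>x. X \<le> x \<Longrightarrow> \<rho> x \<le> poly p x"
    using p unfolding eventually_at_top_linorder by blast
  obtain C k where C: "0 \<le> C" "\<And>x. poly p x \<le> C * (1 + \<bar>x\<bar>) ^ k"
    using poly_le_growth by blast
  have "continuous_on {a..X} \<rho>" using assms(2) by (intro continuous_on_subset[OF cont]) auto
  then have "bounded (\<rho> ` {a..X})" by (intro compact_imp_bounded compact_continuous_image) auto
  then obtain D where D: "\<And>x. x \<in> {a..X} \<Longrightarrow> norm (\<rho> x) \<le> D" "0 < D"
    unfolding bounded_pos by blast
  have "\<rho> x \<le> (C + D) * (1 + \<bar>x\<bar>) ^ k" if "a \<le> x" for x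
  proof (cases "X \<le> x")
    case True
    have "\<rho> x \<le> C * (1 + \<bar>x\<bar>) ^ k" using X[OF True] C(2) order_trans by blast
    also have "\<dots> \<le> (C + D) * (1 + \<bar>x\<bar>) ^ k"
      using D by (intro mult_right_mono) auto
    finally show ?thesis .
  next
    case False
    have "\<rho> x \<le> D" using D(1)[of x] False that by auto
    also have "\<dots> \<le> (C + D) * 1" using C by simp
    also have "\<dots> \<le> (C + D) * (1 + \<bar>x\<bar>) ^ k"
      using D C by (intro mult_left_mono) auto
    finally show ?thesis .
  qed
  then show ?thesis using C(1) D(2) by (intro exI[of _ "C + D"]) (auto intro!: exI[of _ k])
qed

abbreviation gauss_poly :: "nat \<Rightarrow> real \<Rightarrow> real \<Rightarrow> real" where
  "gauss_poly k c x \<equiv> (1 + \<bar>x\<bar>) ^ k * exp (- (c * x\<^sup>2))"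

lemma integrable_growth_gauss:
  fixes c :: real
  assumes "0 < c"
  shows "integrable lborel (\<lambda>x. gauss_poly k c x)"
proof -
  define s where "s = 1 / sqrt (2 * c)"
  have s: "0 < s" and s2: "s\<^sup>2 = 1 / (2 * c)"
    using assms by (auto simp: s_def power_divide)
  have eq: "exp (- (c * x\<^sup>2)) = sqrt (2 * pi * s\<^sup>2) * normal_density 0 s x" for x
    using assms by (simp add: normal_density_def s2)
  have "integrable lborel (\<lambda>x. \<Sum>i\<le>k. (sqrt (2 * pi * s\<^sup>2) * of_nat (k choose i)) *
      (normal_density 0 s x * \<bar>x - 0\<bar> ^ (k - i)))"
    by (intro Bochner_Integration.integrable_sum integrable_mult_right integrable_normal_moment_abs s)
  also have "(\<lambda>x. \<Sum>i\<le>k. (sqrt (2 * pi * s\<^sup>2) * of_nat (k choose i)) *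
      (normal_density 0 s x * \<bar>x - 0\<bar> ^ (k - i))) = (\<lambda>x. gauss_poly k c x)"
    by (auto simp: fun_eq_iff binomial_ring eq sum_distrib_right sum_distrib_left algebra_simps)
  finally show ?thesis .
qed

lemma nn_integral_growth_gauss_finite:
  fixes c :: real
  assumes "0 < c"
  shows "(\<integral>\<^sup>+x. ennreal (gauss_poly k c x) \<partial>lborel) < \<infinity>"
  using integrable_growth_gauss[OF assms, of k] unfolding integrable_iff_bounded
  by (simp add: abs_mult power_abs)

abbreviation nn_tail :: "(real \<Rightarrow> ennreal) \<Rightarrow> real \<Rightarrow> ennreal" where
  "nn_tail f R \<equiv> (\<integral>\<^sup>+x. f x * indicator {x. R < \<bar>x\<bar>} x \<partial>lborel)"

lemma nn_integral_tail_small: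
  fixes f :: "real \<Rightarrow> ennreal"
  assumes [measurable]: "f \<in> borel_measurable borel" and fin: "(\<integral>\<^sup>+x. f x \<partial>lborel) < \<infinity>" and "0 < e"
  shows "\<exists>R0\<ge>0. \<forall>R\<ge>R0. nn_tail f R < e"
proof -
  have "(\<lambda>n. \<integral>\<^sup>+x. f x * indicator {x. real n < \<bar>x\<bar>} x \<partial>lborel) \<longlonglongrightarrow> (\<integral>\<^sup>+x. 0 \<partial>(lborel :: real measure))"
  proof (rule nn_integral_dominated_convergence[where w = f])
    show "AE x in lborel. (\<lambda>n. f x * indicator {x. real n < \<bar>x\<bar>} x) \<longlonglongrightarrow> 0"
    proof (rule AE_I2)
      fix x :: real
      obtain n0 where n0: "\<bar>x\<bar> \<le> real n0" using real_arch_simple by blast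
      have "\<forall>\<^sub>F n in sequentially. f x * indicator {x. real n < \<bar>x\<bar>} x = 0"
        by (rule eventually_sequentiallyI[of n0]) (use n0 in \<open>auto split: split_indicator\<close>)
      then show "(\<lambda>n. f x * indicator {x. real n < \<bar>x\<bar>} x) \<longlonglongrightarrow> 0"
        by (rule tendsto_eventually)
    qed
  qed (use fin in \<open>auto split: split_indicator\<close>)
  then have "(\<lambda>n. \<integral>\<^sup>+x. f x * indicator {x. real n < \<bar>x\<bar>} x \<partial>lborel) \<longlonglongrightarrow> 0" by simp
  then have "\<forall>\<^sub>F n in sequentially. nn_tail f (real n) < e"
    using \<open>0 < e\<close> by (rule order_tendstoD)
  then obtain n where n: "nn_tail f (real n) < e"
    by (auto simp: eventually_sequentially)
  have "nn_tail f R < e" if "real n \<le> R" for R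
    by (rule le_less_trans[OF nn_integral_mono n]) (use that in \<open>auto split: split_indicator\<close>)
  then show ?thesis by (intro exI[of _ "real n"]) auto
qed

text \<open>Writing the function as the \<open>k\<close>-th power of one with \<open>k = 1\<close> reduces the claim to a concrete
  exponent.\<close>

lemma sqrt_growth_exp_tendsto_0:
  fixes c :: real
  assumes "0 < c"
  shows "((\<lambda>i. (1 + sqrt i) ^ k * exp (- (c * i))) \<longlongrightarrow> 0) at_top"
proof (cases "k = 0")
  case True
  show ?thesis unfolding True using assms by simp real_asymp
next
  case False
  define d where "d = c / real k"
  have d: "0 < d" "c = real k * d" using assms False by (auto simp: d_def)
  have "((\<lambda>i. (1 + sqrt i) * exp (- (d * i))) \<longlongrightarrow> 0) at_top"
    using d(1) by real_asymp
  then have "((\<lambda>i. ((1 + sqrt i) * exp (- (d * i))) ^ k) \<longlongrightarrow> 0 ^ k) at_top"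
    by (rule tendsto_power)
  moreover have "((1 + sqrt i) * exp (- (d * i))) ^ k = (1 + sqrt i) ^ k * exp (- (c * i))" for i
  proof -
    have "exp (- (d * i)) ^ k = exp (- (c * i))"
      unfolding d(2) by (simp add: exp_of_nat_mult[symmetric] mult.assoc)
    then show ?thesis by (simp only: power_mult_distrib)
  qed
  ultimately show ?thesis using False by (simp add: power_0_left)
qed

section \<open>Anderson's inequality on the line\<close>

text \<open>Reflection at \<open>m\<close> folds the line onto the half-line above \<open>m\<close>.\<close>

lemma nn_integral_fold_at:
  fixes g :: "real \<Rightarrow> ennreal"
  assumes [measurable]: "g \<in> borel_measurable borel"
  shows "(\<integral>\<^sup>+v. g v \<partial>lborel) = (\<integral>\<^sup>+v. (g v + g (2 * m - v)) * indicator {m<..} v \<partial>lborel)"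
proof -
  have "(\<integral>\<^sup>+v. g v \<partial>lborel) = (\<integral>\<^sup>+v. g v * indicator {m<..} v + g v * indicator {..<m} v \<partial>lborel)"
    by (rule nn_integral_cong_AE, use AE_lborel_singleton[of m] in eventually_elim)
       (auto split: split_indicator)
  also have "\<dots> = (\<integral>\<^sup>+v. g v * indicator {m<..} v \<partial>lborel) + (\<integral>\<^sup>+v. g v * indicator {..<m} v \<partial>lborel)"
    by (rule nn_integral_add) auto
  also have "(\<integral>\<^sup>+v. g v * indicator {..<m} v \<partial>lborel)
      = (\<integral>\<^sup>+v. g (2 * m - v) * indicator {m<..} v \<partial>lborel)"
    by (subst nn_integral_real_affine[where c = "-1" and t = "2 * m"])
       (auto intro!: nn_integral_cong split: split_indicator)
  finally show ?thesis
    by (subst (asm) nn_integral_add[symmetric]) (auto simp: distrib_right)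
qed

lemma abs_loss: "(\<And>x. \<l> (- x) = \<l> x) \<Longrightarrow> \<l> \<bar>x\<bar> = (\<l> x :: real)" for x :: real
  by (simp add: abs_if)

lemma loss_mono_abs:
  fixes \<l> :: "real \<Rightarrow> real"
  assumes "\<And>x. \<l> (- x) = \<l> x" "mono_on {0..} \<l>" "\<bar>x\<bar> \<le> \<bar>y\<bar>"
  shows "\<l> x \<le> \<l> y"
  using mono_onD[OF assms(2), of "\<bar>x\<bar>" "\<bar>y\<bar>"] assms(3) by (simp add: abs_loss[of \<l>, OF assms(1)])

lemma rearrange_le:
  fixes A A' f f' :: real
  assumes "A' \<le> A" "f \<le> f'"
  shows "A * f + A' * f' \<le> A' * f + A * f'"
proof -
  have "0 \<le> (A - A') * (f' - f)" using assms by simp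
  then show ?thesis by (simp add: algebra_simps)
qed

text \<open>The risk of a location estimate that misses by \<open>h\<close> is \<open>\<integral> \<l>(v - h) f(v) dv\<close>. For a symmetric
  unimodal weight \<open>f\<close> it increases with \<open>\<bar>h\<bar>\<close>. To compare shifts \<open>h \<le> h'\<close>, fold at their
  midpoint: reflection exchanges \<open>\<l>(v - h)\<close> and \<open>\<l>(v - h')\<close>, and above the midpoint the larger
  of these two values is paired with the larger weight exactly in the integral for \<open>h'\<close>.\<close>

context
  fixes \<l> f :: "real \<Rightarrow> real"
  assumes l_meas [measurable]: "\<l> \<in> borel_measurable borel"
    and l_nn: "\<And>x. 0 \<le> \<l> x" and l_sym: "\<And>x. \<l> (- x) = \<l> x" and l_mono: "mono_on {0..} \<l>"
    and f_meas [measurable]: "f \<in> borel_measurable borel"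
    and f_nn: "\<And>x. 0 \<le> f x" and f_dec: "\<And>x y. \<bar>x\<bar> \<le> \<bar>y\<bar> \<Longrightarrow> f y \<le> f x"
begin

lemma smoothed_loss_fold:
  "(\<integral>\<^sup>+v. ennreal (\<l> (v - h) * f v) \<partial>lborel) =
     (\<integral>\<^sup>+v. ennreal (\<l> (v - h) * f v + \<l> (v - h') * f (h + h' - v)) * indicator {(h + h') / 2<..} v \<partial>lborel)"
proof -
  have "\<l> (2 * ((h + h') / 2) - v - h) = \<l> (v - h')" for v
  proof -
    have "2 * ((h + h') / 2) - v - h = - (v - h')" by (simp add: field_simps)
    then show ?thesis using l_sym by metis
  qed
  moreover have "f (2 * ((h + h') / 2) - v) = f (h + h' - v)" for v
    by (rule arg_cong[where f = f]) (simp add: field_simps)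
  ultimately show ?thesis
    by (subst nn_integral_fold_at[where m = "(h + h') / 2"])
       (auto simp: ennreal_plus[symmetric] l_nn f_nn simp del: ennreal_plus intro!: nn_integral_cong)
qed

lemma smoothed_loss_integrand_mono:
  assumes "0 \<le> h" "h \<le> h'" "(h + h') / 2 < v"
  shows "\<l> (v - h) * f v + \<l> (v - h') * f (h + h' - v) \<le> \<l> (v - h') * f v + \<l> (v - h) * f (h + h' - v)"
proof (rule rearrange_le)
  show "\<l> (v - h') \<le> \<l> (v - h)"
    using assms by (intro loss_mono_abs[OF l_sym l_mono]) auto
  show "f v \<le> f (h + h' - v)"
    using assms by (intro f_dec) auto
qed

lemma smoothed_loss_mono:
  assumes "0 \<le> h" "h \<le> h'"
  shows "(\<integral>\<^sup>+v. ennreal (\<l> (v - h) * f v) \<partial>lborel) \<le> (\<integral>\<^sup>+v. ennreal (\<l> (v - h') * f v) \<partial>lborel)"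
  unfolding smoothed_loss_fold[of h h'] smoothed_loss_fold[of h' h]
  by (intro nn_integral_mono)
     (use smoothed_loss_integrand_mono[OF assms] in \<open>auto simp: add.commute split: split_indicator intro!: ennreal_leI\<close>)

lemma smoothed_loss_mono_abs:
  assumes "\<bar>h\<bar> \<le> \<bar>h'\<bar>"
  shows "(\<integral>\<^sup>+v. ennreal (\<l> (v - h) * f v) \<partial>lborel) \<le> (\<integral>\<^sup>+v. ennreal (\<l> (v - h') * f v) \<partial>lborel)"
proof -
  have fs: "f (- x) = f x" for x using f_dec[of x "-x"] f_dec[of "-x" x] by simp
  have "(\<integral>\<^sup>+v. ennreal (\<l> (v - h) * f v) \<partial>lborel) = (\<integral>\<^sup>+v. ennreal (\<l> (v - \<bar>h\<bar>) * f v) \<partial>lborel)" for h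
  proof (cases "0 \<le> h")
    case False
    have "\<l> (- v - h) = \<l> (v + h)" for v using l_sym[of "v + h"] by simp
    with False show ?thesis
      by (subst nn_integral_real_affine[where c = "-1" and t = 0]) (auto simp: fs)
  qed auto
  then show ?thesis using smoothed_loss_mono[of "\<bar>h\<bar>" "\<bar>h'\<bar>"] assms by simp
qed

text \<open>Equality in Anderson's inequality forces equality of the folded integrands almost everywhere.
  Strict monotonicity of the weight turns this into \<open>\<l>(v - e) = \<l>(v)\<close> for almost all
  \<open>v > e / 2\<close>. Near \<open>v = e\<close> the left side is close to \<open>\<l>(0) = 0\<close>, so the monotone function
  \<open>\<l>\<close> vanishes on \<open>[0, e]\<close>, and the periodicity carries this zero outwards in steps of \<open>e / 2\<close>,
  against the assumption that \<open>\<l>\<close> is not identically zero.\<close>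

lemma smoothed_loss_strict:
  assumes fstrict: "\<And>x y. \<bar>x\<bar> < \<bar>y\<bar> \<Longrightarrow> f y < f x"
    and l0: "\<l> 0 = 0" and cont: "isCont \<l> 0" and nz: "\<exists>x. \<l> x \<noteq> 0"
    and fin: "(\<integral>\<^sup>+v. ennreal (\<l> v * f v) \<partial>lborel) < \<infinity>" and e: "0 < e"
  shows "(\<integral>\<^sup>+v. ennreal (\<l> v * f v) \<partial>lborel) < (\<integral>\<^sup>+v. ennreal (\<l> (v - e) * f v) \<partial>lborel)"
proof (rule ccontr)
  define A where "A = (\<lambda>v. ennreal (\<l> (v - 0) * f v + \<l> (v - e) * f (0 + e - v)) * indicator {(0 + e) / 2<..} v)"
  define A' where "A' = (\<lambda>v. ennreal (\<l> (v - e) * f v + \<l> (v - 0) * f (e + 0 - v)) * indicator {(e + 0) / 2<..} v)"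
  have [measurable]: "A \<in> borel_measurable borel" "A' \<in> borel_measurable borel"
    by (auto simp: A_def A'_def)
  have iA: "(\<integral>\<^sup>+v. ennreal (\<l> v * f v) \<partial>lborel) = (\<integral>\<^sup>+v. A v \<partial>lborel)"
    using smoothed_loss_fold[of 0 e] by (simp add: A_def)
  have iA': "(\<integral>\<^sup>+v. ennreal (\<l> (v - e) * f v) \<partial>lborel) = (\<integral>\<^sup>+v. A' v \<partial>lborel)"
    using smoothed_loss_fold[of e 0] by (simp add: A'_def)
  have AA': "A v \<le> A' v" for v
    using smoothed_loss_integrand_mono[of 0 e v] e
    by (auto simp: A_def A'_def split: split_indicator intro!: ennreal_leI)
  assume "\<not> ?thesis"
  then have le: "(\<integral>\<^sup>+v. A' v \<partial>lborel) \<le> (\<integral>\<^sup>+v. A v \<partial>lborel)" using iA iA' by simp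
  have "AE v in lborel. A' v \<le> A v"
  proof -
    have "(\<integral>\<^sup>+v. A' v - A v \<partial>lborel) = (\<integral>\<^sup>+v. A' v \<partial>lborel) - (\<integral>\<^sup>+v. A v \<partial>lborel)"
      using fin iA AA' by (intro nn_integral_diff) auto
    also have "\<dots> = 0" using le fin iA by (subst diff_eq_0_iff_ennreal) (auto intro: le_less_trans)
    finally have "AE v in lborel. A' v - A v = 0"
      by (subst (asm) nn_integral_0_iff_AE) auto
    moreover have "A v < top" for v
      by (auto simp: A_def ennreal_mult_less_top split: split_indicator)
    ultimately show ?thesis
      by (auto simp: diff_eq_0_iff_ennreal elim!: eventually_mono)
  qed
  then have per: "AE v in lborel. e / 2 < v \<longrightarrow> \<l> (v - e) = \<l> v"
  proof eventually_elim
    case (elim v)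
    show ?case
    proof
      assume v: "e / 2 < v"
      have "\<l> (v - e) * f v + \<l> v * f (e - v) \<le> \<l> v * f v + \<l> (v - e) * f (e - v)"
        using elim v l_nn f_nn by (simp add: A_def A'_def ennreal_le_iff del: ennreal_plus)
      then have "(\<l> v - \<l> (v - e)) * (f (e - v) - f v) \<le> 0" by (simp add: algebra_simps)
      moreover have "0 < f (e - v) - f v" using fstrict[of "e - v" v] v e by simp
      ultimately have "\<l> v - \<l> (v - e) \<le> 0" by (simp add: mult_le_0_iff)
      moreover have "\<l> (v - e) \<le> \<l> v"
        using v e by (intro loss_mono_abs[OF l_sym l_mono]) auto
      ultimately show "\<l> (v - e) = \<l> v" by simp
    qed
  qed
  \<comment> \<open>A full set meets every interval, so the periodicity may be used at points of any chosen interval.\<close>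
  have pick: "\<exists>v. a < v \<and> v < b \<and> \<l> (v - e) = \<l> v" if ab: "e / 2 \<le> a" "a < b" for a b
  proof (rule ccontr)
    assume c: "\<not> ?thesis"
    have "AE v in lborel. v \<notin> {a<..<b}" using per
      by eventually_elim (use c that in auto)
    then have "emeasure lborel {a<..<b} = 0"
      by (subst (asm) AE_iff_measurable[where N = "{a<..<b}"]) auto
    then show False using that by simp
  qed
  have le_e: "\<l> e \<le> r" if r: "0 < r" for r
  proof -
    obtain d where d: "0 < d" "\<And>x. \<bar>x\<bar> < d \<Longrightarrow> \<bar>\<l> x - \<l> 0\<bar> < r"
      using cont r unfolding continuous_at_eps_delta dist_real_def diff_zero by metis
    obtain v where v: "e < v" "v < e + d" "\<l> (v - e) = \<l> v" using pick[of e "e + d"] d e by auto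
    have "\<l> e \<le> \<l> v" using v e by (intro loss_mono_abs[OF l_sym l_mono]) auto
    also have "\<dots> = \<l> (v - e)" using v by simp
    also have "\<dots> \<le> r" using d(2)[of "v - e"] v l0 by simp
    finally show ?thesis .
  qed
  have "\<l> e = 0" using le_e l_nn[of e] by (metis dense_ge dual_order.antisym)
  have zero: "\<l> (e + real n * (e / 2)) = 0" for n
  proof (induction n)
    case 0 then show ?case using \<open>\<l> e = 0\<close> by simp
  next
    case (Suc n)
    define c where "c = e + real n * (e / 2)"
    have c: "e \<le> c" "\<l> c = 0" using Suc e by (auto simp: c_def)
    obtain v where v: "c + e / 2 < v" "v < c + e" "\<l> (v - e) = \<l> v"
      using pick[of "c + e / 2" "c + e"] c e by auto
    have "\<l> (c + e / 2) \<le> \<l> v" using v c e by (intro loss_mono_abs[OF l_sym l_mono]) auto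
    also have "\<dots> \<le> \<l> c" using v c e by (subst v(3)[symmetric]) (intro loss_mono_abs[OF l_sym l_mono], auto)
    finally have "\<l> (c + e / 2) = 0" using c l_nn[of "c + e / 2"] by simp
    moreover have "e + real (Suc n) * (e / 2) = c + e / 2" by (simp add: c_def field_simps)
    ultimately show ?case by simp
  qed
  obtain x where x: "\<l> x \<noteq> 0" using nz by blast
  obtain n where n: "\<bar>x\<bar> \<le> real n * (e / 2)" using ex_less_of_nat_mult[of "e / 2" "\<bar>x\<bar>"] e by (auto intro: less_imp_le)
  have "\<l> x \<le> \<l> (e + real n * (e / 2))" using n e by (intro loss_mono_abs[OF l_sym l_mono]) auto
  then show False using zero x l_nn[of x] by (metis dual_order.antisym)
qed

end

section \<open>The Bayes risk as a function of the maximum likelihood estimate\<close>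

text \<open>The likelihood of \<open>\<eta>\<close> given the maximum likelihood estimate \<open>x\<close>, relative to its maximum.\<close>

abbreviation lik :: "real \<Rightarrow> real \<Rightarrow> real \<Rightarrow> real" where
  "lik i x \<eta> \<equiv> exp (- (i * (\<eta> - x)\<^sup>2 / 2))"

lemma ennreal_divide_le_cancel:
  fixes a b c :: ennreal
  assumes "0 < c" "c < \<infinity>"
  shows "a / c \<le> b / c \<longleftrightarrow> a \<le> b"
proof -
  have "inverse c \<noteq> 0" "inverse c \<noteq> top" using assms by (auto simp: ennreal_inverse_eq_0_iff)
  then show ?thesis
    using ennreal_mult_le_mult_iff[of "inverse c" a b] by (simp add: divide_ennreal_def mult.commute)
qed

lemma nn_integral_rescale:
  fixes g :: "real \<Rightarrow> ennreal"
  assumes [measurable]: "g \<in> borel_measurable borel" and "0 < i"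
  shows "(\<integral>\<^sup>+\<eta>. g (sqrt i * (\<eta> - x)) \<partial>lborel) = ennreal (1 / sqrt i) * (\<integral>\<^sup>+v. g v \<partial>lborel)"
  using assms(2) by (subst nn_integral_real_affine[where c = "1 / sqrt i" and t = x]) auto

text \<open>A single finite posterior normalization suffices, since the Gaussian factor is bounded below on
  \<open>(0, 1]\<close>.\<close>

lemma prior_integrable_near_0:
  assumes \<rho>: "\<rho> \<in> priors_Qp" and i: "0 \<le> i" and fin: "posterior_norm \<rho> i x < \<infinity>"
  shows "(\<integral>\<^sup>+\<eta>. ennreal (\<rho> \<eta>) * indicator {0<..1} \<eta> \<partial>lborel) < \<infinity>"
proof -
  have cont: "continuous_on {0<..} \<rho>" and pos: "\<And>x. 0 < x \<Longrightarrow> 0 < \<rho> x" using \<rho> by (auto simp: priors_Qp_def)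
  define c where "c = exp (i * (1 + \<bar>x\<bar>)\<^sup>2 / 2)"
  have "(\<lambda>\<eta>. indicator {0<..} \<eta> *\<^sub>R \<rho> \<eta>) \<in> borel_measurable borel"
    by (rule borel_measurable_continuous_on_indicator[OF _ cont]) simp
  then have "(\<lambda>\<eta>. ennreal (lik i x \<eta> * (indicator {0<..} \<eta> *\<^sub>R \<rho> \<eta>))) \<in> borel_measurable borel"
    by measurable
  also have "(\<lambda>\<eta>. ennreal (lik i x \<eta> * (indicator {0<..} \<eta> *\<^sub>R \<rho> \<eta>))) =
      (\<lambda>\<eta>. ennreal (lik i x \<eta> * \<rho> \<eta>) * indicator {0<..} \<eta>)"
    by (auto split: split_indicator)
  finally have meas: "(\<lambda>\<eta>. ennreal (lik i x \<eta> * \<rho> \<eta>) * indicator {0<..} \<eta>) \<in> borel_measurable lborel" by simp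
  have "(\<integral>\<^sup>+\<eta>. ennreal (\<rho> \<eta>) * indicator {0<..1} \<eta> \<partial>lborel) \<le>
      (\<integral>\<^sup>+\<eta>. ennreal c * (ennreal (lik i x \<eta> * \<rho> \<eta>) * indicator {0<..} \<eta>) \<partial>lborel)"
  proof (rule nn_integral_mono)
    fix \<eta> :: real
    show "ennreal (\<rho> \<eta>) * indicator {0<..1} \<eta> \<le>
        ennreal c * (ennreal (lik i x \<eta> * \<rho> \<eta>) * indicator {0<..} \<eta>)"
    proof (cases "\<eta> \<in> {0<..1}")
      case True
      have "(\<eta> - x)\<^sup>2 \<le> (1 + \<bar>x\<bar>)\<^sup>2" using True by (intro abs_le_square_iff[THEN iffD1]) auto
      then have "i * (\<eta> - x)\<^sup>2 / 2 \<le> i * (1 + \<bar>x\<bar>)\<^sup>2 / 2" using i by (intro divide_right_mono mult_left_mono) auto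
      then have "1 \<le> c * lik i x \<eta>" unfolding c_def exp_add[symmetric] by simp
      then have "1 * \<rho> \<eta> \<le> c * lik i x \<eta> * \<rho> \<eta>" using pos[of \<eta>] True by (intro mult_right_mono) auto
      then have "ennreal (\<rho> \<eta>) \<le> ennreal (c * (lik i x \<eta> * \<rho> \<eta>))" by (intro ennreal_leI) simp
      also have "\<dots> = ennreal c * ennreal (lik i x \<eta> * \<rho> \<eta>)"
        by (rule ennreal_mult') (simp add: c_def)
      finally show ?thesis using True by simp
    qed simp
  qed
  also have "\<dots> = ennreal c * posterior_norm \<rho> i x"
    unfolding posterior_norm_def by (rule nn_integral_cmult[OF meas])
  also have "\<dots> < \<infinity>" using fin by (simp add: ennreal_mult_less_top)
  finally show ?thesis .
qed

text \<open>Throughout, \<open>i\<close> is the Fisher information and \<open>x\<close> the realized maximum likelihood estimate.\<close>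

locale bayes_problem =
  fixes \<rho> \<l> :: "real \<Rightarrow> real"
  assumes prior: "\<rho> \<in> priors_Qp" and loss: "\<l> \<in> losses_Wp"
    and prior_int_0: "(\<integral>\<^sup>+\<eta>. ennreal (\<rho> \<eta>) * indicator {0<..1} \<eta> \<partial>lborel) < \<infinity>"
begin

lemma l_meas [measurable]: "\<l> \<in> borel_measurable borel"
  and l_nn: "\<And>x. 0 \<le> \<l> x" and l_sym: "\<And>x. \<l> (- x) = \<l> x" and l_mono: "mono_on {0..} \<l>"
  and l_0: "\<l> 0 = 0" and l_cont: "isCont \<l> 0" and l_nz: "\<exists>x. \<l> x \<noteq> 0"
  using loss by (auto simp: losses_Wp_def losses_W_def)

lemma l_le: "\<bar>x\<bar> \<le> \<bar>y\<bar> \<Longrightarrow> \<l> x \<le> \<l> y"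
  by (rule loss_mono_abs[OF l_sym l_mono])

lemma rho_cont: "continuous_on {0<..} \<rho>" and rho_pos: "\<And>x. 0 < x \<Longrightarrow> 0 < \<rho> x"
  using prior by (auto simp: priors_Qp_def)

text \<open>The prior extended by zero, so that risks become integrals over the whole line.\<close>

definition r :: "real \<Rightarrow> real" where "r \<eta> = indicator {0<..} \<eta> * \<rho> \<eta>"

lemma r_meas [measurable]: "r \<in> borel_measurable borel"
  using borel_measurable_continuous_on_indicator[OF _ rho_cont] unfolding r_def[abs_def] by simp

lemma r_nn: "0 \<le> r \<eta>"
  using rho_pos[of \<eta>] by (auto simp: r_def split: split_indicator)

lemma r_pos_eq: "0 < \<eta> \<Longrightarrow> r \<eta> = \<rho> \<eta>" and r_nonpos_eq: "\<eta> \<le> 0 \<Longrightarrow> r \<eta> = 0"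
  by (auto simp: r_def)

lemma r_int_0: "(\<integral>\<^sup>+\<eta>. ennreal (r \<eta>) * indicator {0<..1} \<eta> \<partial>lborel) < \<infinity>"
  using prior_int_0 by (rule le_less_trans[rotated], intro nn_integral_mono)
    (auto simp: r_def split: split_indicator)

text \<open>The posterior risk without its normalizing constant, which depends on \<open>i\<close> and \<open>x\<close> but not on
  the estimate and therefore does not affect the minimizer.\<close>

definition raw_risk :: "real \<Rightarrow> real \<Rightarrow> real \<Rightarrow> ennreal" where
  "raw_risk i x \<beta> = (\<integral>\<^sup>+\<eta>. ennreal (\<l> (sqrt i * (\<eta> - \<beta>)) * (lik i x \<eta> * r \<eta>)) \<partial>lborel)"

lemma posterior_risk_eq:
  "posterior_risk \<rho> \<l> i x \<beta> = raw_risk i x \<beta> / posterior_norm \<rho> i x"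
proof -
  have "posterior_risk \<rho> \<l> i x \<beta> =
    (\<integral>\<^sup>+\<eta>. ennreal (\<l> (sqrt i * (\<eta> - \<beta>)) * (lik i x \<eta> * r \<eta>)) / posterior_norm \<rho> i x \<partial>lborel)"
    unfolding posterior_risk_def posterior_density_def
    by (intro nn_integral_cong)
       (auto simp: r_def ennreal_times_divide ennreal_mult' l_nn split: split_indicator)
  also have "\<dots> = raw_risk i x \<beta> / posterior_norm \<rho> i x"
    unfolding raw_risk_def by (rule nn_integral_divide) simp
  finally show ?thesis .
qed

text \<open>The values \<open>x\<close> at which the Bayes estimate is well defined. Almost every outcome of the maximum
  likelihood estimator is of this kind, but the set of these values is not known to be measurable.\<close>

definition good :: "real \<Rightarrow> real \<Rightarrow> bool" where
  "good i x \<longleftrightarrow> 0 < posterior_norm \<rho> i x \<and> posterior_norm \<rho> i x < \<infinity> \<and>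
     (\<exists>!b. is_arg_min (posterior_risk \<rho> \<l> i x) (\<lambda>b. 0 < b) b)"

abbreviation b :: "real \<Rightarrow> real \<Rightarrow> real" where "b \<equiv> bayes_estimator \<rho> \<l>"

lemma
  assumes "good i x"
  shows b_pos: "0 < b i x"
    and b_minimal: "0 < \<beta> \<Longrightarrow> raw_risk i x (b i x) \<le> raw_risk i x \<beta>"
    and b_strict: "0 < \<beta> \<Longrightarrow> \<beta> \<noteq> b i x \<Longrightarrow> raw_risk i x (b i x) < raw_risk i x \<beta>"
proof -
  let ?f = "posterior_risk \<rho> \<l> i x" and ?n = "posterior_norm \<rho> i x"
  have n: "0 < ?n" "?n < \<infinity>" and ex: "\<exists>!b. is_arg_min ?f (\<lambda>b. 0 < b) b"
    using assms by (auto simp: good_def)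
  have am: "is_arg_min ?f (\<lambda>b. 0 < b) (b i x)"
    unfolding bayes_estimator_def arg_min_def using ex by (metis someI_ex)
  then show pos: "0 < b i x" by (simp add: is_arg_min_def)
  have le: "?f \<beta> \<le> ?f \<beta>' \<longleftrightarrow> raw_risk i x \<beta> \<le> raw_risk i x \<beta>'" for \<beta> \<beta>'
    unfolding posterior_risk_eq by (rule ennreal_divide_le_cancel[OF n])
  show min: "raw_risk i x (b i x) \<le> raw_risk i x \<beta>" if "0 < \<beta>" for \<beta>
    using am that unfolding is_arg_min_linorder le[symmetric] by blast
  show "raw_risk i x (b i x) < raw_risk i x \<beta>" if "0 < \<beta>" "\<beta> \<noteq> b i x"
  proof (rule ccontr)
    assume "\<not> ?thesis"
    then have "?f \<beta> \<le> ?f (b i x)" unfolding le by simp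
    then have "is_arg_min ?f (\<lambda>b. 0 < b) \<beta>"
      using am that(1) unfolding is_arg_min_linorder by (meson order_trans)
    then show False using ex am that(2) by blast
  qed
qed

text \<open>On \<open>(0, 1]\<close> the integrand is bounded by a multiple of the prior; beyond \<open>1\<close> it is a polynomial
  times a Gaussian. Finiteness is what allows risks to be subtracted in comparisons of two
  estimates.\<close>

lemma raw_risk_finite:
  assumes "0 < i"
  shows "raw_risk i x \<beta> < \<infinity>"
proof -
  let ?l = "\<lambda>\<eta>. \<l> (sqrt i * (\<eta> - \<beta>))"
  obtain A k where A: "0 \<le> A" "\<And>x. \<l> x \<le> A * (1 + \<bar>x\<bar>) ^ k" using loss_growth[OF loss] by blast
  obtain C m where C: "0 \<le> C" "\<And>x. 1 \<le> x \<Longrightarrow> \<rho> x \<le> C * (1 + \<bar>x\<bar>) ^ m"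
    using prior_growth[OF prior, of 1] by auto
  define D where "D = A * (1 + sqrt i * (1 + \<bar>\<beta>\<bar>)) ^ k"
  define E where "E = A * (1 + sqrt i * \<bar>x - \<beta>\<bar>) ^ k * (C * (1 + \<bar>x\<bar> + 1 / sqrt i) ^ m)"
  define g where "g = (\<lambda>v::real. ennreal E * ennreal (gauss_poly (k + m) (1/2) v))"
  have [measurable]: "g \<in> borel_measurable borel" by (auto simp: g_def)
  have si: "0 < sqrt i" using assms by simp
  have D0: "0 \<le> D" and E0: "0 \<le> E" using A C si by (auto simp: D_def E_def)
  have "raw_risk i x \<beta> \<le> (\<integral>\<^sup>+\<eta>. ennreal D * (ennreal (r \<eta>) * indicator {0<..1} \<eta>) + g (sqrt i * (\<eta> - x)) \<partial>lborel)"
    unfolding raw_risk_def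
  proof (rule nn_integral_mono)
    fix \<eta> :: real
    consider "\<eta> \<le> 0" | "0 < \<eta>" "\<eta> \<le> 1" | "1 < \<eta>" by linarith
    then show "ennreal (?l \<eta> * (lik i x \<eta> * r \<eta>))
      \<le> ennreal D * (ennreal (r \<eta>) * indicator {0<..1} \<eta>) + g (sqrt i * (\<eta> - x))"
    proof cases
      case 1 then show ?thesis by (simp add: r_nonpos_eq)
    next
      case 2
      have "?l \<eta> \<le> A * (1 + \<bar>sqrt i * (\<eta> - \<beta>)\<bar>) ^ k" by (rule A)
      also have "\<dots> \<le> D" unfolding D_def abs_mult
        using 2 si A by (intro mult_left_mono power_mono add_left_mono mult_mono) auto
      finally have "?l \<eta> * (lik i x \<eta> * r \<eta>) \<le> D * (1 * r \<eta>)"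
        using assms D0 by (intro mult_mono mult_right_mono) (auto simp: r_nn l_nn)
      then have "ennreal (?l \<eta> * (lik i x \<eta> * r \<eta>))
          \<le> ennreal D * ennreal (r \<eta>)"
        using D0 by (simp add: ennreal_mult[symmetric] r_nn ennreal_leI)
      then show ?thesis using 2 by (simp add: add_increasing2)
    next
      case 3
      define v where "v = sqrt i * (\<eta> - x)"
      have v: "\<eta> = x + v / sqrt i" "i * (\<eta> - x)\<^sup>2 = v\<^sup>2"
        using si assms by (auto simp: v_def power_mult_distrib)
      have "\<bar>sqrt i * (\<eta> - \<beta>)\<bar> \<le> \<bar>v\<bar> + sqrt i * \<bar>x - \<beta>\<bar>"
      proof -
        have "sqrt i * (\<eta> - \<beta>) = v + sqrt i * (x - \<beta>)" by (simp add: v_def algebra_simps)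
        then show ?thesis using abs_triangle_ineq[of v "sqrt i * (x - \<beta>)"] si by (simp add: abs_mult)
      qed
      have "1 + \<bar>sqrt i * (\<eta> - \<beta>)\<bar> \<le> (1 + sqrt i * \<bar>x - \<beta>\<bar>) * (1 + \<bar>v\<bar>)"
      proof -
        note * = \<open>\<bar>sqrt i * (\<eta> - \<beta>)\<bar> \<le> \<bar>v\<bar> + sqrt i * \<bar>x - \<beta>\<bar>\<close>
        have "0 \<le> \<bar>v\<bar> * (sqrt i * \<bar>x - \<beta>\<bar>)" using si by simp
        moreover have "(1 + sqrt i * \<bar>x - \<beta>\<bar>) * (1 + \<bar>v\<bar>)
            = 1 + (\<bar>v\<bar> + sqrt i * \<bar>x - \<beta>\<bar>) + \<bar>v\<bar> * (sqrt i * \<bar>x - \<beta>\<bar>)"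
          by (simp add: distrib_left distrib_right)
        ultimately show ?thesis using * by linarith
      qed
      then have "(1 + \<bar>sqrt i * (\<eta> - \<beta>)\<bar>) ^ k \<le> (1 + sqrt i * \<bar>x - \<beta>\<bar>) ^ k * (1 + \<bar>v\<bar>) ^ k"
        unfolding power_mult_distrib[symmetric] by (intro power_mono) auto
      then have 31: "?l \<eta> \<le> A * ((1 + sqrt i * \<bar>x - \<beta>\<bar>) ^ k * (1 + \<bar>v\<bar>) ^ k)"
        using A order_trans[OF A(2)] by (meson mult_left_mono)
      have "\<bar>\<eta>\<bar> \<le> \<bar>x\<bar> + \<bar>v\<bar> / sqrt i"
        using abs_triangle_ineq[of x "v / sqrt i"] si by (simp add: v(1))
      moreover have "0 \<le> \<bar>x\<bar> * \<bar>v\<bar> + 1 / sqrt i + \<bar>v\<bar>" using si by auto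
      ultimately have "1 + \<bar>\<eta>\<bar> \<le> (1 + \<bar>x\<bar> + 1 / sqrt i) * (1 + \<bar>v\<bar>)"
        by (simp add: algebra_simps add_divide_distrib)
      then have "(1 + \<bar>\<eta>\<bar>) ^ m \<le> (1 + \<bar>x\<bar> + 1 / sqrt i) ^ m * (1 + \<bar>v\<bar>) ^ m"
        unfolding power_mult_distrib[symmetric] by (intro power_mono) auto
      then have 32: "r \<eta> \<le> C * ((1 + \<bar>x\<bar> + 1 / sqrt i) ^ m * (1 + \<bar>v\<bar>) ^ m)"
        using C(1) order_trans[OF C(2)[of \<eta>]] 3 by (simp add: r_pos_eq mult_left_mono)
      have "?l \<eta> * (lik i x \<eta> * r \<eta>)
        \<le> (A * ((1 + sqrt i * \<bar>x - \<beta>\<bar>) ^ k * (1 + \<bar>v\<bar>) ^ k)) *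
           (lik i x \<eta> * (C * ((1 + \<bar>x\<bar> + 1 / sqrt i) ^ m * (1 + \<bar>v\<bar>) ^ m)))"
        using 31 32 A si by (intro mult_mono mult_left_mono) (auto simp: r_nn l_nn)
      also have "\<dots> = E * (gauss_poly (k + m) (1/2) v)"
        unfolding v(2) E_def by (simp add: power_add)
      finally have "ennreal (?l \<eta> * (lik i x \<eta> * r \<eta>)) \<le> g v"
        unfolding g_def using E0 by (simp add: ennreal_mult[symmetric] ennreal_leI)
      then show ?thesis by (simp add: v_def add_increasing)
    qed
  qed
  also have "\<dots> = ennreal D * (\<integral>\<^sup>+\<eta>. ennreal (r \<eta>) * indicator {0<..1} \<eta> \<partial>lborel) +
      ennreal (1 / sqrt i) * (ennreal E * (\<integral>\<^sup>+v. ennreal (gauss_poly (k + m) (1/2) v) \<partial>lborel))"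
    using assms by (simp add: nn_integral_add nn_integral_cmult nn_integral_rescale) (simp add: g_def nn_integral_cmult)
  also have "\<dots> < \<infinity>"
    using r_int_0 nn_integral_growth_gauss_finite[of "1/2" "k + m"]
    by (simp add: ennreal_mult_less_top)
  finally show ?thesis .
qed

text \<open>A single-crossing argument. If the minimizers were in the wrong order, \<open>\<beta> < \<beta>'\<close>, the loss
  difference \<open>\<l>(sqrt i (\<eta> - \<beta>)) - \<l>(sqrt i (\<eta> - \<beta>'))\<close> would be non-positive below the midpoint
  \<open>m\<close> and non-negative above it. The likelihood ratio between \<open>x'\<close> and \<open>x\<close> is increasing in \<open>\<eta>\<close>;
  normalized to \<open>1\<close> at \<open>m\<close>, it can only increase the integral of this difference. So if \<open>\<beta>\<close> is
  worse than \<open>\<beta>'\<close> at \<open>x\<close>, it is worse at \<open>x'\<close> as well.\<close>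

lemma b_mono:
  assumes i: "0 < i" and g: "good i x" "good i x'" and "x \<le> x'"
  shows "b i x \<le> b i x'"
proof (rule ccontr)
  define \<beta> where "\<beta> = b i x'"
  define \<beta>' where "\<beta>' = b i x"
  assume "\<not> ?thesis"
  then have bb: "\<beta> < \<beta>'" by (simp add: \<beta>_def \<beta>'_def)
  have bp: "0 < \<beta>" "0 < \<beta>'" using b_pos g by (auto simp: \<beta>_def \<beta>'_def)
  define m where "m = (\<beta> + \<beta>') / 2"
  define c where "c = exp (i * (x' - x) * m + i * (x\<^sup>2 - x'\<^sup>2) / 2)"
  have c: "0 < c" by (simp add: c_def)
  define lr where "lr = (\<lambda>\<eta>. exp (i * (x' - x) * (\<eta> - m)))"
  have w': "lik i x' \<eta> = c * lr \<eta> * lik i x \<eta>" for \<eta>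
    unfolding c_def lr_def exp_add[symmetric]
    by (rule arg_cong[where f = exp]) (simp add: field_simps power2_eq_square)
  let ?l = "\<lambda>\<beta> \<eta>. \<l> (sqrt i * (\<eta> - \<beta>))"
  have pt: "?l \<beta>' \<eta> * (lik i x' \<eta> * r \<eta>) +
        c * (?l \<beta> \<eta> * (lik i x \<eta> * r \<eta>))
      \<le> ?l \<beta> \<eta> * (lik i x' \<eta> * r \<eta>) +
        c * (?l \<beta>' \<eta> * (lik i x \<eta> * r \<eta>))" for \<eta>
  proof -
    have "0 \<le> (?l \<beta> \<eta> - ?l \<beta>' \<eta>) * (lr \<eta> - 1)"
    proof (cases "\<eta> \<le> m")
      case True
      have "i * (x' - x) * (\<eta> - m) \<le> 0" using True i assms(4) by (intro mult_nonneg_nonpos) auto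
      then have "lr \<eta> \<le> 1" by (simp add: lr_def)
      moreover have "\<bar>\<eta> - \<beta>\<bar> \<le> \<bar>\<eta> - \<beta>'\<bar>" using True bb by (auto simp: m_def abs_if)
      then have "?l \<beta> \<eta> \<le> ?l \<beta>' \<eta>"
        using i by (intro l_le) (simp add: abs_mult mult_left_mono)
      ultimately show ?thesis by (intro mult_nonpos_nonpos) auto
    next
      case False
      have "0 \<le> i * (x' - x) * (\<eta> - m)" using False i assms(4) by (intro mult_nonneg_nonneg) auto
      then have "1 \<le> lr \<eta>" by (simp add: lr_def)
      moreover have "\<bar>\<eta> - \<beta>'\<bar> \<le> \<bar>\<eta> - \<beta>\<bar>" using False bb by (auto simp: m_def abs_if)
      then have "?l \<beta>' \<eta> \<le> ?l \<beta> \<eta>"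
        using i by (intro l_le) (simp add: abs_mult mult_left_mono)
      ultimately show ?thesis by (intro mult_nonneg_nonneg) auto
    qed
    moreover have "0 \<le> c * lik i x \<eta> * r \<eta>"
      using c r_nn[of \<eta>] by simp
    ultimately have "0 \<le> (c * lik i x \<eta> * r \<eta>) *
        ((?l \<beta> \<eta> - ?l \<beta>' \<eta>) * (lr \<eta> - 1))"
      by (rule mult_nonneg_nonneg[rotated])
    then show ?thesis unfolding w' by (simp add: algebra_simps)
  qed
  have "raw_risk i x' \<beta>' + ennreal c * raw_risk i x \<beta> \<le> raw_risk i x' \<beta> + ennreal c * raw_risk i x \<beta>'"
  proof -
    have "raw_risk i x' s + ennreal c * raw_risk i x t =
       (\<integral>\<^sup>+\<eta>. ennreal (?l s \<eta> * (lik i x' \<eta> * r \<eta>) +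
        c * (?l t \<eta> * (lik i x \<eta> * r \<eta>))) \<partial>lborel)" for s t
      unfolding raw_risk_def using c
      by (simp add: nn_integral_add[symmetric] nn_integral_cmult[symmetric] ennreal_plus ennreal_mult' l_nn r_nn)
    then show ?thesis using pt by (auto intro!: nn_integral_mono ennreal_leI)
  qed
  moreover have "raw_risk i x' \<beta> < raw_risk i x' \<beta>'"
    using b_strict[OF g(2), of \<beta>'] bp bb by (auto simp: \<beta>_def)
  moreover have "raw_risk i x \<beta>' < raw_risk i x \<beta>"
    using b_strict[OF g(1), of \<beta>] bp bb by (auto simp: \<beta>'_def)
  moreover obtain W1 W2 W3 W4 where W: "raw_risk i x' \<beta>' = ennreal W1" "raw_risk i x' \<beta> = ennreal W2"
      "raw_risk i x \<beta>' = ennreal W3" "raw_risk i x \<beta> = ennreal W4" "0 \<le> W1" "0 \<le> W2" "0 \<le> W3" "0 \<le> W4"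
    using raw_risk_finite[OF i, of x' \<beta>'] raw_risk_finite[OF i, of x' \<beta>]
      raw_risk_finite[OF i, of x \<beta>'] raw_risk_finite[OF i, of x \<beta>]
    by (cases "raw_risk i x' \<beta>'"; cases "raw_risk i x' \<beta>"; cases "raw_risk i x \<beta>'"; cases "raw_risk i x \<beta>") auto
  ultimately have "W1 + c * W4 \<le> W2 + c * W3" "W2 < W1" "W3 < W4"
    using c by (simp_all add: W ennreal_mult[symmetric] ennreal_plus[symmetric] ennreal_less_iff
        del: ennreal_plus)
  moreover have "c * W3 < c * W4" using c \<open>W3 < W4\<close> by simp
  ultimately show False by linarith
qed

end

section \<open>Concentration at the maximum likelihood estimate\<close>

context bayes_problem
begin

text \<open>The risk in the local variables \<open>v = sqrt i (\<eta> - x)\<close> and \<open>h = sqrt i (\<beta> - x)\<close>, up to the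
  Jacobian.\<close>

definition local_risk :: "real \<Rightarrow> real \<Rightarrow> real \<Rightarrow> ennreal" where
  "local_risk i x h = (\<integral>\<^sup>+v. ennreal (\<l> (v - h) * (exp (- (v\<^sup>2 / 2)) * r (x + v / sqrt i))) \<partial>lborel)"

lemma raw_risk_eq_local_risk:
  assumes "0 < i"
  shows "raw_risk i x (x + h / sqrt i) = ennreal (1 / sqrt i) * local_risk i x h"
proof -
  have "sqrt i * (\<eta> - (x + h / sqrt i)) = sqrt i * (\<eta> - x) - h" for \<eta>
    using assms by (simp add: field_simps)
  moreover have "i * (\<eta> - x)\<^sup>2 / 2 = (sqrt i * (\<eta> - x))\<^sup>2 / 2" for \<eta>
    using assms by (simp add: power_mult_distrib)
  moreover have "\<eta> = x + sqrt i * (\<eta> - x) / sqrt i" for \<eta>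
    using assms by simp
  ultimately have "raw_risk i x (x + h / sqrt i) = (\<integral>\<^sup>+\<eta>. (\<lambda>v. ennreal (\<l> (v - h) * (exp (- (v\<^sup>2 / 2)) *
      r (x + v / sqrt i)))) (sqrt i * (\<eta> - x)) \<partial>lborel)"
    unfolding raw_risk_def by simp
  also have "\<dots> = ennreal (1 / sqrt i) * local_risk i x h"
    unfolding local_risk_def by (rule nn_integral_rescale[OF _ assms]) simp
  finally show ?thesis .
qed

lemma local_risk_minimal:
  assumes "0 < i" "good i x" "0 < x"
  shows "local_risk i x (sqrt i * (b i x - x)) \<le> local_risk i x 0"
proof -
  have "b i x = x + sqrt i * (b i x - x) / sqrt i" using assms by simp
  then have "raw_risk i x (x + sqrt i * (b i x - x) / sqrt i) \<le> raw_risk i x (x + 0 / sqrt i)"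
    using b_minimal[OF assms(2,3)] by simp
  then show ?thesis
    unfolding raw_risk_eq_local_risk[OF assms(1)] using assms
    by (subst (asm) ennreal_mult_le_mult_iff) auto
qed

text \<open>As the information grows, \<open>local_risk i x h\<close> approaches \<open>\<rho>(x)\<close> times this quantity.\<close>

definition limit_risk :: "real \<Rightarrow> ennreal" where
  "limit_risk h = (\<integral>\<^sup>+v. ennreal (\<l> (v - h) * exp (- (v\<^sup>2 / 2))) \<partial>lborel)"

lemma limit_risk_finite: "limit_risk h < \<infinity>"
proof -
  obtain A k where A: "0 \<le> A" "\<And>x. \<l> x \<le> A * (1 + \<bar>x\<bar>) ^ k" using loss_growth[OF loss] by blast
  have "limit_risk h \<le> (\<integral>\<^sup>+v. ennreal (A * (1 + \<bar>h\<bar>) ^ k) * ennreal (gauss_poly k (1/2) v) \<partial>lborel)"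
    unfolding limit_risk_def
  proof (rule nn_integral_mono)
    fix v :: real
    have "\<bar>v - h\<bar> \<le> \<bar>v\<bar> + \<bar>h\<bar>" "0 \<le> \<bar>v\<bar> * \<bar>h\<bar>" by auto
    then have "1 + \<bar>v - h\<bar> \<le> (1 + \<bar>h\<bar>) * (1 + \<bar>v\<bar>)" by (simp only: distrib_left distrib_right mult.commute)
    then have "(1 + \<bar>v - h\<bar>) ^ k \<le> (1 + \<bar>h\<bar>) ^ k * (1 + \<bar>v\<bar>) ^ k"
      unfolding power_mult_distrib[symmetric] by (intro power_mono) auto
    then have "\<l> (v - h) \<le> A * ((1 + \<bar>h\<bar>) ^ k * (1 + \<bar>v\<bar>) ^ k)"
      using A order_trans[OF A(2)] by (meson mult_left_mono)
    then have "\<l> (v - h) * exp (- (v\<^sup>2 / 2)) \<le> (A * (1 + \<bar>h\<bar>) ^ k) * (gauss_poly k (1/2) v)"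
      by (simp add: mult.assoc[symmetric])
    then show "ennreal (\<l> (v - h) * exp (- (v\<^sup>2 / 2))) \<le>
        ennreal (A * (1 + \<bar>h\<bar>) ^ k) * ennreal (gauss_poly k (1/2) v)"
      using A(1) by (subst ennreal_mult[symmetric]) (auto intro: ennreal_leI)
  qed
  also have "\<dots> < \<infinity>"
    using nn_integral_growth_gauss_finite[of "1/2" k] by (simp add: nn_integral_cmult ennreal_mult_less_top)
  finally show ?thesis .
qed

lemma limit_risk_strict: "0 < e \<Longrightarrow> limit_risk 0 < limit_risk e"
  using smoothed_loss_strict[OF l_meas l_nn l_sym l_mono, of "\<lambda>v. exp (- (v\<^sup>2 / 2))" e]
    limit_risk_finite[of 0] l_0 l_cont l_nz
  by (auto simp: limit_risk_def abs_le_square_iff not_le[symmetric])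

text \<open>Truncating the Gaussian to \<open>[-V, V]\<close> leaves a unimodal weight, so Anderson's inequality still
  applies and bounds the risk from below uniformly over all \<open>\<bar>h\<bar> \<ge> e\<close>, also for unbounded \<open>h\<close>.\<close>

lemma local_risk_lower:
  assumes "0 \<le> c" "0 \<le> e" "e \<le> \<bar>h\<bar>" and lb: "\<And>v. \<bar>v\<bar> \<le> V \<Longrightarrow> c \<le> r (x + v / sqrt i)"
  shows "ennreal c * (\<integral>\<^sup>+v. ennreal (\<l> (v - e) * (exp (- (v\<^sup>2 / 2)) * indicator {-V..V} v)) \<partial>lborel) \<le> local_risk i x h"
proof -
  let ?f = "\<lambda>v. exp (- (v\<^sup>2 / 2)) * indicator {-V..V} v :: real"
  have "(\<integral>\<^sup>+v. ennreal (\<l> (v - e) * ?f v) \<partial>lborel) \<le> (\<integral>\<^sup>+v. ennreal (\<l> (v - h) * ?f v) \<partial>lborel)"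
  proof (rule smoothed_loss_mono_abs[OF l_meas l_nn l_sym l_mono])
    show "?f y \<le> ?f x" if "\<bar>x\<bar> \<le> \<bar>y\<bar>" for x y
      using that by (auto simp: abs_le_square_iff[symmetric] split: split_indicator)
  qed (use assms in auto)
  then have "ennreal c * (\<integral>\<^sup>+v. ennreal (\<l> (v - e) * ?f v) \<partial>lborel)
      \<le> ennreal c * (\<integral>\<^sup>+v. ennreal (\<l> (v - h) * ?f v) \<partial>lborel)"
    by (rule mult_left_mono) simp
  also have "\<dots> = (\<integral>\<^sup>+v. ennreal c * ennreal (\<l> (v - h) * ?f v) \<partial>lborel)"
    by (rule nn_integral_cmult[symmetric]) simp
  also have "\<dots> \<le> local_risk i x h"
    unfolding local_risk_def
  proof (rule nn_integral_mono)
    fix v :: real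
    show "ennreal c * ennreal (\<l> (v - h) * ?f v) \<le> ennreal (\<l> (v - h) * (exp (- (v\<^sup>2 / 2)) * r (x + v / sqrt i)))"
    proof (cases "\<bar>v\<bar> \<le> V")
      case True
      have "c * (\<l> (v - h) * exp (- (v\<^sup>2 / 2))) \<le> r (x + v / sqrt i) * (\<l> (v - h) * exp (- (v\<^sup>2 / 2)))"
        using lb[OF True] l_nn by (intro mult_right_mono) auto
      then show ?thesis
        using True assms(1) l_nn by (auto simp: ennreal_mult[symmetric] ac_simps abs_le_iff intro!: ennreal_leI)
    next
      case False
      then have "v \<notin> {-V..V}" by auto
      then show ?thesis by simp
    qed
  qed
  finally show ?thesis .
qed

text \<open>Three ranges of \<open>v\<close> contribute to the upper bound: for \<open>\<bar>v\<bar> \<le> V\<close> the prior is nearly constant;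
  beyond, as long as \<open>\<eta> = x + v / sqrt i\<close> stays away from \<open>0\<close>, the prior is polynomially bounded and
  \<open>G\<close> is a Gaussian majorant; near \<open>\<eta> = 0\<close>, where the prior may be unbounded, the Gaussian factor
  is exponentially small in \<open>i\<close>, and \<open>U\<close> collects that contribution.\<close>

lemma local_risk_0_upper:
  assumes a: "0 < a" "a \<le> d"
  shows "\<exists>G U. G \<in> borel_measurable borel \<and> (\<integral>\<^sup>+v. G v \<partial>lborel) < \<infinity> \<and> (U \<longlongrightarrow> 0) at_top \<and>
     (\<forall>V i x c. 1 \<le> i \<and> a \<le> x \<and> x \<le> d \<and> 0 \<le> c \<and> (\<forall>v. \<bar>v\<bar> \<le> V \<longrightarrow> r (x + v / sqrt i) \<le> c) \<longrightarrow>
        local_risk i x 0 \<le> ennreal c * limit_risk 0 + nn_tail G V + ennreal (U i))"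
proof -
  obtain A k where A: "0 \<le> A" "\<And>x. \<l> x \<le> A * (1 + \<bar>x\<bar>) ^ k" using loss_growth[OF loss] by blast
  define a0 where "a0 = min (a / 2) 1"
  have a0: "0 < a0" "a0 \<le> a / 2" "a0 \<le> 1" using a by (auto simp: a0_def)
  obtain C m where C: "0 \<le> C" "\<And>x. a0 \<le> x \<Longrightarrow> \<rho> x \<le> C * (1 + \<bar>x\<bar>) ^ m"
    using prior_growth[OF prior a0(1)] by auto
  define g where "g = (\<lambda>\<eta>. ennreal (r \<eta>) * indicator {0<..1} \<eta>)"
  have [measurable]: "g \<in> borel_measurable borel" by (simp add: g_def)
  obtain P0 where P0: "(\<integral>\<^sup>+\<eta>. g \<eta> \<partial>lborel) = ennreal P0" "0 \<le> P0"
    using r_int_0 unfolding g_def by (metis ennreal_enn2real_if enn2real_nonneg infinity_ennreal_def less_irrefl)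
  define E where "E = A * C * (1 + d) ^ m"
  define G where "G = (\<lambda>v::real. ennreal E * ennreal (gauss_poly (k + m) (1/2) v))"
  define U where "U = (\<lambda>i. (A * (1 + d) ^ k * P0) * ((1 + sqrt i) ^ (k + 1) * exp (- (a\<^sup>2 / 8 * i))))"
  have E0: "0 \<le> E" using A C a by (simp add: E_def)
  have G_meas [measurable]: "G \<in> borel_measurable borel" by (simp add: G_def)
  have G_fin: "(\<integral>\<^sup>+v. G v \<partial>lborel) < \<infinity>"
    unfolding G_def using nn_integral_growth_gauss_finite[of "1/2" "k + m"]
    by (simp add: nn_integral_cmult ennreal_mult_less_top)
  have U_lim: "(U \<longlongrightarrow> 0) at_top"
    unfolding U_def using tendsto_mult_left[OF sqrt_growth_exp_tendsto_0[of "a\<^sup>2 / 8" "k + 1"], of "A * (1 + d) ^ k * P0"] a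
    by simp
  have main: "local_risk i x 0 \<le> ennreal c * limit_risk 0 + nn_tail G V + ennreal (U i)"
    if i: "1 \<le> i" and x: "a \<le> x" "x \<le> d" and c: "0 \<le> c" and le_c: "\<And>v. \<bar>v\<bar> \<le> V \<Longrightarrow> r (x + v / sqrt i) \<le> c"
    for V i x c
  proof -
    define L where "L = A * (1 + sqrt i * d) ^ k * exp (- (a\<^sup>2 / 8 * i))"
    have si: "1 \<le> sqrt i" using i by simp
    have L0: "0 \<le> L" using A a si by (simp add: L_def)
    have "local_risk i x 0 \<le> (\<integral>\<^sup>+v. ennreal c * ennreal (\<l> (v - 0) * exp (- (v\<^sup>2 / 2))) + G v * indicator {v. V < \<bar>v\<bar>} v
        + ennreal L * g (x + v / sqrt i) \<partial>lborel)"
      unfolding local_risk_def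
    proof (rule nn_integral_mono)
      fix v :: real
      define \<eta> where "\<eta> = x + v / sqrt i"
      have v: "v = sqrt i * (\<eta> - x)" using si by (simp add: \<eta>_def)
      let ?lhs = "ennreal (\<l> (v - 0) * (exp (- (v\<^sup>2 / 2)) * r \<eta>))"
      let ?rhs = "ennreal c * ennreal (\<l> (v - 0) * exp (- (v\<^sup>2 / 2))) + G v * indicator {v. V < \<bar>v\<bar>} v + ennreal L * g \<eta>"
      consider "\<eta> \<le> 0" | "\<bar>v\<bar> \<le> V" | "0 < \<eta>" "\<eta> < a0" | "V < \<bar>v\<bar>" "a0 \<le> \<eta>" by linarith
      then show "ennreal (\<l> (v - 0) * (exp (- (v\<^sup>2 / 2)) * r (x + v / sqrt i))) \<le>
        ennreal c * ennreal (\<l> (v - 0) * exp (- (v\<^sup>2 / 2))) + G v * indicator {v. V < \<bar>v\<bar>} v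
          + ennreal L * g (x + v / sqrt i)"
        unfolding \<eta>_def[symmetric]
      proof cases
        case 1 then show "?lhs \<le> ?rhs"
          by (simp add: r_nonpos_eq)
      next
        case 2
        have "(\<l> v * exp (- (v\<^sup>2 / 2))) * r \<eta> \<le> (\<l> v * exp (- (v\<^sup>2 / 2))) * c"
          using le_c[OF 2] l_nn by (intro mult_left_mono) (auto simp: \<eta>_def)
        then have "ennreal (\<l> (v - 0) * (exp (- (v\<^sup>2 / 2)) * r \<eta>)) \<le> ennreal c * ennreal (\<l> (v - 0) * exp (- (v\<^sup>2 / 2)))"
          using c l_nn by (auto simp: ennreal_mult[symmetric] ac_simps intro!: ennreal_leI)
        then show "?lhs \<le> ?rhs"
          by (simp add: add_increasing2)
      next
        case 3
        have "\<bar>v\<bar> = sqrt i * (x - \<eta>)" using 3 a0 x si by (simp add: v abs_mult)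
        moreover have "sqrt i * (x - \<eta>) \<le> sqrt i * d" "sqrt i * (a / 2) \<le> sqrt i * (x - \<eta>)"
          using 3 a0 x si by (auto intro!: mult_left_mono)
        ultimately have vd: "\<bar>v\<bar> \<le> sqrt i * d" and va: "sqrt i * (a / 2) \<le> \<bar>v\<bar>" by auto
        have "\<l> v \<le> A * (1 + sqrt i * d) ^ k"
          using A(2)[of v] vd A(1) by (smt (verit) mult_left_mono power_mono)
        moreover have "(sqrt i * (a / 2))\<^sup>2 \<le> v\<^sup>2"
          using va a si by (metis abs_ge_zero abs_le_square_iff abs_of_nonneg divide_nonneg_pos less_eq_real_def
              mult_nonneg_nonneg order_trans zero_less_numeral zero_le_one)
        then have "i * a\<^sup>2 / 4 \<le> v\<^sup>2" using i by (simp add: power_mult_distrib power_divide)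
        then have "exp (- (v\<^sup>2 / 2)) \<le> exp (- (a\<^sup>2 / 8 * i))" by (simp add: mult.commute)
        ultimately have "\<l> v * exp (- (v\<^sup>2 / 2)) \<le> L"
          unfolding L_def using A a si l_nn by (intro mult_mono) auto
        then have "(\<l> v * exp (- (v\<^sup>2 / 2))) * r \<eta> \<le> L * r \<eta>" by (intro mult_right_mono) (auto simp: r_nn)
        then have "ennreal (\<l> (v - 0) * (exp (- (v\<^sup>2 / 2)) * r \<eta>)) \<le> ennreal L * g \<eta>"
          using 3 a0 L0 r_nn by (auto simp: g_def ennreal_mult[symmetric] ac_simps intro!: ennreal_leI)
        then show "?lhs \<le> ?rhs"
          by (simp add: add_increasing)
      next
        case 4
        have "\<bar>v / sqrt i\<bar> \<le> \<bar>v\<bar>" 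
          using si by (simp add: abs_divide divide_le_eq mult_le_cancel_left1)
        then have "\<bar>\<eta>\<bar> \<le> d + \<bar>v\<bar>"
          using abs_triangle_ineq[of x "v / sqrt i"] x a unfolding \<eta>_def by linarith
        moreover have "0 \<le> d * \<bar>v\<bar>" using a by simp
        ultimately have "1 + \<bar>\<eta>\<bar> \<le> (1 + d) * (1 + \<bar>v\<bar>)" by (simp add: distrib_left distrib_right)
        then have "(1 + \<bar>\<eta>\<bar>) ^ m \<le> (1 + d) ^ m * (1 + \<bar>v\<bar>) ^ m"
          unfolding power_mult_distrib[symmetric] by (intro power_mono) auto
        then have 41: "r \<eta> \<le> C * ((1 + d) ^ m * (1 + \<bar>v\<bar>) ^ m)"
          using C(1) order_trans[OF C(2)[of \<eta>]] 4 a0 by (simp add: r_pos_eq mult_left_mono)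
        have "\<l> v * (exp (- (v\<^sup>2 / 2)) * r \<eta>) \<le> (A * (1 + \<bar>v\<bar>) ^ k) * (exp (- (v\<^sup>2 / 2)) * (C * ((1 + d) ^ m * (1 + \<bar>v\<bar>) ^ m)))"
          using A(1) A(2)[of v] 41 by (intro mult_mono mult_left_mono) (auto simp: r_nn l_nn)
        also have "\<dots> = E * (gauss_poly (k + m) (1/2) v)"
          unfolding E_def by (simp add: power_add)
        finally have "ennreal (\<l> (v - 0) * (exp (- (v\<^sup>2 / 2)) * r \<eta>)) \<le> G v * indicator {v. V < \<bar>v\<bar>} v"
          unfolding G_def using E0 4 by (simp add: ennreal_mult[symmetric] ennreal_leI)
        then show "?lhs \<le> ?rhs"
          by (simp add: add_increasing add_increasing2)
      qed
    qed
    also have "\<dots> = ennreal c * limit_risk 0 + nn_tail G V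
        + ennreal L * (\<integral>\<^sup>+v. g (x + v / sqrt i) \<partial>lborel)"
      unfolding limit_risk_def by (simp add: nn_integral_add nn_integral_cmult)
    also have "(\<integral>\<^sup>+v. g (x + v / sqrt i) \<partial>lborel) = ennreal (sqrt i * P0)"
    proof -
      have "ennreal P0 = ennreal (1 / sqrt i) * (\<integral>\<^sup>+v. g (x + v / sqrt i) \<partial>lborel)"
        using P0 nn_integral_real_affine[of g "1 / sqrt i" x] si by simp
      then have "ennreal (sqrt i) * ennreal P0 = ennreal (sqrt i * (1 / sqrt i)) * (\<integral>\<^sup>+v. g (x + v / sqrt i) \<partial>lborel)"
        using si by (simp add: ennreal_mult[symmetric] mult.assoc[symmetric] del: ennreal_1)
      then show ?thesis using si P0 by (simp add: ennreal_mult)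
    qed
    also have "ennreal L * ennreal (sqrt i * P0) \<le> ennreal (U i)"
    proof -
      have "1 + sqrt i * d \<le> (1 + d) * (1 + sqrt i)" using a si by (simp add: algebra_simps)
      then have "(1 + sqrt i * d) ^ k \<le> (1 + d) ^ k * (1 + sqrt i) ^ k"
        unfolding power_mult_distrib[symmetric] using a si by (intro power_mono) auto
      then have "(1 + sqrt i * d) ^ k * sqrt i \<le> ((1 + d) ^ k * (1 + sqrt i) ^ k) * (1 + sqrt i)"
        using a si by (intro mult_mono) auto
      then have "(A * P0 * exp (- (a\<^sup>2 / 8 * i))) * ((1 + sqrt i * d) ^ k * sqrt i) \<le>
         (A * P0 * exp (- (a\<^sup>2 / 8 * i))) * (((1 + d) ^ k * (1 + sqrt i) ^ k) * (1 + sqrt i))"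
        using A P0 by (intro mult_left_mono) auto
      then have "L * (sqrt i * P0) \<le> U i" unfolding L_def U_def by (simp add: mult_ac)
      then show ?thesis using L0 si P0 by (simp add: ennreal_mult[symmetric] ennreal_leI)
    qed
    finally show ?thesis by (simp add: add_left_mono)
  qed
  show ?thesis
    by (intro exI[of _ G] exI[of _ U]) (use G_meas G_fin U_lim main in blast)
qed

text \<open>Suppose that \<open>h = sqrt i (b - x)\<close> satisfies \<open>\<bar>h\<bar> \<ge> e\<close>. Minimality gives
  \<open>local_risk i x h \<le> local_risk i x 0\<close>. The left side is almost at least
  \<open>\<rho>(x) limit_risk e\<close>, the right side almost at most \<open>\<rho>(x) limit_risk 0\<close>, and the gap between
  these is bounded below because \<open>\<rho>\<close> is bounded away from \<open>0\<close> on the compact interval.\<close>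

lemma b_close:
  assumes a: "0 < a" "a \<le> d" and e: "0 < e"
  shows "\<exists>I0\<ge>1. \<forall>i\<ge>I0. \<forall>x. a \<le> x \<longrightarrow> x \<le> d \<longrightarrow> good i x \<longrightarrow> \<bar>sqrt i * (b i x - x)\<bar> < e"
proof -
  obtain G U where GU: "G \<in> borel_measurable borel \<and> (\<integral>\<^sup>+v. G v \<partial>lborel) < \<infinity> \<and> (U \<longlongrightarrow> 0) at_top \<and>
     (\<forall>V i x c. 1 \<le> i \<and> a \<le> x \<and> x \<le> d \<and> 0 \<le> c \<and> (\<forall>v. \<bar>v\<bar> \<le> V \<longrightarrow> r (x + v / sqrt i) \<le> c) \<longrightarrow>
        local_risk i x 0 \<le> ennreal c * limit_risk 0 + nn_tail G V + ennreal (U i))"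
    using local_risk_0_upper[OF a] by (elim exE)
  have G_meas [measurable]: "G \<in> borel_measurable borel" and G_fin: "(\<integral>\<^sup>+v. G v \<partial>lborel) < \<infinity>"
    and U_lim: "(U \<longlongrightarrow> 0) at_top"
    using GU by simp_all
  note upper = GU[THEN conjunct2, THEN conjunct2, THEN conjunct2, rule_format, OF conjI[OF _ conjI[OF _ conjI[OF _ conjI]]]]
  obtain J0 where J0: "limit_risk 0 = ennreal J0" "0 \<le> J0" using limit_risk_finite[of 0] by (cases "limit_risk 0") auto
  obtain Je where Je: "limit_risk e = ennreal Je" "0 \<le> Je" using limit_risk_finite[of e] by (cases "limit_risk e") auto
  have JJ: "J0 < Je" using limit_risk_strict[OF e] J0 Je by (simp add: ennreal_less_iff)
  define g where "g = Je - J0"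
  have g: "0 < g" "g \<le> Je" using JJ J0 by (auto simp: g_def)
  have Je_pos: "0 < Je" using JJ J0 by simp
  have cont_K: "continuous_on {a/2..d+1} \<rho>" using a by (intro continuous_on_subset[OF rho_cont]) auto
  obtain x0 where x0: "x0 \<in> {a..d}" "\<And>x. x \<in> {a..d} \<Longrightarrow> \<rho> x0 \<le> \<rho> x"
    using continuous_attains_inf[of "{a..d}" \<rho>] continuous_on_subset[OF cont_K, of "{a..d}"] a by auto
  define \<rho>m where "\<rho>m = \<rho> x0"
  have \<rho>m: "0 < \<rho>m" "\<And>x. a \<le> x \<Longrightarrow> x \<le> d \<Longrightarrow> \<rho>m \<le> \<rho> x"
    using x0 a rho_pos[of x0] by (auto simp: \<rho>m_def)
  obtain V1 where V1: "\<And>R. V1 \<le> R \<Longrightarrow>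
      nn_tail (\<lambda>v. ennreal (\<l> (v - e) * exp (- (v\<^sup>2 / 2)))) R < ennreal (g / 4)"
    using nn_integral_tail_small[of "\<lambda>v. ennreal (\<l> (v - e) * exp (- (v\<^sup>2 / 2)))" "ennreal (g / 4)"]
      limit_risk_finite[of e] g unfolding limit_risk_def by (auto simp: ennreal_lessI)
  obtain V2 where V2: "0 \<le> V2" "\<And>R. V2 \<le> R \<Longrightarrow>
      nn_tail G R < ennreal (\<rho>m * g / 8)"
    using nn_integral_tail_small[of G "ennreal (\<rho>m * g / 8)"] G_fin g \<rho>m(1) by auto
  define V where "V = max V1 V2"
  have V0: "0 \<le> V" using V2 by (simp add: V_def)
  define JV where "JV = (\<integral>\<^sup>+v. ennreal (\<l> (v - e) * (exp (- (v\<^sup>2 / 2)) * indicator {-V..V} v)) \<partial>lborel)"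
  have JV_le: "JV \<le> limit_risk e" unfolding JV_def limit_risk_def
    by (intro nn_integral_mono) (auto simp: l_nn split: split_indicator)
  obtain Jv where Jv: "JV = ennreal Jv" "0 \<le> Jv" using JV_le limit_risk_finite[of e] by (cases JV) (auto simp: top_unique)
  have Jv_le: "Jv \<le> Je" using JV_le Je Jv by simp
  have Jv_ge: "Je - g / 4 \<le> Jv"
  proof -
    have "limit_risk e \<le> (\<integral>\<^sup>+v. ennreal (\<l> (v - e) * (exp (- (v\<^sup>2 / 2)) * indicator {-V..V} v)) +
        ennreal (\<l> (v - e) * exp (- (v\<^sup>2 / 2))) * indicator {v. V < \<bar>v\<bar>} v \<partial>lborel)"
      unfolding limit_risk_def by (intro nn_integral_mono) (auto split: split_indicator)
    also have "\<dots> = JV + nn_tail (\<lambda>v. ennreal (\<l> (v - e) * exp (- (v\<^sup>2 / 2)))) V"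
      unfolding JV_def by (rule nn_integral_add) auto
    also have "\<dots> \<le> JV + ennreal (g / 4)"
      using V1[of V] by (intro add_left_mono) (auto simp: V_def intro: less_imp_le)
    finally show ?thesis using Je Jv g by (simp add: ennreal_plus[symmetric] del: ennreal_plus)
  qed
  \<comment> \<open>With this \<open>\<delta>\<close> the errors sum to \<open>\<rho>m * g / 2\<close>, below the available gap \<open>\<rho>m * 3 * g / 4\<close>.\<close>
  define \<delta> where "\<delta> = \<rho>m * g / (8 * Je)"
  have \<delta>: "0 < \<delta>" "\<delta> \<le> \<rho>m" "2 * \<delta> * Je = \<rho>m * g / 4"
    using \<rho>m g Je_pos by (auto simp: \<delta>_def divide_le_eq)
  have "uniformly_continuous_on {a/2..d+1} \<rho>"
    by (rule compact_uniformly_continuous[OF cont_K]) simp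
  then obtain t where t: "0 < t" "\<And>x y. x \<in> {a/2..d+1} \<Longrightarrow> y \<in> {a/2..d+1} \<Longrightarrow> dist y x < t \<Longrightarrow> dist (\<rho> y) (\<rho> x) < \<delta>"
    using \<delta>(1) unfolding uniformly_continuous_on_def by metis
  define s where "s = min t (min (a / 2) 1)"
  have s: "0 < s" using t a by (simp add: s_def)
  have "\<forall>\<^sub>F i in at_top. U i < \<rho>m * g / 8"
    using U_lim by (rule order_tendstoD) (use \<rho>m g in auto)
  then obtain I1 where I1: "\<And>i. I1 \<le> i \<Longrightarrow> U i < \<rho>m * g / 8" by (auto simp: eventually_at_top_linorder)
  define I0 where "I0 = max 1 (max I1 ((V / s + 1)\<^sup>2))"
  have "\<bar>sqrt i * (b i x - x)\<bar> < e" if i: "I0 \<le> i" and x: "a \<le> x" "x \<le> d" and gd: "good i x" for i x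
  proof (rule ccontr)
    assume "\<not> ?thesis"
    then have h: "e \<le> \<bar>sqrt i * (b i x - x)\<bar>" by simp
    have i1: "1 \<le> i" "I1 \<le> i" "(V / s + 1)\<^sup>2 \<le> i" using i by (auto simp: I0_def)
    have si: "1 \<le> sqrt i" using i1 by simp
    have "V / s + 1 \<le> sqrt i" using i1(3) by (rule real_le_rsqrt)
    then have "V / s < sqrt i" by simp
    then have Vs: "V / sqrt i < s" using s si by (simp add: field_simps)
    have near: "\<bar>r (x + v / sqrt i) - \<rho> x\<bar> < \<delta>" if v: "\<bar>v\<bar> \<le> V" for v
    proof -
      have "\<bar>v / sqrt i\<bar> \<le> V / sqrt i" using v si by (simp add: divide_right_mono)
      then have vs: "\<bar>v / sqrt i\<bar> < s" using Vs by simp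
      then have "\<bar>v / sqrt i\<bar> < t" "\<bar>v / sqrt i\<bar> < a / 2" "\<bar>v / sqrt i\<bar> < 1" by (auto simp: s_def)
      then have in_K: "x + v / sqrt i \<in> {a/2..d+1}" and tt: "dist (x + v / sqrt i) x < t"
        using x unfolding dist_real_def atLeastAtMost_iff by linarith+
      have "dist (\<rho> (x + v / sqrt i)) (\<rho> x) < \<delta>"
        using t(2)[OF _ in_K tt] x a by auto
      moreover have "0 < x + v / sqrt i" using in_K a unfolding atLeastAtMost_iff by linarith
      ultimately show ?thesis by (simp add: r_pos_eq dist_real_def)
    qed
    have xpos: "0 < x" using x a by simp
    have rx: "\<rho>m \<le> \<rho> x" using \<rho>m x by simp
    have near1: "\<rho> x - \<delta> \<le> r (x + v / sqrt i)" and near2: "r (x + v / sqrt i) \<le> \<rho> x + \<delta>" if "\<bar>v\<bar> \<le> V" for v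
      using near[OF that] by auto
    have c0: "0 \<le> \<rho> x - \<delta>" "0 \<le> \<rho> x + \<delta>" using rx \<delta> by auto
    have "ennreal ((\<rho> x - \<delta>) * Jv) = ennreal (\<rho> x - \<delta>) * JV"
      using Jv rx \<delta> by (simp add: ennreal_mult)
    also have "\<dots> \<le> local_risk i x (sqrt i * (b i x - x))"
      unfolding JV_def by (rule local_risk_lower[OF c0(1) less_imp_le[OF e] h near1])
    also have "\<dots> \<le> local_risk i x 0" using local_risk_minimal[of i x] gd xpos i1 by simp
    also have "\<dots> \<le> ennreal (\<rho> x + \<delta>) * limit_risk 0 + nn_tail G V + ennreal (U i)"
      by (rule upper[OF i1(1) x c0(2)]) (use near2 in blast)
    also have "\<dots> \<le> ennreal (\<rho> x + \<delta>) * limit_risk 0 + ennreal (\<rho>m * g / 8) + ennreal (\<rho>m * g / 8)"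
      using V2(2)[of V] I1[OF i1(2)] by (intro add_mono) (auto simp: V_def intro: less_imp_le ennreal_leI)
    also have "\<dots> = ennreal ((\<rho> x + \<delta>) * J0 + \<rho>m * g / 8 + \<rho>m * g / 8)"
      using J0 rx \<delta> \<rho>m g by (simp add: ennreal_mult[symmetric] ennreal_plus[symmetric] del: ennreal_plus)
    finally have "(\<rho> x - \<delta>) * Jv \<le> (\<rho> x + \<delta>) * J0 + \<rho>m * g / 8 + \<rho>m * g / 8"
      using J0 rx \<delta> \<rho>m g by (subst (asm) ennreal_le_iff) auto
    then have "\<rho> x * (Jv - J0) \<le> \<delta> * (Jv + J0) + \<rho>m * g / 4" by (simp add: algebra_simps)
    also have "\<delta> * (Jv + J0) \<le> \<delta> * (Je + Je)" using \<delta> Jv_le JJ by (intro mult_left_mono) auto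
    also have "\<delta> * (Je + Je) = \<rho>m * g / 4" using \<delta>(3) by simp
    finally have 1: "\<rho> x * (Jv - J0) \<le> \<rho>m * g / 2" by simp
    have "\<rho>m * (3 / 4 * g) \<le> \<rho> x * (Jv - J0)"
    proof (rule mult_mono)
      show "3 / 4 * g \<le> Jv - J0" using Jv_ge by (simp add: g_def field_simps)
    qed (use rx g \<rho>m in auto)
    with 1 have "\<rho>m * g * (3/4) \<le> \<rho>m * g * (1/2)" by simp
    moreover have "0 < \<rho>m * g" using \<rho>m g by simp
    ultimately show False by simp
  qed
  then show ?thesis by (intro exI[of _ I0]) (auto simp: I0_def)
qed

text \<open>Compare an estimate \<open>\<beta> > 6 x\<close> with the fixed estimate \<open>X0 \<le> x\<close>. The fixed one can lose more only
  where \<open>\<eta> > 3 x\<close>; there \<open>(\<eta> - x)\<^sup>2 \<ge> \<eta>\<^sup>2 / 3 + x\<^sup>2\<close>, so that the excess is \<open>exp (- i x\<^sup>2 / 2)\<close>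
  times a Gaussian tail. On an interval \<open>S\<close> of length of order \<open>1 / sqrt i\<close> just below \<open>X0\<close> it
  loses less, by an amount of order \<open>exp (- i x\<^sup>2 / 2) / sqrt i\<close>. After rescaling, the tail carries the
  same factor \<open>1 / sqrt i\<close>, so the gain dominates uniformly in \<open>x\<close>.\<close>

lemma b_le_6:
  assumes X0: "0 < X0"
  shows "\<exists>I0\<ge>1. \<forall>i\<ge>I0. \<forall>x\<ge>X0. good i x \<longrightarrow> b i x \<le> 6 * x"
proof -
  obtain A k where A: "0 \<le> A" "\<And>x. \<l> x \<le> A * (1 + \<bar>x\<bar>) ^ k" using loss_growth[OF loss] by blast
  obtain C m where C: "0 \<le> C" "\<And>x. X0 \<le> x \<Longrightarrow> \<rho> x \<le> C * (1 + \<bar>x\<bar>) ^ m"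
    using prior_growth[OF prior X0] by auto
  obtain x1 where x1: "0 \<le> x1" "0 < \<l> x1"
  proof -
    obtain y where "\<l> y \<noteq> 0" using l_nz by blast
    then show thesis using that[of "\<bar>y\<bar>"] l_nn[of y] abs_loss[of \<l> y, OF l_sym] by simp
  qed
  obtain s0 where s0: "0 < s0" "\<And>x. \<bar>x\<bar> \<le> s0 \<Longrightarrow> \<l> x \<le> \<l> x1 / 2"
  proof -
    obtain t where t: "0 < t" "\<And>x. \<bar>x\<bar> < t \<Longrightarrow> \<bar>\<l> x - \<l> 0\<bar> < \<l> x1 / 2"
      using l_cont half_gt_zero[OF x1(2)] unfolding continuous_at_eps_delta dist_real_def diff_zero by metis
    have "\<l> x \<le> \<l> x1 / 2" if "\<bar>x\<bar> \<le> t / 2" for x using t(2)[of x] that t(1) l_0 by auto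
    then show thesis using that[of "t / 2"] t(1) by auto
  qed
  have cont_K: "continuous_on {X0/2..X0} \<rho>" using X0 by (intro continuous_on_subset[OF rho_cont]) auto
  obtain x0 where x0: "x0 \<in> {X0/2..X0}" "\<And>x. x \<in> {X0/2..X0} \<Longrightarrow> \<rho> x0 \<le> \<rho> x"
    using continuous_attains_inf[of "{X0/2..X0}" \<rho>] cont_K X0 by auto
  define \<rho>m where "\<rho>m = \<rho> x0"
  have \<rho>m: "0 < \<rho>m" "\<And>x. X0 / 2 \<le> x \<Longrightarrow> x \<le> X0 \<Longrightarrow> \<rho>m \<le> \<rho> x"
    using x0 X0 rho_pos[of x0] by (auto simp: \<rho>m_def)
  define G where "G = (\<lambda>v::real. ennreal (A * C) * ennreal (gauss_poly (k + m) (1/6) v))"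
  have G_meas [measurable]: "G \<in> borel_measurable borel" by (simp add: G_def)
  have G_fin: "(\<integral>\<^sup>+v. G v \<partial>lborel) < \<infinity>"
    unfolding G_def using nn_integral_growth_gauss_finite[of "1/6" "k + m"]
    by (simp add: nn_integral_cmult ennreal_mult_less_top)
  define \<kappa> where "\<kappa> = \<l> x1 / 2 * (\<rho>m * s0)"
  have \<kappa>: "0 < \<kappa>" using x1 \<rho>m s0 by (simp add: \<kappa>_def)
  obtain V where V: "0 \<le> V" "\<And>R. V \<le> R \<Longrightarrow> nn_tail G R < ennreal \<kappa>"
    using nn_integral_tail_small[OF G_meas G_fin, of "ennreal \<kappa>"] \<kappa> by auto
  \<comment> \<open>Large information makes \<open>sqrt i * X0\<close> exceed the tail cut-off \<open>V\<close>, the argument \<open>x1\<close> at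
    which the loss is positive, and twice the unscaled length \<open>s0\<close> of \<open>S\<close>.\<close>
  define I0 where "I0 = max 1 (((V + x1 + 2 * s0) / X0)\<^sup>2)"
  have "b i x \<le> 6 * x" if i: "I0 \<le> i" and x: "X0 \<le> x" and gd: "good i x" for i x
  proof (rule ccontr)
    assume neg: "\<not> ?thesis"
    define \<beta> where "\<beta> = b i x"
    have \<beta>: "6 * x < \<beta>" using neg by (simp add: \<beta>_def)
    have i1: "1 \<le> i" "((V + x1 + 2 * s0) / X0)\<^sup>2 \<le> i" using i by (auto simp: I0_def)
    have si: "1 \<le> sqrt i" using i1 by simp
    have "(V + x1 + 2 * s0) / X0 \<le> sqrt i" using i1(2) by (rule real_le_rsqrt)
    then have sX: "V + x1 + 2 * s0 \<le> sqrt i * X0" using X0 by (simp add: field_simps)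
    define S where "S = {X0 - s0 / sqrt i..X0}"
    define w where "w = (\<lambda>\<eta>. lik i x \<eta> * r \<eta>)"
    have w_nn: "0 \<le> w \<eta>" for \<eta> by (simp add: w_def r_nn)
    have [measurable]: "w \<in> borel_measurable borel" "S \<in> sets borel" by (auto simp: w_def S_def)
    define ex where "ex = exp (- (i * x\<^sup>2 / 2))"
    have ex: "0 < ex" by (simp add: ex_def)
    define L where "L = (\<lambda>\<beta> \<eta>. ennreal (\<l> (sqrt i * (\<eta> - \<beta>)) * w \<eta>))"
    have L_meas [measurable]: "L \<beta> \<in> borel_measurable borel" for \<beta> by (simp add: L_def)
    have WL: "raw_risk i x \<beta> = (\<integral>\<^sup>+\<eta>. L \<beta> \<eta> \<partial>lborel)" for \<beta> by (simp add: raw_risk_def L_def w_def)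
    have S_half: "X0 / 2 \<le> X0 - s0 / sqrt i"
    proof -
      have "2 * s0 \<le> sqrt i * X0" using sX V x1 by simp
      then show ?thesis using si by (simp add: field_simps)
    qed
    have S_w: "\<rho>m * ex \<le> w \<eta>" if "\<eta> \<in> S" for \<eta>
    proof -
      have h: "X0 / 2 \<le> \<eta>" "\<eta> \<le> X0" using that S_half by (auto simp: S_def)
      have "(\<eta> - x)\<^sup>2 \<le> x\<^sup>2" using h X0 x by (intro abs_le_square_iff[THEN iffD1]) auto
      then have "i * (\<eta> - x)\<^sup>2 / 2 \<le> i * x\<^sup>2 / 2"
        using i1 by (intro divide_right_mono mult_left_mono) auto
      then have "ex \<le> lik i x \<eta>" unfolding ex_def by (subst exp_le_cancel_iff) linarith
      then have "\<rho>m * ex \<le> \<rho> \<eta> * lik i x \<eta>"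
        using \<rho>m h ex rho_pos[of \<eta>] X0 by (intro mult_mono) auto
      then show ?thesis using h X0 by (simp add: w_def r_pos_eq mult.commute)
    qed
    have pt: "L X0 \<eta> + ennreal (\<l> x1 / 2 * (\<rho>m * ex)) * indicator S \<eta> \<le>
        L \<beta> \<eta> + ennreal ex * (G (sqrt i * (\<eta> - 0)) * indicator {v. V < \<bar>v\<bar>} (sqrt i * (\<eta> - 0)))" for \<eta>
    proof (cases "\<eta> \<in> S")
      case True
      then have h: "X0 / 2 \<le> \<eta>" "\<eta> \<le> X0" "X0 - s0 / sqrt i \<le> \<eta>" using S_half by (auto simp: S_def)
      have "\<bar>\<eta> - X0\<bar> \<le> s0 / sqrt i" using h by auto
      then have "sqrt i * \<bar>\<eta> - X0\<bar> \<le> sqrt i * (s0 / sqrt i)" using si by (intro mult_left_mono) auto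
      then have l1: "\<l> (sqrt i * (\<eta> - X0)) \<le> \<l> x1 / 2" using si by (intro s0(2)) (simp add: abs_mult)
      have "x1 \<le> sqrt i * X0" using sX V s0 by simp
      also have "\<dots> \<le> sqrt i * \<bar>\<eta> - \<beta>\<bar>" using h \<beta> x X0 si by (intro mult_left_mono) auto
      finally have l2: "\<l> x1 \<le> \<l> (sqrt i * (\<eta> - \<beta>))" using x1 si by (intro l_le) (simp add: abs_mult)
      have "\<l> (sqrt i * (\<eta> - X0)) * w \<eta> + \<l> x1 / 2 * (\<rho>m * ex) \<le> \<l> x1 / 2 * w \<eta> + \<l> x1 / 2 * w \<eta>"
        using l1 S_w[OF True] w_nn x1 by (intro add_mono mult_right_mono mult_left_mono) auto
      also have "\<dots> = \<l> x1 * w \<eta>" by simp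
      also have "\<dots> \<le> \<l> (sqrt i * (\<eta> - \<beta>)) * w \<eta>" using l2 w_nn by (intro mult_right_mono) auto
      finally have "L X0 \<eta> + ennreal (\<l> x1 / 2 * (\<rho>m * ex)) \<le> L \<beta> \<eta>"
        unfolding L_def using l_nn w_nn x1 \<rho>m ex
        by (subst ennreal_plus[symmetric]) (auto intro!: ennreal_leI simp del: ennreal_plus)
      then show ?thesis using True by (simp add: add_increasing2)
    next
      case False
      have "L X0 \<eta> \<le> L \<beta> \<eta> + ennreal ex * (G (sqrt i * \<eta>) * indicator {v. V < \<bar>v\<bar>} (sqrt i * \<eta>))"
      proof (cases "\<eta> \<le> 3 * x")
        case True
        have "\<bar>\<eta> - X0\<bar> \<le> \<bar>\<eta> - \<beta>\<bar>" using True \<beta> x X0 by auto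
        then have "\<l> (sqrt i * (\<eta> - X0)) \<le> \<l> (sqrt i * (\<eta> - \<beta>))"
          using si by (intro l_le) (simp add: abs_mult mult_left_mono)
        then have "L X0 \<eta> \<le> L \<beta> \<eta>" unfolding L_def using w_nn by (intro ennreal_leI mult_right_mono) auto
        then show ?thesis by (simp add: add_increasing2)
      next
        case False
        define v where "v = sqrt i * \<eta>"
        have \<eta>: "3 * x < \<eta>" "0 < \<eta>" "X0 < \<eta>" using False x X0 by auto
        have vV: "V < \<bar>v\<bar>"
        proof -
          have "V \<le> sqrt i * X0" using sX x1 s0 by simp
          also have "\<dots> < v" unfolding v_def using \<eta> si by (intro mult_strict_left_mono) auto
          finally show ?thesis by simp
        qed
        have v2: "i * \<eta>\<^sup>2 = v\<^sup>2" using i1 by (simp add: v_def power_mult_distrib)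
        have "\<l> (sqrt i * (\<eta> - X0)) \<le> \<l> v"
          unfolding v_def using \<eta> si X0 by (intro l_le) (simp add: abs_mult)
        also have "\<dots> \<le> A * (1 + \<bar>v\<bar>) ^ k" by (rule A)
        finally have p1: "\<l> (sqrt i * (\<eta> - X0)) \<le> A * (1 + \<bar>v\<bar>) ^ k" .
        have "\<bar>\<eta>\<bar> \<le> \<bar>v\<bar>" using \<eta> si by (simp add: v_def abs_mult)
        then have "(1 + \<bar>\<eta>\<bar>) ^ m \<le> (1 + \<bar>v\<bar>) ^ m" by (intro power_mono) auto
        then have p2: "r \<eta> \<le> C * (1 + \<bar>v\<bar>) ^ m"
          using C(1) order_trans[OF C(2)[of \<eta>]] \<eta> by (simp add: r_pos_eq mult_left_mono)
        have "\<eta>\<^sup>2 / 3 + x\<^sup>2 \<le> (\<eta> - x)\<^sup>2"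
        proof -
          have "(\<eta> - x)\<^sup>2 - (\<eta>\<^sup>2 / 3 + x\<^sup>2) = 2 / 3 * (\<eta> * (\<eta> - 3 * x))"
            by (simp add: power2_eq_square algebra_simps)
          moreover have "0 \<le> \<eta> * (\<eta> - 3 * x)" using \<eta> by simp
          ultimately show ?thesis by linarith
        qed
        then have "i * (\<eta>\<^sup>2 / 3 + x\<^sup>2) \<le> i * (\<eta> - x)\<^sup>2" using i1 by (intro mult_left_mono) auto
        then have "lik i x \<eta> \<le> exp (- (i * x\<^sup>2 / 2) + - (1/6 * v\<^sup>2))"
          unfolding v2[symmetric] by (subst exp_le_cancel_iff) (simp add: algebra_simps)
        then have p3: "lik i x \<eta> \<le> ex * exp (- (1/6 * v\<^sup>2))"
          unfolding ex_def exp_add .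
        have "\<l> (sqrt i * (\<eta> - X0)) * w \<eta> \<le>
            (A * (1 + \<bar>v\<bar>) ^ k) * ((ex * exp (- (1/6 * v\<^sup>2))) * (C * (1 + \<bar>v\<bar>) ^ m))"
          unfolding w_def using p1 p2 p3 A ex by (intro mult_mono) (auto simp: l_nn r_nn)
        also have "\<dots> = ex * (A * C * (gauss_poly (k + m) (1/6) v))"
          by (simp add: power_add)
        finally have "L X0 \<eta> \<le> ennreal ex * G v"
          unfolding L_def G_def using ex A C by (simp add: ennreal_mult[symmetric] ennreal_leI)
        then show ?thesis using vV by (simp add: v_def add_increasing)
      qed
      then show ?thesis using False by simp
    qed
    have "raw_risk i x X0 + ennreal (ex * (\<kappa> / sqrt i)) =
        (\<integral>\<^sup>+\<eta>. L X0 \<eta> + ennreal (\<l> x1 / 2 * (\<rho>m * ex)) * indicator S \<eta> \<partial>lborel)"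
    proof -
      have "ennreal (\<l> x1 / 2 * (\<rho>m * ex)) * emeasure lborel S = ennreal (ex * (\<kappa> / sqrt i))"
        using s0 si x1 \<rho>m ex by (simp add: S_def \<kappa>_def ennreal_mult[symmetric] mult_ac)
      then show ?thesis by (simp add: nn_integral_add nn_integral_cmult_indicator WL)
    qed
    also have "\<dots> \<le> (\<integral>\<^sup>+\<eta>. L \<beta> \<eta> +
        ennreal ex * (G (sqrt i * (\<eta> - 0)) * indicator {v. V < \<bar>v\<bar>} (sqrt i * (\<eta> - 0))) \<partial>lborel)"
      by (intro nn_integral_mono pt)
    also have "\<dots> = raw_risk i x \<beta> + ennreal ex * (ennreal (1 / sqrt i) *
        nn_tail G V)"
      using i1 nn_integral_rescale[of "\<lambda>v. G v * indicator {v. V < \<bar>v\<bar>} v" i 0]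
      by (simp add: nn_integral_add nn_integral_cmult WL)
    finally have 1: "raw_risk i x X0 + ennreal (ex * (\<kappa> / sqrt i)) \<le> raw_risk i x \<beta> +
        ennreal ex * (ennreal (1 / sqrt i) * nn_tail G V)" .
    have 2: "raw_risk i x \<beta> \<le> raw_risk i x X0" unfolding \<beta>_def by (rule b_minimal[OF gd X0])
    obtain g where g: "nn_tail G V = ennreal g" "0 \<le> g" "g < \<kappa>"
      using V(2)[of V] by (cases "\<integral>\<^sup>+v. G v * indicator {v. V < \<bar>v\<bar>} v \<partial>lborel") (auto simp: ennreal_less_iff)
    obtain W where W: "raw_risk i x X0 = ennreal W" "0 \<le> W" using raw_risk_finite[of i x X0] i1 by (cases "raw_risk i x X0") auto
    obtain W' where W': "raw_risk i x \<beta> = ennreal W'" "0 \<le> W'" using raw_risk_finite[of i x \<beta>] i1 by (cases "raw_risk i x \<beta>") auto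
    have "W' \<le> W" using 2 W W' by simp
    moreover have "W + ex * (\<kappa> / sqrt i) \<le> W' + ex * (1 / sqrt i * g)"
      using 1 W W' g si ex \<kappa> by (simp add: ennreal_mult[symmetric] ennreal_plus[symmetric] del: ennreal_plus)
    moreover have "ex * (1 / sqrt i * g) < ex * (\<kappa> / sqrt i)"
      using g si ex by (simp add: divide_strict_right_mono)
    ultimately show False by linarith
  qed
  then show ?thesis by (intro exI[of _ I0]) (auto simp: I0_def)
qed

end

section \<open>Monotone extension and the normalized estimation error\<close>

context bayes_problem
begin

text \<open>Density of the good points follows from their having full measure, and it is all that the
  extension of the estimator to the whole line needs.\<close>

definition dense_good :: "real \<Rightarrow> bool" where
  "dense_good i \<longleftrightarrow> (\<forall>c d. c < d \<longrightarrow> (\<exists>y. c < y \<and> y < d \<and> good i y))"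

text \<open>The smallest monotone extension from the good set: a monotone function on the whole line, hence
  Borel, that agrees with the Bayes estimator at good points. Bounds for the estimator pass to it by
  squeezing between nearby good points.\<close>

definition b_ext :: "real \<Rightarrow> real \<Rightarrow> real" where
  "b_ext i x = Sup (b i ` {y. good i y \<and> y \<le> x})"

lemma
  assumes i: "0 < i" and dense: "dense_good i"
  shows b_ext_le: "good i y \<Longrightarrow> x \<le> y \<Longrightarrow> b_ext i x \<le> b i y"
    and b_ext_ge: "good i y \<Longrightarrow> y \<le> x \<Longrightarrow> b i y \<le> b_ext i x"
    and b_ext_mono: "mono (b_ext i)"
proof -
  have ne: "b i ` {y. good i y \<and> y \<le> x} \<noteq> {}" for x
  proof -
    obtain y where "y < x" "good i y" using dense unfolding dense_good_def by (metis lt_ex)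
    then show ?thesis by force
  qed
  have bdd: "bdd_above (b i ` {y. good i y \<and> y \<le> x})" for x
  proof -
    obtain z where "x < z" "good i z" using dense unfolding dense_good_def by (metis gt_ex)
    then show ?thesis by (intro bdd_aboveI2[of _ _ "b i z"]) (auto intro!: b_mono[OF i])
  qed
  show "b_ext i x \<le> b i y" if "good i y" "x \<le> y" for x y
    unfolding b_ext_def using that by (intro cSup_least[OF ne]) (auto intro!: b_mono[OF i])
  show "b i y \<le> b_ext i x" if "good i y" "y \<le> x" for x y
    unfolding b_ext_def using that by (intro cSup_upper[OF _ bdd]) auto
  show "mono (b_ext i)"
    unfolding mono_def b_ext_def by (intro allI impI cSup_subset_mono ne bdd image_mono) auto
qed

lemma b_ext_eq: "0 < i \<Longrightarrow> dense_good i \<Longrightarrow> good i x \<Longrightarrow> b_ext i x = b i x"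
  by (intro antisym b_ext_le b_ext_ge) auto

lemma b_ext_nonneg:
  assumes "0 < i" "dense_good i"
  shows "0 \<le> b_ext i x"
proof -
  obtain y where y: "y < x" "good i y" using assms(2) unfolding dense_good_def by (metis lt_ex)
  have "0 < b i y" by (rule b_pos[OF y(2)])
  also have "\<dots> \<le> b_ext i x" using y by (intro b_ext_ge[OF assms]) auto
  finally show ?thesis by simp
qed

lemma b_ext_close:
  assumes a: "0 < a" "a \<le> d" and e: "0 < e"
  shows "\<exists>I0\<ge>1. \<forall>i\<ge>I0. dense_good i \<longrightarrow> (\<forall>x. a \<le> x \<longrightarrow> x \<le> d \<longrightarrow> \<bar>sqrt i * (b_ext i x - x)\<bar> < e)"
proof -
  obtain I0 where I0: "1 \<le> I0" "\<And>i x. I0 \<le> i \<Longrightarrow> a / 2 \<le> x \<Longrightarrow> x \<le> d + 1 \<Longrightarrow> good i x \<Longrightarrow> \<bar>sqrt i * (b i x - x)\<bar> < e / 2"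
    using b_close[of "a / 2" "d + 1" "e / 2"] a e by auto
  have "\<bar>sqrt i * (b_ext i x - x)\<bar> < e" if i: "I0 \<le> i" and dense: "dense_good i" and x: "a \<le> x" "x \<le> d" for i x
  proof -
    have si: "1 \<le> sqrt i" and i0: "0 < i" using i I0 by auto
    define t where "t = min (e / (2 * sqrt i)) (min (a / 2) 1)"
    have t: "0 < t" "t \<le> e / (2 * sqrt i)" "t \<le> a / 2" "t \<le> 1" using e a si by (auto simp: t_def)
    have st: "sqrt i * t \<le> e / 2" using t(2) si by (simp add: field_simps)
    have "x < x + t" "x - t < x" using t(1) by auto
    then obtain y z where y: "x < y" "y < x + t" "good i y" and z: "x - t < z" "z < x" "good i z"
      using dense unfolding dense_good_def by metis
    have "sqrt i * (y - x) \<le> sqrt i * t" "sqrt i * (x - z) \<le> sqrt i * t"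
      using y z si by (auto intro!: mult_left_mono)
    moreover have "sqrt i * (b i y - y) < e / 2" "- (e / 2) < sqrt i * (b i z - z)"
      using I0(2)[OF i _ _ y(3)] I0(2)[OF i _ _ z(3)] x y z t by (auto simp: abs_less_iff)
    moreover have "sqrt i * b_ext i x \<le> sqrt i * b i y" "sqrt i * b i z \<le> sqrt i * b_ext i x"
      using b_ext_le[OF i0 dense y(3), of x] b_ext_ge[OF i0 dense z(3), of x] y z si by (auto intro!: mult_left_mono)
    ultimately show ?thesis using st by (simp add: abs_less_iff right_diff_distrib)
  qed
  then show ?thesis using I0(1) by blast
qed

lemma b_ext_le_7:
  assumes X0: "0 < X0"
  shows "\<exists>I0\<ge>1. \<forall>i\<ge>I0. dense_good i \<longrightarrow> (\<forall>x\<ge>X0. b_ext i x \<le> 7 * x)"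
proof -
  obtain I0 where I0: "1 \<le> I0" "\<And>i x. I0 \<le> i \<Longrightarrow> X0 \<le> x \<Longrightarrow> good i x \<Longrightarrow> b i x \<le> 6 * x"
    using b_le_6[OF X0] by auto
  have "b_ext i x \<le> 7 * x" if i: "I0 \<le> i" and dense: "dense_good i" and x: "X0 \<le> x" for i x
  proof -
    have "x < x * (7/6)" using x X0 by simp
    then obtain y where y: "x < y" "y < x * (7/6)" "good i y"
      using dense unfolding dense_good_def by blast
    have "b_ext i x \<le> b i y" using i I0 dense y by (intro b_ext_le) auto
    also have "\<dots> \<le> 6 * y" using i x y by (intro I0) auto
    also have "\<dots> \<le> 7 * x" using y by simp
    finally show ?thesis .
  qed
  then show ?thesis using I0(1) by blast
qed

text \<open>The normalized estimation error as a function of \<open>z\<close>, when the maximum likelihood estimate is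
  \<open>\<theta> + z / sqrt i\<close>.\<close>

definition \<psi> :: "real \<Rightarrow> real \<Rightarrow> real \<Rightarrow> real" where
  "\<psi> i \<theta> z = sqrt i * (b_ext i (\<theta> + z / sqrt i) - \<theta>)"

lemma \<psi>_eq: "0 < i \<Longrightarrow> \<psi> i \<theta> z - z = sqrt i * (b_ext i (\<theta> + z / sqrt i) - (\<theta> + z / sqrt i))"
  by (simp add: \<psi>_def field_simps)

lemma \<psi>_measurable [measurable]:
  assumes "0 < i" "dense_good i"
  shows "\<psi> i \<theta> \<in> borel_measurable borel"
proof -
  have [measurable]: "b_ext i \<in> borel_measurable borel"
    by (rule borel_measurable_mono[OF b_ext_mono[OF assms]])
  show ?thesis unfolding \<psi>_def[abs_def] by simp
qed

lemma \<psi>_limit: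
  assumes a: "0 < a" "a \<le> d" and e: "0 < e"
  shows "\<exists>I0\<ge>1. \<forall>i\<ge>I0. dense_good i \<longrightarrow>
    (\<forall>\<theta> z. a \<le> \<theta> \<longrightarrow> \<theta> \<le> d \<longrightarrow> \<bar>z\<bar> \<le> R \<longrightarrow> \<bar>\<psi> i \<theta> z - z\<bar> < e)"
proof -
  obtain I0 where I0: "1 \<le> I0" "\<And>i x. I0 \<le> i \<Longrightarrow> dense_good i \<Longrightarrow> a / 2 \<le> x \<Longrightarrow> x \<le> d + 1 \<Longrightarrow> \<bar>sqrt i * (b_ext i x - x)\<bar> < e"
    using b_ext_close[of "a / 2" "d + 1" e] a e by auto
  define s where "s = min (a / 2) 1"
  have s: "0 < s" "s \<le> a / 2" "s \<le> 1" using a by (auto simp: s_def)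
  define I1 where "I1 = max I0 ((\<bar>R\<bar> / s)\<^sup>2)"
  have "\<bar>\<psi> i \<theta> z - z\<bar> < e" if i: "I1 \<le> i" and dense: "dense_good i" and \<theta>: "a \<le> \<theta>" "\<theta> \<le> d" and z: "\<bar>z\<bar> \<le> R" for i \<theta> z
  proof -
    have i1: "I0 \<le> i" "(\<bar>R\<bar> / s)\<^sup>2 \<le> i" "0 < i" using i I0(1) by (auto simp: I1_def)
    have si: "0 < sqrt i" using i1 by simp
    have "\<bar>R\<bar> / s \<le> sqrt i" using i1(2) by (rule real_le_rsqrt)
    then have "\<bar>R\<bar> / sqrt i \<le> s" using s si by (simp add: field_simps)
    moreover have "\<bar>z / sqrt i\<bar> \<le> \<bar>R\<bar> / sqrt i" using z si by (simp add: divide_right_mono)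
    ultimately have "\<bar>z / sqrt i\<bar> \<le> s" by simp
    then have "a / 2 \<le> \<theta> + z / sqrt i" "\<theta> + z / sqrt i \<le> d + 1" using \<theta> s by linarith+
    then show ?thesis unfolding \<psi>_eq[OF i1(3)] by (rule I0(2)[OF i1(1) dense])
  qed
  then show ?thesis using I0(1) by (intro exI[of _ I1]) (auto simp: I1_def)
qed

text \<open>Let \<open>x = \<theta> + z / sqrt i\<close>. For \<open>x\<close> in a compact interval around \<open>[a, d]\<close> concentration gives
  \<open>\<bar>\<psi>(z)\<bar> \<le> 1 + \<bar>z\<bar>\<close>. Otherwise \<open>\<bar>z\<bar>\<close> is at least of order \<open>sqrt i\<close>: for small \<open>x\<close> the estimate
  is bounded by monotonicity, for large \<open>x\<close> it is of order \<open>x\<close>, and in both cases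
  \<open>sqrt i\<close> times the error is absorbed by \<open>\<bar>z\<bar>\<close>.\<close>

lemma \<psi>_growth:
  assumes a: "0 < a" "a \<le> d"
  shows "\<exists>C\<ge>0. \<exists>I0\<ge>1. \<forall>i\<ge>I0. dense_good i \<longrightarrow>
    (\<forall>\<theta> z. a \<le> \<theta> \<longrightarrow> \<theta> \<le> d \<longrightarrow> \<bar>\<psi> i \<theta> z\<bar> \<le> C * (1 + \<bar>z\<bar>))"
proof -
  obtain I0 where I0: "1 \<le> I0" "\<And>i x. I0 \<le> i \<Longrightarrow> dense_good i \<Longrightarrow> a / 2 \<le> x \<Longrightarrow> x \<le> 2 * d \<Longrightarrow>
      \<bar>sqrt i * (b_ext i x - x)\<bar> < min (a / 2) 1"
    using b_ext_close[of "a / 2" "2 * d" "min (a / 2) 1"] a by auto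
  obtain I1 where I1: "1 \<le> I1" "\<And>i x. I1 \<le> i \<Longrightarrow> dense_good i \<Longrightarrow> 2 * d \<le> x \<Longrightarrow> b_ext i x \<le> 7 * x"
    using b_ext_le_7[of "2 * d"] a by auto
  define C where "C = 14 + 2 * d / a"
  have C: "14 \<le> C" "2 * d / a \<le> C" using a by (auto simp: C_def)
  have "\<bar>\<psi> i \<theta> z\<bar> \<le> C * (1 + \<bar>z\<bar>)" if i: "max I0 I1 \<le> i" and dense: "dense_good i" and \<theta>: "a \<le> \<theta>" "\<theta> \<le> d" for i \<theta> z
  proof -
    have i1: "I0 \<le> i" "I1 \<le> i" "0 < i" "1 \<le> i" using i I0(1) by auto
    have si: "1 \<le> sqrt i" using i1 by simp
    define x where "x = \<theta> + z / sqrt i"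
    have z: "z = sqrt i * (x - \<theta>)" using si by (simp add: x_def)
    have psi: "\<bar>\<psi> i \<theta> z\<bar> = sqrt i * \<bar>b_ext i x - \<theta>\<bar>" using si by (simp add: \<psi>_def x_def abs_mult)
    have nn: "0 \<le> b_ext i x" by (rule b_ext_nonneg[OF i1(3) dense])
    consider "x < a / 2" | "a / 2 \<le> x" "x \<le> 2 * d" | "2 * d < x" by linarith
    then show ?thesis
    proof cases
      case 1
      have "b_ext i x \<le> b_ext i (a / 2)" using b_ext_mono[OF i1(3) dense] 1 by (simp add: mono_def)
      also have "\<dots> \<le> a"
      proof -
        have "\<bar>sqrt i * (b_ext i (a / 2) - a / 2)\<bar> < a / 2" using I0(2)[OF i1(1) dense, of "a / 2"] a by simp
        moreover have "1 * \<bar>b_ext i (a / 2) - a / 2\<bar> \<le> sqrt i * \<bar>b_ext i (a / 2) - a / 2\<bar>"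
          using si by (rule mult_right_mono) simp
        ultimately show ?thesis using si by (simp add: abs_mult)
      qed
      finally have "\<bar>b_ext i x - \<theta>\<bar> \<le> d" using nn \<theta> a by auto
      then have "\<bar>\<psi> i \<theta> z\<bar> \<le> sqrt i * d" unfolding psi using si by (intro mult_left_mono) auto
      also have "\<dots> = 2 * d / a * (sqrt i * (a / 2))" using a by simp
      also have "sqrt i * (a / 2) \<le> \<bar>z\<bar>"
      proof -
        have "sqrt i * (a / 2) \<le> sqrt i * (\<theta> - x)" using 1 \<theta> si by (intro mult_left_mono) auto
        also have "\<dots> \<le> \<bar>z\<bar>" unfolding z by (simp add: algebra_simps)
        finally show ?thesis .
      qed
      then have "2 * d / a * (sqrt i * (a / 2)) \<le> 2 * d / a * \<bar>z\<bar>" using a by (intro mult_left_mono) auto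
      also have "\<dots> \<le> C * (1 + \<bar>z\<bar>)" using C a by (intro mult_mono) auto
      finally show ?thesis .
    next
      case 2
      have "\<bar>\<psi> i \<theta> z - z\<bar> < 1" unfolding \<psi>_eq[OF i1(3)] x_def[symmetric] using I0(2)[OF i1(1) dense 2] by simp
      then have "\<bar>\<psi> i \<theta> z\<bar> \<le> 1 + \<bar>z\<bar>" by linarith
      also have "\<dots> \<le> C * (1 + \<bar>z\<bar>)" using C mult_right_mono[of 1 C "1 + \<bar>z\<bar>"] by simp
      finally show ?thesis .
    next
      case 3
      have "b_ext i x \<le> 7 * x" using 3 by (intro I1(2)[OF i1(2) dense]) auto
      then have "\<bar>b_ext i x - \<theta>\<bar> \<le> 14 * (x - \<theta>)" using nn \<theta> 3 a by auto
      then have "\<bar>\<psi> i \<theta> z\<bar> \<le> sqrt i * (14 * (x - \<theta>))" unfolding psi using si by (intro mult_left_mono) auto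
      also have "\<dots> = 14 * z" by (simp add: z)
      also have "\<dots> \<le> 14 * (1 + \<bar>z\<bar>)" by simp
      also have "\<dots> \<le> C * (1 + \<bar>z\<bar>)" using C by (intro mult_right_mono) auto
      finally show ?thesis .
    qed
  qed
  then show ?thesis using C I0(1) by (intro exI[of _ C] conjI exI[of _ "max I0 I1"]) auto
qed

end

section \<open>Ito's formula for the logarithm of a geometric Brownian motion\<close>

text \<open>Exponential tilting shifts the mean; all moments needed below reduce to those of shifted
  Gaussians.\<close>

lemma normal_density_exp_tilt:
  assumes "0 < t"
  shows "normal_density 0 (sqrt t) z * exp (c * z - c\<^sup>2 * t / 2) = normal_density (c * t) (sqrt t) z"
proof -
  have "- z\<^sup>2 / (2 * t) + (c * z - c\<^sup>2 * t / 2) = - (z - c * t)\<^sup>2 / (2 * t)"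
    using assms by (simp add: field_simps power2_eq_square)
  then show ?thesis
    using assms by (simp add: normal_density_def exp_add[symmetric])
qed

lemma normal_density_moments:
  fixes s t D :: real
  assumes t: "0 < t"
  defines "E \<equiv> (\<lambda>z. exp (s * z - s\<^sup>2 * t / 2))"
  shows "has_bochner_integral lborel (\<lambda>z. normal_density 0 (sqrt t) z * (D * (E z - 1) - s * z)) 0"
    and "has_bochner_integral lborel (\<lambda>z. normal_density 0 (sqrt t) z * (D * (E z - 1) - s * z)\<^sup>2)
           (D\<^sup>2 * (exp (s\<^sup>2 * t) - 1) + s\<^sup>2 * t - 2 * D * (s\<^sup>2 * t))"
proof -
  let ?n = "normal_density 0 (sqrt t)"
  have st: "0 < sqrt t" using t by simp
  have dens: "has_bochner_integral lborel (normal_density m (sqrt t)) 1" for m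
    using integrable_normal_density[OF st, of m] integral_normal_density[OF st, of m]
    by (simp add: has_bochner_integral_iff)
  have nE: "?n z * E z = normal_density (s * t) (sqrt t) z" for z
    unfolding E_def by (rule normal_density_exp_tilt[OF t])
  have nE2: "?n z * (E z)\<^sup>2 = normal_density (2 * s * t) (sqrt t) z * exp (s\<^sup>2 * t)" for z
  proof -
    have "(E z)\<^sup>2 = exp (2 * s * z - (2 * s)\<^sup>2 * t / 2) * exp (s\<^sup>2 * t)"
      unfolding E_def power2_eq_square exp_add[symmetric] by (rule arg_cong[where f = exp]) (simp add: field_simps)
    then show ?thesis using normal_density_exp_tilt[OF t, of z "2 * s"] by (simp add: mult.assoc[symmetric])
  qed
  have f0: "has_bochner_integral lborel ?n 1" by (rule dens)
  have f1: "has_bochner_integral lborel (\<lambda>z. ?n z * E z) 1" unfolding nE by (rule dens)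
  have f2: "has_bochner_integral lborel (\<lambda>z. ?n z * z) 0" by (rule normal_moment_nz_1[OF st])
  have f3: "has_bochner_integral lborel (\<lambda>z. ?n z * (E z)\<^sup>2) (exp (s\<^sup>2 * t))"
    unfolding nE2 using has_bochner_integral_mult_left[where c = "exp (s\<^sup>2 * t)", OF dens[of "2 * s * t"]] by simp
  have f4: "has_bochner_integral lborel (\<lambda>z. ?n z * E z * z) (s * t)"
    unfolding nE by (rule normal_moment_nz_1[OF st])
  have f5: "has_bochner_integral lborel (\<lambda>z. ?n z * z\<^sup>2) t"
    using normal_moment_even[OF st, of 0 1] t by simp
  have "has_bochner_integral lborel (\<lambda>z. (?n z * E z * D - ?n z * D) - ?n z * z * s) ((1 * D - 1 * D) - 0 * s)"
    by (intro has_bochner_integral_diff has_bochner_integral_mult_left f0 f1 f2)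
  then show "has_bochner_integral lborel (\<lambda>z. ?n z * (D * (E z - 1) - s * z)) 0"
    by (simp add: algebra_simps)
  have "has_bochner_integral lborel (\<lambda>z. (?n z * (E z)\<^sup>2 * D\<^sup>2 - ?n z * E z * (2 * D\<^sup>2) + ?n z * D\<^sup>2
      + ?n z * z\<^sup>2 * s\<^sup>2) - (?n z * E z * z * (2 * D * s) - ?n z * z * (2 * D * s)))
      ((exp (s\<^sup>2 * t) * D\<^sup>2 - 1 * (2 * D\<^sup>2) + 1 * D\<^sup>2 + t * s\<^sup>2) - (s * t * (2 * D * s) - 0 * (2 * D * s)))"
    by (intro has_bochner_integral_diff has_bochner_integral_add has_bochner_integral_mult_left f0 f1 f2 f3 f4 f5)
  moreover have "(?n z * (E z)\<^sup>2 * D\<^sup>2 - ?n z * E z * (2 * D\<^sup>2) + ?n z * D\<^sup>2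
      + ?n z * z\<^sup>2 * s\<^sup>2) - (?n z * E z * z * (2 * D * s) - ?n z * z * (2 * D * s))
      = ?n z * (D * (E z - 1) - s * z)\<^sup>2" for z
    by (simp add: power2_eq_square algebra_simps)
  moreover have "(exp (s\<^sup>2 * t) * D\<^sup>2 - 1 * (2 * D\<^sup>2) + 1 * D\<^sup>2 + t * s\<^sup>2) - (s * t * (2 * D * s) - 0 * (2 * D * s))
      = D\<^sup>2 * (exp (s\<^sup>2 * t) - 1) + s\<^sup>2 * t - 2 * D * (s\<^sup>2 * t)"
    by (simp add: power2_eq_square algebra_simps)
  ultimately show "has_bochner_integral lborel (\<lambda>z. ?n z * (D * (E z - 1) - s * z)\<^sup>2)
           (D\<^sup>2 * (exp (s\<^sup>2 * t) - 1) + s\<^sup>2 * t - 2 * D * (s\<^sup>2 * t))"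
    by (simp only:)
qed

lemma exp_remainder_le:
  assumes "0 \<le> (x :: real)"
  shows "exp x - 1 - x \<le> x\<^sup>2 * exp x"
proof -
  have "1 - x \<le> exp (- x)" using exp_ge_add_one_self[of "- x"] by simp
  then have "(1 - x) * exp x \<le> exp (- x) * exp x" by (intro mult_right_mono) auto
  then have "exp x - 1 \<le> x * exp x" by (simp add: exp_minus algebra_simps)
  then have "x * (exp x - 1) \<le> x * (x * exp x)" using assms by (rule mult_left_mono)
  moreover have "exp x - 1 - x \<le> x * (exp x - 1)"
    using \<open>exp x - 1 \<le> x * exp x\<close> by (simp add: algebra_simps)
  ultimately show ?thesis by (simp add: power2_eq_square)
qed

lemma exp_neg_remainder:
  assumes "0 \<le> (y :: real)"
  shows "0 \<le> exp (- y) - 1 + y" "exp (- y) - 1 + y \<le> y\<^sup>2"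
proof -
  show "0 \<le> exp (- y) - 1 + y" using exp_ge_add_one_self[of "- y"] by simp
  have "exp (- y) = 1 / exp y" by (simp add: exp_minus inverse_eq_divide)
  also have "\<dots> \<le> 1 / (1 + y)" using assms exp_ge_add_one_self[of y] by (intro divide_left_mono) auto
  also have "\<dots> \<le> 1 - y + y\<^sup>2" 
  proof -
    have "(1 - y + y\<^sup>2) * (1 + y) = 1 + y ^ 3" by (simp add: power2_eq_square power3_eq_cube algebra_simps)
    then have "1 \<le> (1 - y + y\<^sup>2) * (1 + y)" using assms by simp
    then show ?thesis using assms by (simp add: divide_le_eq)
  qed
  finally show "exp (- y) - 1 + y \<le> y\<^sup>2" by simp
qed

text \<open>The error of one Riemann summand of \<open>\<integral> dv / v\<close> over a time step \<open>t\<close> with Brownian increment \<open>z\<close>,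
  for \<open>dv = - c v dt + s v dw\<close>, after removal of its deterministic part: the summand is
  \<open>exp (- c t) * exp (s z - s\<^sup>2 t / 2) - 1\<close> and should be \<open>- c t + s z\<close>; their difference is
  \<open>log_error\<close> plus \<open>exp (- c t) - 1 + c t\<close>.\<close>

definition log_error :: "real \<Rightarrow> real \<Rightarrow> real \<Rightarrow> real \<Rightarrow> real" where
  "log_error s c t z = exp (- (c * t)) * (exp (s * z - s\<^sup>2 * t / 2) - 1) - s * z"

lemma log_error_measurable [measurable]: "log_error s c t \<in> borel_measurable borel"
  by (simp add: log_error_def[abs_def])

text \<open>With \<open>x = s\<^sup>2 t\<close> and \<open>D = exp (- c t)\<close>, the second moment equals
  \<open>D\<^sup>2 (exp x - 1 - x) + x (1 - D)\<^sup>2\<close>, where the terms of first order in \<open>t\<close> cancel. This is the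
  quadratic variation correction in Ito's formula.\<close>

lemma (in prob_space) log_error_moments:
  assumes Z: "distributed M lborel Z (normal_density 0 (sqrt t))" and t: "0 < t" "t \<le> T" and c: "0 \<le> c"
  shows "integrable M (\<lambda>\<omega>. log_error s c t (Z \<omega>))" "expectation (\<lambda>\<omega>. log_error s c t (Z \<omega>)) = 0"
    and "integrable M (\<lambda>\<omega>. (log_error s c t (Z \<omega>))\<^sup>2)"
    and "expectation (\<lambda>\<omega>. (log_error s c t (Z \<omega>))\<^sup>2) \<le> (s ^ 4 * exp (s\<^sup>2 * T) + s\<^sup>2 * c\<^sup>2 * T) * t\<^sup>2"
proof -
  let ?n = "normal_density 0 (sqrt t)"
  define D where "D = exp (- (c * t))"
  have le: "log_error s c t z = D * (exp (s * z - s\<^sup>2 * t / 2) - 1) - s * z" for z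
    by (simp add: log_error_def D_def)
  note m = normal_density_moments[OF t(1), where s = s and D = D, folded le]
  note i = distributed_integrable[OF Z] distributed_integral[OF Z]
  show "integrable M (\<lambda>\<omega>. log_error s c t (Z \<omega>))"
    using m(1) i(1)[of "log_error s c t"] by (simp add: has_bochner_integral_iff)
  show "expectation (\<lambda>\<omega>. log_error s c t (Z \<omega>)) = 0"
    using m(1) i(2)[of "log_error s c t"] by (simp add: has_bochner_integral_iff)
  show "integrable M (\<lambda>\<omega>. (log_error s c t (Z \<omega>))\<^sup>2)"
    using m(2) i(1)[of "\<lambda>z. (log_error s c t z)\<^sup>2"] by (simp add: has_bochner_integral_iff)
  define x where "x = s\<^sup>2 * t"
  have x: "0 \<le> x" using t by (simp add: x_def)
  have "expectation (\<lambda>\<omega>. (log_error s c t (Z \<omega>))\<^sup>2) = D\<^sup>2 * (exp x - 1) + x - 2 * D * x"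
    using m(2) i(2)[of "\<lambda>z. (log_error s c t z)\<^sup>2"] by (simp add: has_bochner_integral_iff x_def)
  also have "\<dots> = D\<^sup>2 * (exp x - 1 - x) + x * (1 - D)\<^sup>2"
    by (simp add: power2_eq_square algebra_simps)
  also have "\<dots> \<le> 1 * (x\<^sup>2 * exp (s\<^sup>2 * T)) + x * (c * t)\<^sup>2"
  proof (intro add_mono mult_mono mult_left_mono)
    have D: "0 < D" "D \<le> 1" using c t by (auto simp: D_def)
    then show "D\<^sup>2 \<le> 1" by (simp add: power_le_one)
    have "exp x \<le> exp (s\<^sup>2 * T)" unfolding x_def using t by (simp add: mult_left_mono)
    then have "x\<^sup>2 * exp x \<le> x\<^sup>2 * exp (s\<^sup>2 * T)" by (intro mult_left_mono) auto
    then show "exp x - 1 - x \<le> x\<^sup>2 * exp (s\<^sup>2 * T)" using exp_remainder_le[OF x] by simp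
    show "0 \<le> exp x - 1 - x" using exp_ge_add_one_self[of x] by linarith
    have "1 - D \<le> c * t" using exp_ge_add_one_self[of "- (c * t)"] by (simp add: D_def)
    then show "(1 - D)\<^sup>2 \<le> (c * t)\<^sup>2" using D by (intro power_mono) auto
  qed (use x in auto)
  also have "\<dots> = (s ^ 4 * exp (s\<^sup>2 * T) + s\<^sup>2 * c\<^sup>2 * t) * t\<^sup>2"
    by (simp add: x_def power2_eq_square power4_eq_xxxx algebra_simps)
  also have "\<dots> \<le> (s ^ 4 * exp (s\<^sup>2 * T) + s\<^sup>2 * c\<^sup>2 * T) * t\<^sup>2"
    using t by (intro mult_right_mono add_left_mono mult_left_mono) auto
  finally show "expectation (\<lambda>\<omega>. (log_error s c t (Z \<omega>))\<^sup>2) \<le> (s ^ 4 * exp (s\<^sup>2 * T) + s\<^sup>2 * c\<^sup>2 * T) * t\<^sup>2" .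
qed

lemma (in prob_space) indep_var_of_indep_set:
  assumes indep: "indep_set (sets G) (sets (vimage_algebra (space M) Z borel))"
    and G: "subalgebra M G" and X: "X \<in> borel_measurable G"
    and Z: "Z \<in> borel_measurable M" and g: "g \<in> borel_measurable borel"
  shows "indep_var borel X borel (\<lambda>\<omega>. g (Z \<omega>))"
  unfolding indep_var_eq
proof (intro conjI)
  have sp: "space G = space M" using G by (simp add: subalgebra_def)
  show "random_variable borel X" by (rule measurable_from_subalg[OF G X])
  show "random_variable borel (\<lambda>\<omega>. g (Z \<omega>))" using Z g by measurable
  have 1: "sigma_sets (space M) {X -` A \<inter> space M |A. A \<in> sets borel} \<subseteq> sets G"
    using measurable_sets[OF X] unfolding sp[symmetric] by (intro sets.sigma_sets_subset) auto
  have "(\<lambda>\<omega>. g (Z \<omega>)) \<in> borel_measurable (vimage_algebra (space M) Z borel)"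
    by (rule measurable_compose[OF measurable_vimage_algebra1 g]) auto
  from measurable_sets[OF this]
  have "sigma_sets (space (vimage_algebra (space M) Z borel)) {(\<lambda>\<omega>. g (Z \<omega>)) -` A \<inter> space M |A. A \<in> sets borel}
      \<subseteq> sets (vimage_algebra (space M) Z borel)"
    by (intro sets.sigma_sets_subset) auto
  then have 2: "sigma_sets (space M) {(\<lambda>\<omega>. g (Z \<omega>)) -` A \<inter> space M |A. A \<in> sets borel}
      \<subseteq> sets (vimage_algebra (space M) Z borel)" by simp
  show "indep_set (sigma_sets (space M) {X -` A \<inter> space M |A. A \<in> sets borel})
     (sigma_sets (space M) {(\<lambda>\<omega>. g (Z \<omega>)) -` A \<inter> space M |A. A \<in> sets borel})"
    using indep unfolding indep_set_def
    by (rule indep_sets_mono_sets) (use 1 2 in \<open>auto split: bool.splits\<close>)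
qed

abbreviation mesh_less :: "real \<Rightarrow> real \<Rightarrow> nat \<Rightarrow> (nat \<Rightarrow> real) \<Rightarrow> bool" where
  "mesh_less T \<delta> m \<tau> \<equiv> \<tau> 0 = 0 \<and> \<tau> m = T \<and> (\<forall>i<m. \<tau> i \<le> \<tau> (Suc i) \<and> \<tau> (Suc i) - \<tau> i < \<delta>)"

lemma sq_sum_le_mesh:
  fixes \<tau> :: "nat \<Rightarrow> real"
  assumes "\<tau> 0 = 0" "\<tau> m = T" "\<And>i. i < m \<Longrightarrow> \<tau> i \<le> \<tau> (Suc i) \<and> \<tau> (Suc i) - \<tau> i < \<delta>"
  shows "(\<Sum>i<m. (\<tau> (Suc i) - \<tau> i)\<^sup>2) \<le> \<delta> * T"
proof -
  have "(\<Sum>i<m. (\<tau> (Suc i) - \<tau> i)\<^sup>2) \<le> (\<Sum>i<m. \<delta> * (\<tau> (Suc i) - \<tau> i))"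
  proof (rule sum_mono)
    fix i assume "i \<in> {..<m}"
    then have "\<tau> i \<le> \<tau> (Suc i)" "\<tau> (Suc i) - \<tau> i < \<delta>" using assms(3)[of i] by auto
    then show "(\<tau> (Suc i) - \<tau> i)\<^sup>2 \<le> \<delta> * (\<tau> (Suc i) - \<tau> i)"
      unfolding power2_eq_square by (intro mult_right_mono) auto
  qed
  also have "\<dots> = \<delta> * (\<Sum>i<m. \<tau> (Suc i) - \<tau> i)" by (simp add: sum_distrib_left)
  also have "(\<Sum>i<m. \<tau> (Suc i) - \<tau> i) = T" using assms by (simp add: sum_lessThan_telescope)
  finally show ?thesis .
qed

locale basis_bm =
  fixes M :: "'a measure" and F and W :: "real \<Rightarrow> 'a \<Rightarrow> real"
  assumes basis: "stochastic_basis M F" and bm: "brownian_motion M F W"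

sublocale basis_bm \<subseteq> prob_space M
  using basis by (simp add: stochastic_basis_def)

context basis_bm
begin

lemma F_sub: "0 \<le> t \<Longrightarrow> subalgebra M (F t)" and F_mono: "0 \<le> s \<Longrightarrow> s \<le> t \<Longrightarrow> subalgebra (F t) (F s)"
  using basis by (auto simp: stochastic_basis_def)

lemma W_F: "0 \<le> t \<Longrightarrow> W t \<in> borel_measurable (F t)"
  using bm by (simp add: brownian_motion_def)

lemma W_F_le: "0 \<le> s \<Longrightarrow> s \<le> t \<Longrightarrow> W s \<in> borel_measurable (F t)"
  by (rule measurable_from_subalg[OF F_mono W_F]) auto

lemma W_M: "0 \<le> t \<Longrightarrow> W t \<in> borel_measurable M"
  by (rule measurable_from_subalg[OF F_sub W_F])

lemma W_0: "AE \<omega> in M. W 0 \<omega> = 0"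
  using bm by (simp add: brownian_motion_def)

lemma W_incr: "0 \<le> s \<Longrightarrow> s < t \<Longrightarrow> distributed M lborel (\<lambda>\<omega>. W t \<omega> - W s \<omega>) (normal_density 0 (sqrt (t - s)))"
  and W_indep: "0 \<le> s \<Longrightarrow> s < t \<Longrightarrow> indep_set (sets (F s)) (sets (vimage_algebra (space M) (\<lambda>\<omega>. W t \<omega> - W s \<omega>) borel))"
  using bm by (simp_all add: brownian_motion_def)

text \<open>The errors over disjoint steps are centred, and each is independent of the past, so that they are
  orthogonal and their second moments add up.\<close>

lemma log_error_sum:
  fixes \<tau> :: "nat \<Rightarrow> real" and s :: real
  assumes c: "0 \<le> c" and \<tau>0: "\<tau> 0 = 0" and \<tau>: "\<And>i. i < m \<Longrightarrow> \<tau> i \<le> \<tau> (Suc i)" and \<tau>T: "\<tau> m = T"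
  defines "X \<equiv> (\<lambda>i \<omega>. log_error s c (\<tau> (Suc i) - \<tau> i) (W (\<tau> (Suc i)) \<omega> - W (\<tau> i) \<omega>))"
  shows "n \<le> m \<Longrightarrow> (\<lambda>\<omega>. \<Sum>i<n. X i \<omega>) \<in> borel_measurable (F (\<tau> n)) \<and> 0 \<le> \<tau> n \<and>
     integrable M (\<lambda>\<omega>. (\<Sum>i<n. X i \<omega>)) \<and> integrable M (\<lambda>\<omega>. (\<Sum>i<n. X i \<omega>)\<^sup>2) \<and>
     expectation (\<lambda>\<omega>. (\<Sum>i<n. X i \<omega>)\<^sup>2) \<le> (s ^ 4 * exp (s\<^sup>2 * T) + s\<^sup>2 * c\<^sup>2 * T) * (\<Sum>i<n. (\<tau> (Suc i) - \<tau> i)\<^sup>2)"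
proof (induction n)
  case 0
  show ?case by (simp add: \<tau>0)
next
  case (Suc n)
  define S where "S = (\<lambda>\<omega>. \<Sum>i<n. X i \<omega>)"
  define K where "K = s ^ 4 * exp (s\<^sup>2 * T) + s\<^sup>2 * c\<^sup>2 * T"
  have n: "n < m" using Suc.prems by simp
  have S: "S \<in> borel_measurable (F (\<tau> n))" "0 \<le> \<tau> n" "integrable M S" "integrable M (\<lambda>\<omega>. (S \<omega>)\<^sup>2)"
    "expectation (\<lambda>\<omega>. (S \<omega>)\<^sup>2) \<le> K * (\<Sum>i<n. (\<tau> (Suc i) - \<tau> i)\<^sup>2)"
    using Suc.IH n by (auto simp: S_def K_def)
  have le: "\<tau> n \<le> \<tau> (Suc n)" by (rule \<tau>[OF n])
  have "\<tau> (Suc n) \<le> \<tau> m"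
    using Suc.prems
  proof (induction rule: inc_induct)
    case (step k) then show ?case using \<tau>[of k] by simp
  qed simp
  then have le_T: "\<tau> (Suc n) - \<tau> n \<le> T" using S(2) \<tau>T by simp
  have sum: "(\<Sum>i<Suc n. X i \<omega>) = S \<omega> + X n \<omega>" for \<omega> by (simp add: S_def)
  have [measurable]: "S \<in> borel_measurable (F (\<tau> (Suc n)))"
    by (rule measurable_from_subalg[OF F_mono[OF S(2) le] S(1)])
  have [measurable]: "W (\<tau> (Suc n)) \<in> borel_measurable (F (\<tau> (Suc n)))" "W (\<tau> n) \<in> borel_measurable (F (\<tau> (Suc n)))"
    using W_F[of "\<tau> (Suc n)"] W_F_le[OF S(2) le] S(2) le by auto
  have meas: "(\<lambda>\<omega>. S \<omega> + X n \<omega>) \<in> borel_measurable (F (\<tau> (Suc n)))" unfolding X_def by measurable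
  \<comment> \<open>A step of length zero has to be treated apart: its increment has no density.\<close>
  have X: "integrable M (X n) \<and> integrable M (\<lambda>\<omega>. (X n \<omega>)\<^sup>2) \<and> integrable M (\<lambda>\<omega>. S \<omega> * X n \<omega>) \<and>
      expectation (\<lambda>\<omega>. S \<omega> * X n \<omega>) = 0 \<and> expectation (\<lambda>\<omega>. (X n \<omega>)\<^sup>2) \<le> K * (\<tau> (Suc n) - \<tau> n)\<^sup>2"
  proof (cases "\<tau> n = \<tau> (Suc n)")
    case True
    then have "X n = (\<lambda>\<omega>. 0)" by (simp add: X_def log_error_def fun_eq_iff)
    then show ?thesis using True by simp
  next
    case False
    then have lt: "\<tau> n < \<tau> (Suc n)" using le by simp
    define Z where "Z = (\<lambda>\<omega>. W (\<tau> (Suc n)) \<omega> - W (\<tau> n) \<omega>)"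
    have Zd: "distributed M lborel Z (normal_density 0 (sqrt (\<tau> (Suc n) - \<tau> n)))"
      unfolding Z_def by (rule W_incr[OF S(2) lt])
    have Z_meas: "Z \<in> borel_measurable M" using distributed_measurable[OF Zd] by simp
    have XZ: "X n = (\<lambda>\<omega>. log_error s c (\<tau> (Suc n) - \<tau> n) (Z \<omega>))" by (simp add: X_def Z_def)
    note mom = log_error_moments[OF Zd _ le_T c, of s, folded XZ K_def]
    have iv: "indep_var borel S borel (X n)"
      unfolding XZ by (rule indep_var_of_indep_set[OF _ F_sub[OF S(2)] S(1) Z_meas])
        (use W_indep[OF S(2) lt] in \<open>auto simp: Z_def\<close>)
    show ?thesis
      using mom lt indep_var_integrable[OF iv S(3)] indep_var_lebesgue_integral[OF iv S(3)]
      by (auto simp: XZ K_def)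
  qed
  have sq: "(S \<omega> + X n \<omega>)\<^sup>2 = (S \<omega>)\<^sup>2 + 2 * (S \<omega> * X n \<omega>) + (X n \<omega>)\<^sup>2" for \<omega>
    by (simp add: power2_sum)
  have "integrable M (\<lambda>\<omega>. (S \<omega> + X n \<omega>)\<^sup>2)" unfolding sq using X S by (intro Bochner_Integration.integrable_add integrable_mult_right) auto
  moreover have "expectation (\<lambda>\<omega>. (S \<omega> + X n \<omega>)\<^sup>2) = expectation (\<lambda>\<omega>. (S \<omega>)\<^sup>2) + expectation (\<lambda>\<omega>. (X n \<omega>)\<^sup>2)"
    unfolding sq using X S by simp
  ultimately show ?case
    unfolding sum using meas X S le by (simp add: K_def[symmetric] distrib_left)
qed

text \<open>The Riemann sum misses the claimed value by the sum of the centred errors and the sum of the terms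
  \<open>exp (- c t) - 1 + c t\<close>. Both are governed by the sum of the squared step lengths, at most \<open>T\<close>
  times the mesh: the first through Chebyshev's inequality, the second deterministically.\<close>

lemma has_stoch_integral_log:
  fixes s :: real
  assumes T: "0 < T" and c: "0 \<le> c" and v0: "v0 \<in> borel_measurable (F 0)" "AE \<omega> in M. v0 \<omega> \<noteq> 0"
  defines "v \<equiv> (\<lambda>t \<omega>. v0 \<omega> * exp (- (c + s\<^sup>2 / 2) * t + s * W t \<omega>))"
  shows "has_stoch_integral M T (\<lambda>t \<omega>. 1 / v t \<omega>) v (\<lambda>\<omega>. - (c * T) + s * (W T \<omega> - W 0 \<omega>))"
  unfolding has_stoch_integral_def
proof (intro conjI allI impI)
  let ?J = "\<lambda>\<omega>. - (c * T) + s * (W T \<omega> - W 0 \<omega>)"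
  have [measurable]: "W T \<in> borel_measurable M" "W 0 \<in> borel_measurable M" using T by (auto intro: W_M)
  have [measurable]: "v0 \<in> borel_measurable M" by (rule measurable_from_subalg[OF F_sub v0(1)]) simp
  show "?J \<in> borel_measurable M" by measurable
  fix \<epsilon> \<eta> :: real assume \<epsilon>: "0 < \<epsilon>" and \<eta>: "0 < \<eta>"
  define K where "K = s ^ 4 * exp (s\<^sup>2 * T) + s\<^sup>2 * c\<^sup>2 * T"
  have K: "0 \<le> K" using T by (simp add: K_def)
  define \<delta> where "\<delta> = min (\<epsilon> / (4 * (c\<^sup>2 * T + 1))) (\<eta> * (\<epsilon> / 2)\<^sup>2 / (2 * (K * T + 1)))"
  have cT: "0 < c\<^sup>2 * T + 1" "0 < K * T + 1" using T K by (auto intro!: add_nonneg_pos)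
  have cancel: "y / (k * q) * q = y / k" if "0 < q" for y k q :: real using that by simp
  have \<delta>: "0 < \<delta>" using \<epsilon> \<eta> cT by (simp add: \<delta>_def)
  have \<delta>1: "\<delta> * (c\<^sup>2 * T) < \<epsilon> / 2"
  proof -
    have "\<delta> * (c\<^sup>2 * T) \<le> \<delta> * (c\<^sup>2 * T + 1)" using \<delta> by simp
    also have "\<dots> \<le> \<epsilon> / (4 * (c\<^sup>2 * T + 1)) * (c\<^sup>2 * T + 1)" using cT by (intro mult_right_mono) (auto simp: \<delta>_def)
    also have "\<dots> = \<epsilon> / 4" by (rule cancel[OF cT(1)])
    also have "\<dots> < \<epsilon> / 2" using \<epsilon> by simp
    finally show ?thesis .
  qed
  have \<delta>2: "K * (\<delta> * T) < \<eta> * (\<epsilon> / 2)\<^sup>2"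
  proof -
    have "K * (\<delta> * T) \<le> \<delta> * (K * T + 1)" using \<delta> by (simp add: algebra_simps)
    also have "\<dots> \<le> \<eta> * (\<epsilon> / 2)\<^sup>2 / (2 * (K * T + 1)) * (K * T + 1)" using cT by (intro mult_right_mono) (auto simp: \<delta>_def)
    also have "\<dots> = \<eta> * (\<epsilon> / 2)\<^sup>2 / 2" by (rule cancel[OF cT(2)])
    also have "\<dots> < \<eta> * (\<epsilon> / 2)\<^sup>2" using \<epsilon> \<eta> by simp
    finally show ?thesis .
  qed
  show "\<exists>\<delta>>0. \<forall>m \<tau>. mesh_less T \<delta> m \<tau> \<longrightarrow>
        measure M {\<omega> \<in> space M. \<epsilon> < \<bar>(\<Sum>i<m. 1 / v (\<tau> i) \<omega> * (v (\<tau> (Suc i)) \<omega> - v (\<tau> i) \<omega>)) - ?J \<omega>\<bar>} < \<eta>"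
  proof (intro exI[of _ \<delta>] conjI \<delta> allI impI)
    fix m and \<tau> :: "nat \<Rightarrow> real"
    assume h: "mesh_less T \<delta> m \<tau>"
    then have \<tau>0: "\<tau> 0 = 0" and \<tau>T: "\<tau> m = T" and \<tau>: "\<And>i. i < m \<Longrightarrow> \<tau> i \<le> \<tau> (Suc i)"
      and mesh: "\<And>i. i < m \<Longrightarrow> \<tau> i \<le> \<tau> (Suc i) \<and> \<tau> (Suc i) - \<tau> i < \<delta>" by auto
    define X where "X = (\<lambda>i \<omega>. log_error s c (\<tau> (Suc i) - \<tau> i) (W (\<tau> (Suc i)) \<omega> - W (\<tau> i) \<omega>))"
    define S where "S = (\<lambda>\<omega>. \<Sum>i<m. X i \<omega>)"
    have sq: "(\<Sum>i<m. (\<tau> (Suc i) - \<tau> i)\<^sup>2) \<le> \<delta> * T" by (rule sq_sum_le_mesh[OF \<tau>0 \<tau>T mesh])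
    have Sm: "S \<in> borel_measurable (F T)" and S2: "integrable M (\<lambda>\<omega>. (S \<omega>)\<^sup>2)"
      and ES: "expectation (\<lambda>\<omega>. (S \<omega>)\<^sup>2) \<le> K * (\<Sum>i<m. (\<tau> (Suc i) - \<tau> i)\<^sup>2)"
      using log_error_sum[where \<tau> = \<tau> and m = m and T = T and n = m and s = s, OF c \<tau>0 \<tau> \<tau>T order_refl] \<tau>T
      by (simp_all add: S_def X_def K_def)
    have [measurable]: "S \<in> borel_measurable M" by (rule measurable_from_subalg[OF F_sub Sm]) (use T in simp)
    let ?dev = "{\<omega> \<in> space M. \<epsilon> < \<bar>(\<Sum>i<m. 1 / v (\<tau> i) \<omega> * (v (\<tau> (Suc i)) \<omega> - v (\<tau> i) \<omega>)) - ?J \<omega>\<bar>}"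
    have "AE \<omega> in M. (\<Sum>i<m. 1 / v (\<tau> i) \<omega> * (v (\<tau> (Suc i)) \<omega> - v (\<tau> i) \<omega>)) - ?J \<omega>
        = S \<omega> + (\<Sum>i<m. exp (- (c * (\<tau> (Suc i) - \<tau> i))) - 1 + c * (\<tau> (Suc i) - \<tau> i))"
      using v0(2)
    proof eventually_elim
      case (elim \<omega>)
      have step: "1 / v (\<tau> i) \<omega> * (v (\<tau> (Suc i)) \<omega> - v (\<tau> i) \<omega>) =
        X i \<omega> + (exp (- (c * (\<tau> (Suc i) - \<tau> i))) - 1 + c * (\<tau> (Suc i) - \<tau> i))
         + (s * (W (\<tau> (Suc i)) \<omega> - W (\<tau> i) \<omega>) - c * (\<tau> (Suc i) - \<tau> i))" for i
      proof -
        have "v (\<tau> (Suc i)) \<omega> = v (\<tau> i) \<omega> * (exp (- (c * (\<tau> (Suc i) - \<tau> i))) *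
           exp (s * (W (\<tau> (Suc i)) \<omega> - W (\<tau> i) \<omega>) - s\<^sup>2 * (\<tau> (Suc i) - \<tau> i) / 2))"
          unfolding v_def mult.assoc exp_add[symmetric]
          by (rule arg_cong[where f = "\<lambda>x. v0 \<omega> * exp x"]) (simp add: field_simps)
        moreover have "v (\<tau> i) \<omega> \<noteq> 0" using elim by (simp add: v_def)
        ultimately have "1 / v (\<tau> i) \<omega> * (v (\<tau> (Suc i)) \<omega> - v (\<tau> i) \<omega>) = exp (- (c * (\<tau> (Suc i) - \<tau> i))) *
           exp (s * (W (\<tau> (Suc i)) \<omega> - W (\<tau> i) \<omega>) - s\<^sup>2 * (\<tau> (Suc i) - \<tau> i) / 2) - 1"
          by (simp add: field_simps)
        then show ?thesis by (simp add: X_def log_error_def algebra_simps)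
      qed
      have "(\<Sum>i<m. s * (W (\<tau> (Suc i)) \<omega> - W (\<tau> i) \<omega>) - c * (\<tau> (Suc i) - \<tau> i)) = ?J \<omega>"
      proof -
        have "(\<Sum>i<m. s * (W (\<tau> (Suc i)) \<omega> - W (\<tau> i) \<omega>) - c * (\<tau> (Suc i) - \<tau> i)) =
            s * (\<Sum>i<m. W (\<tau> (Suc i)) \<omega> - W (\<tau> i) \<omega>) - c * (\<Sum>i<m. \<tau> (Suc i) - \<tau> i)"
          by (subst sum_subtractf) (simp only: sum_distrib_left)
        then show ?thesis
          unfolding sum_lessThan_telescope[of "\<lambda>i. W (\<tau> i) \<omega>"] sum_lessThan_telescope[of \<tau>] \<tau>0 \<tau>T by simp
      qed
      then show ?case unfolding step sum.distrib by (simp add: S_def)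
    qed
    then have AE_le: "AE \<omega> in M. \<omega> \<in> ?dev \<longrightarrow>
        \<omega> \<in> {\<omega> \<in> space M. \<epsilon> / 2 \<le> \<bar>S \<omega>\<bar>}"
    proof eventually_elim
      case (elim \<omega>)
      let ?d = "\<Sum>i<m. exp (- (c * (\<tau> (Suc i) - \<tau> i))) - 1 + c * (\<tau> (Suc i) - \<tau> i)"
      have "0 \<le> ?d" using exp_neg_remainder(1) c \<tau> by (intro sum_nonneg) simp
      moreover have "?d \<le> (\<Sum>i<m. (c * (\<tau> (Suc i) - \<tau> i))\<^sup>2)"
        using exp_neg_remainder(2) c \<tau> by (intro sum_mono) simp
      then have "?d \<le> c\<^sup>2 * (\<Sum>i<m. (\<tau> (Suc i) - \<tau> i)\<^sup>2)" by (simp add: power_mult_distrib sum_distrib_left)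
      moreover have "c\<^sup>2 * (\<Sum>i<m. (\<tau> (Suc i) - \<tau> i)\<^sup>2) \<le> c\<^sup>2 * (\<delta> * T)" using sq by (intro mult_left_mono) auto
      ultimately have "\<bar>?d\<bar> < \<epsilon> / 2" using \<delta>1 by (simp add: algebra_simps)
      moreover have "\<epsilon> / 2 \<le> \<bar>S \<omega>\<bar>" if "\<epsilon> < \<bar>S \<omega> + ?d\<bar>" "\<bar>?d\<bar> < \<epsilon> / 2"
        using that by linarith
      ultimately show ?case unfolding mem_Collect_eq elim by blast
    qed
    have "measure M ?dev
        \<le> measure M {\<omega> \<in> space M. \<epsilon> / 2 \<le> \<bar>S \<omega>\<bar>}"
      by (rule finite_measure_mono_AE[OF AE_le]) simp
    also have "\<dots> \<le> expectation (\<lambda>\<omega>. (S \<omega>)\<^sup>2) / (\<epsilon> / 2)\<^sup>2"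
      using \<epsilon> by (intro second_moment_method S2) auto
    also have "\<dots> \<le> K * (\<delta> * T) / (\<epsilon> / 2)\<^sup>2"
      using ES mult_left_mono[OF sq K] by (intro divide_right_mono) auto
    also have "\<dots> < \<eta>" using \<delta>2 \<epsilon> by (subst divide_less_eq) auto
    finally show "measure M ?dev < \<eta>" .
  qed
qed

end

lemma (in prob_space) has_stoch_integral_unique:
  assumes T: "0 < T" and H: "\<And>t. 0 \<le> t \<Longrightarrow> H t \<in> borel_measurable M" and X: "\<And>t. 0 \<le> t \<Longrightarrow> X t \<in> borel_measurable M"
    and J1: "has_stoch_integral M T H X J1" and J2: "has_stoch_integral M T H X J2"
  shows "AE \<omega> in M. J1 \<omega> = J2 \<omega>"
proof -
  have [measurable]: "J1 \<in> borel_measurable M" "J2 \<in> borel_measurable M"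
    using J1 J2 by (auto simp: has_stoch_integral_def)
  have small: "measure M {\<omega> \<in> space M. 2 * \<epsilon> < \<bar>J1 \<omega> - J2 \<omega>\<bar>} \<le> 2 * \<eta>" if \<epsilon>: "0 < \<epsilon>" and \<eta>: "0 < \<eta>" for \<epsilon> \<eta>
  proof -
    define R where "R = (\<lambda>m (\<tau> :: nat \<Rightarrow> real) \<omega>. \<Sum>i<m. H (\<tau> i) \<omega> * (X (\<tau> (Suc i)) \<omega> - X (\<tau> i) \<omega>))"
    have "\<exists>\<delta>>0. \<forall>m \<tau>. mesh_less T \<delta> m \<tau> \<longrightarrow>
        measure M {\<omega> \<in> space M. \<epsilon> < \<bar>R m \<tau> \<omega> - J \<omega>\<bar>} < \<eta>" if "has_stoch_integral M T H X J" for J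
      using that[unfolded has_stoch_integral_def, THEN conjunct2, rule_format, OF \<epsilon> \<eta>] unfolding R_def .
    note ex = this
    from ex[OF J1] obtain \<delta>1 where \<delta>1: "0 < \<delta>1 \<and> (\<forall>m \<tau>. mesh_less T \<delta>1 m \<tau> \<longrightarrow>
        measure M {\<omega> \<in> space M. \<epsilon> < \<bar>R m \<tau> \<omega> - J1 \<omega>\<bar>} < \<eta>)" by (rule exE)
    from ex[OF J2] obtain \<delta>2 where \<delta>2: "0 < \<delta>2 \<and> (\<forall>m \<tau>. mesh_less T \<delta>2 m \<tau> \<longrightarrow>
        measure M {\<omega> \<in> space M. \<epsilon> < \<bar>R m \<tau> \<omega> - J2 \<omega>\<bar>} < \<eta>)" by (rule exE)
    have \<delta>: "0 < \<delta>1" "0 < \<delta>2" using \<delta>1 \<delta>2 by auto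
    note 1 = \<delta>1[THEN conjunct2, rule_format] and 2 = \<delta>2[THEN conjunct2, rule_format]
    obtain m :: nat where m: "T / min \<delta>1 \<delta>2 < real m" using reals_Archimedean2 by blast
    have "0 < T / min \<delta>1 \<delta>2" using T \<delta> by simp
    then have m0: "0 < real m" using m by linarith
    define \<tau> where "\<tau> = (\<lambda>i. real i * (T / real m))"
    have Tm: "T / real m < min \<delta>1 \<delta>2" 
    proof -
      have "0 < min \<delta>1 \<delta>2" using \<delta> by simp
      then show ?thesis using m m0 by (simp only: pos_divide_less_eq mult.commute)
    qed
    have \<tau>: "\<tau> 0 = 0" "\<tau> m = T" "\<And>i. \<tau> (Suc i) - \<tau> i = T / real m" "\<And>i. 0 \<le> \<tau> i"
      using m0 T by (auto simp: \<tau>_def algebra_simps add_divide_distrib)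
    have \<tau>le: "\<tau> i \<le> \<tau> (Suc i)" for i
    proof -
      have "0 \<le> \<tau> (Suc i) - \<tau> i" unfolding \<tau>(3) using T by simp
      then show ?thesis by simp
    qed
    let ?A1 = "{\<omega> \<in> space M. \<epsilon> < \<bar>R m \<tau> \<omega> - J1 \<omega>\<bar>}" and ?A2 = "{\<omega> \<in> space M. \<epsilon> < \<bar>R m \<tau> \<omega> - J2 \<omega>\<bar>}"
    let ?A = "{\<omega> \<in> space M. 2 * \<epsilon> < \<bar>J1 \<omega> - J2 \<omega>\<bar>}"
    have [measurable]: "R m \<tau> \<in> borel_measurable M"
      unfolding R_def using H X \<tau>(4)
      by (intro borel_measurable_sum borel_measurable_times borel_measurable_diff) auto
    have "?A \<subseteq>
        ?A1 \<union> ?A2"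
      by auto
    then have "measure M ?A \<le>
        measure M (?A1 \<union> ?A2)"
      by (rule finite_measure_mono) measurable
    also have "\<dots> \<le> measure M ?A1 + measure M ?A2"
      by (rule measure_Un_le) measurable
    also have "\<dots> \<le> \<eta> + \<eta>"
      by (intro add_mono less_imp_le 1 2) (use \<tau> \<tau>le Tm in auto)
    finally show ?thesis by simp
  qed
  have "AE \<omega> in M. \<bar>J1 \<omega> - J2 \<omega>\<bar> \<le> 2 / real (Suc n)" for n
  proof -
    let ?D = "{\<omega> \<in> space M. 2 * (1 / real (Suc n)) < \<bar>J1 \<omega> - J2 \<omega>\<bar>}"
    have "measure M ?D \<le> e" if "0 < e" for e
      using small[of "1 / real (Suc n)" "e / 2"] that by simp
    then have "measure M ?D \<le> 0"
      by (rule dense_ge)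
    then have "measure M ?D = 0"
      by (simp add: measure_le_0_iff)
    then have "AE \<omega> in M. \<omega> \<notin> ?D"
      by (intro AE_not_in) (auto simp: null_sets_def emeasure_eq_measure)
    then show ?thesis using AE_space by eventually_elim auto
  qed
  then have "AE \<omega> in M. \<forall>n. \<bar>J1 \<omega> - J2 \<omega>\<bar> \<le> 2 / real (Suc n)" by (simp add: AE_all_countable)
  then show ?thesis
  proof eventually_elim
    case (elim \<omega>)
    have "(\<lambda>n. 2 * inverse (real (Suc n))) \<longlonglongrightarrow> 2 * 0" by (intro tendsto_intros LIMSEQ_inverse_real_of_nat)
    then have "(\<lambda>n. 2 / real (Suc n)) \<longlonglongrightarrow> 0" by (simp add: divide_inverse)
    then have "\<bar>J1 \<omega> - J2 \<omega>\<bar> \<le> 0" by (rule LIMSEQ_le_const) (use elim in auto)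
    then show ?case by simp
  qed
qed

lemma (in basis_bm) stoch_integral_log:
  fixes s :: real
  assumes T: "0 < T" and c: "0 \<le> c" and v0: "v0 \<in> borel_measurable (F 0)" "AE \<omega> in M. v0 \<omega> \<noteq> 0"
  defines "v \<equiv> (\<lambda>t \<omega>. v0 \<omega> * exp (- (c + s\<^sup>2 / 2) * t + s * W t \<omega>))"
  shows "AE \<omega> in M. stoch_integral M T (\<lambda>t \<omega>. 1 / v t \<omega>) v \<omega> = - (c * T) + s * W T \<omega>"
proof -
  have h: "has_stoch_integral M T (\<lambda>t \<omega>. 1 / v t \<omega>) v (\<lambda>\<omega>. - (c * T) + s * (W T \<omega> - W 0 \<omega>))"
    unfolding v_def by (rule has_stoch_integral_log[OF T c v0])
  then have h': "has_stoch_integral M T (\<lambda>t \<omega>. 1 / v t \<omega>) v (stoch_integral M T (\<lambda>t \<omega>. 1 / v t \<omega>) v)"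
    unfolding stoch_integral_def by (rule someI[of "has_stoch_integral M T (\<lambda>t \<omega>. 1 / v t \<omega>) v"])
  have [measurable]: "v0 \<in> borel_measurable M" by (rule measurable_from_subalg[OF F_sub v0(1)]) simp
  have v_meas: "v t \<in> borel_measurable M" if "0 \<le> t" for t
    using W_M[OF that] unfolding v_def by measurable
  have "AE \<omega> in M. stoch_integral M T (\<lambda>t \<omega>. 1 / v t \<omega>) v \<omega> = - (c * T) + s * (W T \<omega> - W 0 \<omega>)"
    by (rule has_stoch_integral_unique[OF T _ v_meas h' h]) (use v_meas in auto)
  with W_0 show ?thesis by eventually_elim simp
qed

section \<open>The maximum likelihood estimator is exactly Gaussian\<close>

locale fourier_modes =
  fixes M :: "'a measure" and F :: "real \<Rightarrow> 'a measure"
    and w :: "nat \<Rightarrow> real \<Rightarrow> 'a \<Rightarrow> real" and \<mu> q :: "nat \<Rightarrow> real" and \<sigma> T :: real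
  assumes basis: "stochastic_basis M F"
    and bm: "\<And>k. k \<ge> 1 \<Longrightarrow> brownian_motion M F (w k)"
    and indep: "independent_processes M w {1..}"
    and mu_pos: "\<And>k. k \<ge> 1 \<Longrightarrow> 0 < \<mu> k"
    and q_pos: "\<And>k. k \<ge> 1 \<Longrightarrow> 0 < q k"
    and sigma_pos: "0 < \<sigma>" and T_pos: "0 < T"

sublocale fourier_modes \<subseteq> prob_space M
  using basis by (simp add: stochastic_basis_def)

context fourier_modes
begin

abbreviation I :: "nat \<Rightarrow> real" where "I \<equiv> fisher_info T \<sigma> \<mu> q"

lemma basis_bm_w: "1 \<le> k \<Longrightarrow> basis_bm M F (w k)"
  using basis bm by unfold_locales auto

lemma sum_mu_q_pos:
  assumes "1 \<le> N"
  shows "0 < (\<Sum>k=1..N. (\<mu> k)\<^sup>2 / (q k)\<^sup>2)"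
  using assms mu_pos q_pos by (intro sum_pos) (auto intro!: divide_pos_pos simp: less_imp_neq[THEN not_sym])

lemma fisher_pos: "1 \<le> N \<Longrightarrow> 0 < I N"
  using sum_mu_q_pos sigma_pos T_pos by (simp add: fisher_info_def)

text \<open>Well-posedness gives \<open>\<sigma>\<^sup>2 q\<^sub>N\<^sup>2 \<le> 2 \<theta>b \<mu>\<^sub>N\<close> for large \<open>N\<close>, so the last summand of the Fisher
  information alone is at least a multiple of \<open>\<mu>\<^sub>N\<close>.\<close>

lemma fisher_info_at_top:
  assumes mu_lim: "filterlim \<mu> at_top sequentially"
    and wp: "\<exists>\<theta>b>0. \<exists>N0::nat. \<exists>c>0. \<forall>k\<ge>N0. c \<le> 2 * \<theta>b - \<sigma>\<^sup>2 * (q k)\<^sup>2 / \<mu> k"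
  shows "filterlim I at_top sequentially"
proof -
  obtain \<theta>b N0 c where wp': "0 < \<theta>b" "0 < c" "\<And>k. N0 \<le> k \<Longrightarrow> c \<le> 2 * \<theta>b - \<sigma>\<^sup>2 * (q k)\<^sup>2 / \<mu> k"
    using wp by blast
  have "(T / (2 * \<theta>b)) * \<mu> N \<le> I N" if N: "max 1 N0 \<le> N" for N
  proof -
    have N1: "1 \<le> N" "N0 \<le> N" using N by auto
    have pos: "0 < \<mu> N" "0 < q N" using N1 mu_pos q_pos by auto
    have "\<sigma>\<^sup>2 * (q N)\<^sup>2 / \<mu> N \<le> 2 * \<theta>b" using wp'(3)[OF N1(2)] wp'(2) by simp
    then have "\<sigma>\<^sup>2 * (q N)\<^sup>2 \<le> 2 * \<theta>b * \<mu> N" using pos by (simp add: divide_le_eq)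
    then have "T * \<mu> N * (\<sigma>\<^sup>2 * (q N)\<^sup>2) \<le> T * \<mu> N * (2 * \<theta>b * \<mu> N)"
      using T_pos pos by (intro mult_left_mono) auto
    then have "T / (2 * \<theta>b) * \<mu> N \<le> T / \<sigma>\<^sup>2 * ((\<mu> N)\<^sup>2 / (q N)\<^sup>2)"
      using pos wp'(1) sigma_pos by (simp add: field_simps power2_eq_square)
    also have "\<dots> \<le> I N"
      unfolding fisher_info_def using N1 T_pos
      by (intro mult_left_mono member_le_sum) auto
    finally show ?thesis .
  qed
  then have ev: "\<forall>\<^sub>F N in sequentially. (T / (2 * \<theta>b)) * \<mu> N \<le> I N"
    by (rule eventually_sequentiallyI)
  have "filterlim (\<lambda>N. (T / (2 * \<theta>b)) * \<mu> N) at_top sequentially"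
    using T_pos wp'(1) by (intro filterlim_tendsto_pos_mult_at_top[OF tendsto_const _ mu_lim]) auto
  then show ?thesis using ev by (rule filterlim_at_top_mono)
qed

text \<open>A version of \<open>\<xi>\<^sub>N\<close> built from increments, because a Brownian motion starts at \<open>0\<close> only almost
  surely and it is the increments whose densities are given.\<close>

definition Y :: "nat \<Rightarrow> 'a \<Rightarrow> real" where
  "Y N \<omega> = (\<Sum>k=1..N. 0 + - (\<mu> k / q k) / (\<sigma> * sqrt (I N)) * (w k T \<omega> - w k 0 \<omega>))"

lemma xi_eq_Y: "AE \<omega> in M. xi T \<sigma> \<mu> q w N \<omega> = Y N \<omega>"
proof -
  have "AE \<omega> in M. \<forall>k\<in>{1..N}. w k 0 \<omega> = 0"
    by (intro AE_finite_allI) (auto intro!: basis_bm.W_0 basis_bm_w)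
  then show ?thesis
    unfolding xi_def Y_def sum_distrib_left
    by eventually_elim (rule sum.cong, simp_all)
qed

lemma Y_distributed:
  assumes N: "1 \<le> N"
  shows "distributed M lborel (Y N) std_normal_density"
proof -
  define a where "a = (\<lambda>k. - (\<mu> k / q k) / (\<sigma> * sqrt (I N)))"
  define Z where "Z = (\<lambda>k \<omega>. 0 + a k * (w k T \<omega> - w k 0 \<omega>))"
  have IN: "0 < I N" by (rule fisher_pos[OF N])
  have a0: "a k \<noteq> 0" if "1 \<le> k" for k
    using mu_pos[OF that] q_pos[OF that] sigma_pos IN by (simp add: a_def)
  have "indep_vars (\<lambda>_. PiM {0..} (\<lambda>_. borel)) (\<lambda>k \<omega>. \<lambda>t\<in>{0..}. w k t \<omega>) {1..N}"
    by (rule indep_vars_subset[OF indep[unfolded independent_processes_def]]) auto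
  moreover have "(\<lambda>f. 0 + a k * (f T - f 0)) \<in> borel_measurable (PiM {0..} (\<lambda>_. borel))" for k
    using T_pos by (intro borel_measurable_add borel_measurable_times borel_measurable_diff
        borel_measurable_const measurable_component_singleton) auto
  ultimately have "indep_vars (\<lambda>_. borel) (\<lambda>k \<omega>. 0 + a k * ((\<lambda>t\<in>{0..}. w k t \<omega>) T - (\<lambda>t\<in>{0..}. w k t \<omega>) 0)) {1..N}"
    by (rule indep_vars_compose2)
  then have ind: "indep_vars (\<lambda>_. borel) Z {1..N}" using T_pos by (simp add: Z_def)
  have "distributed M lborel (Z k) (normal_density 0 (\<bar>a k\<bar> * sqrt T))" if "k \<in> {1..N}" for k
    using normal_density_affine[OF basis_bm.W_incr[OF basis_bm_w order_refl T_pos], of k "a k" 0] a0[of k] that T_pos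
    by (simp add: Z_def)
  from sum_indep_normal[OF _ _ ind _ this]
  have "distributed M lborel (\<lambda>\<omega>. \<Sum>k=1..N. Z k \<omega>) (normal_density (\<Sum>k=1..N. 0) (sqrt (\<Sum>k=1..N. (\<bar>a k\<bar> * sqrt T)\<^sup>2)))"
    using N a0 T_pos by simp
  moreover have "(\<Sum>k=1..N. (\<bar>a k\<bar> * sqrt T)\<^sup>2) = 1"
  proof -
    have "(\<Sum>k=1..N. (\<bar>a k\<bar> * sqrt T)\<^sup>2) = (\<Sum>k=1..N. T / (\<sigma>\<^sup>2 * I N) * ((\<mu> k)\<^sup>2 / (q k)\<^sup>2))"
      using IN T_pos by (intro sum.cong) (simp_all add: a_def power_mult_distrib power_divide mult_ac)
    also have "\<dots> = T / (\<sigma>\<^sup>2 * I N) * (\<Sum>k=1..N. (\<mu> k)\<^sup>2 / (q k)\<^sup>2)"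
      by (rule sum_distrib_left[symmetric])
    also have "\<dots> = (T / \<sigma>\<^sup>2 * (\<Sum>k=1..N. (\<mu> k)\<^sup>2 / (q k)\<^sup>2)) / I N" by simp
    also have "T / \<sigma>\<^sup>2 * (\<Sum>k=1..N. (\<mu> k)\<^sup>2 / (q k)\<^sup>2) = I N" by (simp only: fisher_info_def)
    finally show ?thesis using IN by simp
  qed
  moreover have "(\<lambda>\<omega>. \<Sum>k=1..N. Z k \<omega>) = Y N" by (simp add: fun_eq_iff Z_def Y_def a_def)
  ultimately show ?thesis by simp
qed

lemma Y_measurable: "1 \<le> N \<Longrightarrow> Y N \<in> borel_measurable M"
  using distributed_measurable[OF Y_distributed] by simp

lemma Y_distr:
  assumes "1 \<le> N"
  shows "distr M borel (Y N) = std_normal_distribution"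
proof -
  have "distr M borel (Y N) = distr M lborel (Y N)" by (rule distr_cong) auto
  then show ?thesis using distributed_distr_eq_density[OF Y_distributed[OF assms]] by simp
qed

text \<open>By Ito's formula the integrals in the estimator are \<open>- \<theta> \<mu>\<^sub>k T + \<sigma> q\<^sub>k w\<^sub>k(T)\<close>; the drift parts
  add up to \<open>\<theta>\<close> and the noise parts to \<open>\<xi>\<^sub>N / sqrt I\<^sub>N\<close>.\<close>

lemma theta_hat_eq:
  assumes N: "1 \<le> N" and \<theta>: "0 < \<theta>"
    and u0_meas: "\<And>k. k \<ge> 1 \<Longrightarrow> u0 k \<in> borel_measurable (F 0)"
    and u0_nz: "\<And>k. k \<ge> 1 \<Longrightarrow> AE \<omega> in M. u0 k \<omega> \<noteq> 0"
  defines "u \<equiv> (\<lambda>k t \<omega>. u0 k \<omega> * exp (- (\<theta> * \<mu> k + \<sigma>\<^sup>2 * (q k)\<^sup>2 / 2) * t + \<sigma> * q k * w k t \<omega>))"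
  shows "AE \<omega> in M. theta_hat M T \<mu> q u N \<omega> = \<theta> + Y N \<omega> / sqrt (I N)"
proof -
  have "AE \<omega> in M. stoch_integral M T (\<lambda>t \<omega>. 1 / u k t \<omega>) (u k) \<omega> = - (\<theta> * \<mu> k * T) + \<sigma> * q k * w k T \<omega>"
    if k: "1 \<le> k" for k
  proof -
    have c: "0 \<le> \<theta> * \<mu> k" using \<theta> mu_pos[OF k] by simp
    show ?thesis
      using basis_bm.stoch_integral_log[OF basis_bm_w[OF k] T_pos c u0_meas[OF k] u0_nz[OF k], of "\<sigma> * q k"]
      unfolding u_def power_mult_distrib .
  qed
  then have "AE \<omega> in M. \<forall>k\<in>{1..N}. stoch_integral M T (\<lambda>t \<omega>. 1 / u k t \<omega>) (u k) \<omega> = - (\<theta> * \<mu> k * T) + \<sigma> * q k * w k T \<omega>"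
    by (intro AE_finite_allI) auto
  with xi_eq_Y[of N] show ?thesis
  proof eventually_elim
    case (elim \<omega>)
    define S where "S = (\<Sum>k=1..N. (\<mu> k)\<^sup>2 / (q k)\<^sup>2)"
    define V where "V = (\<Sum>k=1..N. \<mu> k / q k * w k T \<omega>)"
    have IS: "I N = T / \<sigma>\<^sup>2 * S" by (simp only: fisher_info_def S_def)
    have S: "0 < S" unfolding S_def by (rule sum_mu_q_pos[OF N])
    have "(\<Sum>k=1..N. \<mu> k / (q k)\<^sup>2 * stoch_integral M T (\<lambda>t \<omega>. 1 / u k t \<omega>) (u k) \<omega>)
        = (\<Sum>k=1..N. - (\<theta> * T) * ((\<mu> k)\<^sup>2 / (q k)\<^sup>2) + \<sigma> * (\<mu> k / q k * w k T \<omega>))"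
    proof (rule sum.cong)
      fix k assume k: "k \<in> {1..N}"
      then have "0 < q k" using q_pos by simp
      have "stoch_integral M T (\<lambda>t \<omega>. 1 / u k t \<omega>) (u k) \<omega> = - (\<theta> * \<mu> k * T) + \<sigma> * q k * w k T \<omega>"
        using elim(2) k by blast
      then show "\<mu> k / (q k)\<^sup>2 * stoch_integral M T (\<lambda>t \<omega>. 1 / u k t \<omega>) (u k) \<omega> =
          - (\<theta> * T) * ((\<mu> k)\<^sup>2 / (q k)\<^sup>2) + \<sigma> * (\<mu> k / q k * w k T \<omega>)"
        using \<open>0 < q k\<close> by (simp only:) (simp add: power2_eq_square field_simps)
    qed simp
    also have "\<dots> = - (\<theta> * T) * S + \<sigma> * V" unfolding sum.distrib S_def V_def by (simp add: sum_distrib_left sum_negf)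
    finally have "theta_hat M T \<mu> q u N \<omega> = - (- (\<theta> * T) * S + \<sigma> * V) / (T * S)"
      unfolding theta_hat_def S_def by simp
    also have "\<dots> = \<theta> - \<sigma> * V / (T * S)" using S T_pos by (simp add: field_simps)
    also have "\<sigma> * V / (T * S) = V / (\<sigma> * I N)"
      using S T_pos sigma_pos by (simp add: IS field_simps power2_eq_square)
    also have "\<theta> - V / (\<sigma> * I N) = \<theta> + xi T \<sigma> \<mu> q w N \<omega> / sqrt (I N)"
    proof -
      have "xi T \<sigma> \<mu> q w N \<omega> = - (1 / (\<sigma> * sqrt (I N))) * V" by (simp only: xi_def V_def)
      then show ?thesis using fisher_pos[OF N] sigma_pos by (simp add: mult.assoc)
    qed
    finally show ?case using elim(1) by simp
  qed
qed

text \<open>An almost sure property of \<open>Y N\<close> holds somewhere in every interval, as the normal density is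
  positive. The property \<open>P\<close> may be non-measurable.\<close>

lemma AE_Y_imp_point:
  assumes N: "1 \<le> N" and AE: "AE \<omega> in M. P (Y N \<omega>)" and ab: "a < b"
  shows "\<exists>z. a < z \<and> z < b \<and> P z"
proof (rule ccontr)
  assume c: "\<not> ?thesis"
  from AE have "AE \<omega> in M. Y N \<omega> \<notin> {a<..<b}"
    by eventually_elim (use c in auto)
  then have "AE z in distr M borel (Y N). z \<notin> {a<..<b}"
    using Y_measurable[OF N] by (subst AE_distr_iff) auto
  then have "AE z in lborel. z \<notin> {a<..<b}"
    unfolding Y_distr[OF N] by (subst (asm) AE_density) (auto simp: normal_density_pos)
  then have "emeasure lborel {a<..<b} = 0"
    by (subst (asm) AE_iff_measurable[where N = "{a<..<b}"]) auto
  then show False using ab by simp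
qed

text \<open>Events contained in \<open>{R < \<bar>Y N\<bar>}\<close> for large \<open>N\<close> are negligible, because the tail of \<open>Y N\<close> is the
  same for all \<open>N\<close>.\<close>

lemma SUP_emeasure_tendsto_0:
  assumes A: "\<And>R. \<forall>\<^sub>F N in sequentially. \<forall>\<theta>\<in>\<Theta>. AE \<omega> in M. \<omega> \<in> A \<theta> N \<longrightarrow> R < \<bar>Y N \<omega>\<bar>"
  shows "(\<lambda>N. SUP \<theta>\<in>\<Theta>. emeasure M (A \<theta> N)) \<longlonglongrightarrow> 0"
proof (rule order_tendstoI)
  fix e :: ennreal assume "0 < e"
  then obtain e' where e': "0 < e'" "e' < e" using dense by blast
  have "(\<integral>\<^sup>+z. ennreal (std_normal_density z) \<partial>lborel) < \<infinity>"
    using prob_space.emeasure_space_1[OF prob_space_normal_density[of 1 0]]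
    by (simp add: emeasure_density)
  from nn_integral_tail_small[OF _ this e'(1)] obtain R where
    R: "nn_tail (\<lambda>z. ennreal (std_normal_density z)) R < e'" by auto
  have "\<forall>\<^sub>F N in sequentially. (SUP \<theta>\<in>\<Theta>. emeasure M (A \<theta> N)) < e"
    using A[of R] eventually_ge_at_top[of 1]
  proof eventually_elim
    case (elim N)
    have [measurable]: "Y N \<in> borel_measurable M" by (rule Y_measurable[OF elim(2)])
    have "emeasure M {\<omega> \<in> space M. R < \<bar>Y N \<omega>\<bar>} = emeasure (distr M borel (Y N)) {z. R < \<bar>z\<bar>}"
      by (subst emeasure_distr) (auto intro!: arg_cong2[where f = emeasure])
    also have "\<dots> < e'" unfolding Y_distr[OF elim(2)] using R by (subst emeasure_density) auto
    finally have Re: "emeasure M {\<omega> \<in> space M. R < \<bar>Y N \<omega>\<bar>} < e'" .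
    have "(SUP \<theta>\<in>\<Theta>. emeasure M (A \<theta> N)) \<le> e'"
    proof (rule SUP_least)
      fix \<theta> assume "\<theta> \<in> \<Theta>"
      with elim(1) have "AE \<omega> in M. \<omega> \<in> A \<theta> N \<longrightarrow> R < \<bar>Y N \<omega>\<bar>" by blast
      with AE_space have "AE \<omega> in M. \<omega> \<in> A \<theta> N \<longrightarrow> \<omega> \<in> {\<omega> \<in> space M. R < \<bar>Y N \<omega>\<bar>}" by eventually_elim auto
      then have "emeasure M (A \<theta> N) \<le> emeasure M {\<omega> \<in> space M. R < \<bar>Y N \<omega>\<bar>}" by (rule emeasure_mono_AE) simp
      then show "emeasure M (A \<theta> N) \<le> e'" using Re by simp
    qed
    then show ?case using e'(2) by simp
  qed
  then show "\<forall>\<^sub>F N in sequentially. (SUP \<theta>\<in>\<Theta>. emeasure M (A \<theta> N)) < e" .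
qed simp

end

section \<open>Measurability and uniform convergence of expectations\<close>

lemma loss_AE_isCont:
  assumes "\<pi> \<in> losses_Wp"
  shows "AE z in lborel. isCont \<pi> z"
proof -
  have sym: "\<And>x. \<pi> (- x) = \<pi> x" and mono: "mono_on {0..} \<pi>"
    using assms by (auto simp: losses_Wp_def losses_W_def)
  define D where "D = {a\<in>{0<..}. \<not> isCont \<pi> a}"
  have cD: "countable D"
    unfolding D_def by (rule mono_on_ctble_discont_open[OF open_greaterThan])
      (auto intro: mono_on_subset[OF mono])
  have "countable ({0} \<union> D \<union> uminus ` D)" using cD by auto
  then have "AE z in lborel. z \<notin> {0} \<union> D \<union> uminus ` D"
    by (intro AE_not_in countable_imp_null_set_lborel)
  then show ?thesis
  proof eventually_elim
    case (elim z)
    show ?case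
    proof (cases "0 < z")
      case True then show ?thesis using elim by (auto simp: D_def)
    next
      case False
      have "- z \<notin> D"
      proof
        assume "- z \<in> D"
        from imageI[OF this, of uminus] show False using elim by simp
      qed
      then have "isCont \<pi> (- z)" using elim False by (simp add: D_def)
      then have "isCont (\<lambda>x. \<pi> (- x)) z" 
        using isCont_o2[of z "\<lambda>x. - x" \<pi>] continuous_minus[OF continuous_ident[of z UNIV]] by blast
      then show ?thesis by (simp only: sym)
    qed
  qed
qed

lemma std_normal_AE: "(AE z in lborel. P z) \<Longrightarrow> (AE z in std_normal_distribution. P z)"
  by (subst AE_density) auto

lemma std_normal_integrable_growth:
  "integrable std_normal_distribution (\<lambda>z. (1 + \<bar>z\<bar>) ^ k)"
proof -
  have "integrable lborel (\<lambda>z. 1 / sqrt (2 * pi) * (gauss_poly k (1/2) z))"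
    by (intro integrable_mult_right integrable_growth_gauss) simp
  then have "integrable lborel (\<lambda>z. std_normal_density z *\<^sub>R (1 + \<bar>z\<bar>) ^ k)"
    by (simp add: std_normal_density_def mult_ac)
  then show ?thesis by (subst integrable_density) auto
qed

text \<open>For each \<open>N\<close> choose a parameter that violates the claimed bound, if there is one. Along this choice
  the errors converge pointwise to the identity with a common linear bound, so dominated convergence
  applies and the violation must eventually stop.\<close>

lemma std_normal_uniform_limit:
  fixes f :: "real \<Rightarrow> real" and \<psi> :: "nat \<Rightarrow> real \<Rightarrow> real \<Rightarrow> real"
  assumes f_meas [measurable]: "f \<in> borel_measurable borel"
    and f_cont: "AE z in lborel. isCont f z"
    and f_gr: "\<And>y. \<bar>f y\<bar> \<le> A * (1 + \<bar>y\<bar>) ^ k"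
    and \<psi>_meas: "\<forall>\<^sub>F N in sequentially. \<forall>\<theta>\<in>\<Theta>. \<psi> N \<theta> \<in> borel_measurable borel"
    and \<psi>_lim: "\<And>R e. 0 < e \<Longrightarrow> \<forall>\<^sub>F N in sequentially. \<forall>\<theta>\<in>\<Theta>. \<forall>z. \<bar>z\<bar> \<le> R \<longrightarrow> \<bar>\<psi> N \<theta> z - z\<bar> < e"
    and \<psi>_gr: "\<forall>\<^sub>F N in sequentially. \<forall>\<theta>\<in>\<Theta>. \<forall>z. \<bar>\<psi> N \<theta> z\<bar> \<le> C * (1 + \<bar>z\<bar>)"
  shows "\<forall>\<^sub>F N in sequentially. \<forall>\<theta>\<in>\<Theta>. integrable std_normal_distribution (\<lambda>z. f (\<psi> N \<theta> z))"
    and "0 < e \<Longrightarrow> \<forall>\<^sub>F N in sequentially. \<forall>\<theta>\<in>\<Theta>.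
      \<bar>(LINT z|std_normal_distribution. f (\<psi> N \<theta> z)) - (LINT z|std_normal_distribution. f z)\<bar> < e"
proof -
  let ?\<nu> = std_normal_distribution
  define W where "W = (\<lambda>z. (A * (1 + \<bar>C\<bar>) ^ k) * (1 + \<bar>z\<bar>) ^ k)"
  have W_int: "integrable ?\<nu> W"
    unfolding W_def by (intro integrable_mult_right std_normal_integrable_growth)
  have A0: "0 \<le> A" using f_gr[of 0] by simp
  have W: "\<bar>f y\<bar> \<le> W z" if "\<bar>y\<bar> \<le> C * (1 + \<bar>z\<bar>)" for y z
  proof -
    have "C * (1 + \<bar>z\<bar>) \<le> \<bar>C\<bar> * (1 + \<bar>z\<bar>)" by (intro mult_right_mono) auto
    with that have "\<bar>y\<bar> \<le> \<bar>C\<bar> * (1 + \<bar>z\<bar>)" by (rule order_trans)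
    then have "1 + \<bar>y\<bar> \<le> 1 * (1 + \<bar>z\<bar>) + \<bar>C\<bar> * (1 + \<bar>z\<bar>)" by (intro add_mono) auto
    then have "1 + \<bar>y\<bar> \<le> (1 + \<bar>C\<bar>) * (1 + \<bar>z\<bar>)" unfolding distrib_right[of 1 "\<bar>C\<bar>"] .
    then have "(1 + \<bar>y\<bar>) ^ k \<le> ((1 + \<bar>C\<bar>) * (1 + \<bar>z\<bar>)) ^ k" by (intro power_mono) auto
    then have "A * (1 + \<bar>y\<bar>) ^ k \<le> W z" unfolding W_def using A0 by (simp add: power_mult_distrib mult.assoc mult_left_mono)
    then show ?thesis using f_gr[of y] by simp
  qed
  obtain N0 where N0: "\<And>N \<theta>. N0 \<le> N \<Longrightarrow> \<theta> \<in> \<Theta> \<Longrightarrow> \<psi> N \<theta> \<in> borel_measurable borel"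
    "\<And>N \<theta> z. N0 \<le> N \<Longrightarrow> \<theta> \<in> \<Theta> \<Longrightarrow> \<bar>\<psi> N \<theta> z\<bar> \<le> C * (1 + \<bar>z\<bar>)"
    using eventually_conj[OF \<psi>_meas \<psi>_gr] unfolding eventually_sequentially by blast
  have fpsi_meas: "(\<lambda>z. f (\<psi> N \<theta> z)) \<in> borel_measurable ?\<nu>" if "N0 \<le> N" "\<theta> \<in> \<Theta>" for N \<theta>
    using measurable_compose[OF N0(1)[OF that] f_meas] by simp
  have "integrable ?\<nu> (\<lambda>z. f (\<psi> N \<theta> z))" if "N0 \<le> N" "\<theta> \<in> \<Theta>" for N \<theta>
    by (rule Bochner_Integration.integrable_bound[OF W_int fpsi_meas[OF that]])
      (use W[OF N0(2)[OF that]] in \<open>auto intro: order_trans[OF _ abs_ge_self]\<close>)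
  then show "\<forall>\<^sub>F N in sequentially. \<forall>\<theta>\<in>\<Theta>. integrable ?\<nu> (\<lambda>z. f (\<psi> N \<theta> z))"
    unfolding eventually_sequentially by blast
  assume e: "0 < e"
  let ?P = "\<lambda>N \<theta>. \<bar>(LINT z|?\<nu>. f (\<psi> N \<theta> z)) - (LINT z|?\<nu>. f z)\<bar> < e"
  show "\<forall>\<^sub>F N in sequentially. \<forall>\<theta>\<in>\<Theta>. ?P N \<theta>"
  proof (cases "\<Theta> = {}")
    case False
    \<comment> \<open>The candidate for violating the bound at stage \<open>N\<close>.\<close>
    define t where "t = (\<lambda>N. if \<exists>\<theta>\<in>\<Theta>. \<not> ?P N \<theta> then SOME \<theta>. \<theta> \<in> \<Theta> \<and> \<not> ?P N \<theta> else SOME \<theta>. \<theta> \<in> \<Theta>)"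
    have t_in: "t N \<in> \<Theta>" for N
    proof (cases "\<exists>\<theta>\<in>\<Theta>. \<not> ?P N \<theta>")
      case True
      then have "\<exists>\<theta>. \<theta> \<in> \<Theta> \<and> \<not> ?P N \<theta>" by blast
      from someI_ex[OF this] show ?thesis using True by (simp add: t_def)
    next
      case F: False
      have "(SOME \<theta>. \<theta> \<in> \<Theta>) \<in> \<Theta>" using False by (simp add: some_in_eq)
      then show ?thesis using F by (simp add: t_def)
    qed
    have t_bad: "\<forall>\<theta>\<in>\<Theta>. ?P N \<theta>" if "?P N (t N)" for N
    proof (rule ccontr)
      assume n: "\<not> ?thesis"
      then have "\<exists>\<theta>. \<theta> \<in> \<Theta> \<and> \<not> ?P N \<theta>" by blast
      from someI_ex[OF this] show False using n that by (simp add: t_def)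
    qed
    have lim: "(\<lambda>n. \<psi> (n + N0) (t (n + N0)) z) \<longlonglongrightarrow> z" for z
    proof (rule LIMSEQ_I)
      fix r :: real assume "0 < r"
      from \<psi>_lim[OF this, of "\<bar>z\<bar>"] obtain N1 where "\<And>N. N1 \<le> N \<Longrightarrow> \<bar>\<psi> N (t N) z - z\<bar> < r"
        unfolding eventually_sequentially using t_in by blast
      then show "\<exists>no. \<forall>n\<ge>no. norm (\<psi> (n + N0) (t (n + N0)) z - z) < r"
        by (intro exI[of _ N1]) auto
    qed
    have "(\<lambda>n. LINT z|?\<nu>. f (\<psi> (n + N0) (t (n + N0)) z)) \<longlonglongrightarrow> (LINT z|?\<nu>. f z)"
    proof (rule integral_dominated_convergence[OF _ _ W_int])
      show "AE z in ?\<nu>. (\<lambda>n. f (\<psi> (n + N0) (t (n + N0)) z)) \<longlonglongrightarrow> f z"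
        using std_normal_AE[OF f_cont]
        by eventually_elim (rule isCont_tendsto_compose[OF _ lim])
      show "AE z in ?\<nu>. norm (f (\<psi> (n + N0) (t (n + N0)) z)) \<le> W z" for n
        using W[OF N0(2)[OF _ t_in]] by auto
      show "(\<lambda>z. f (\<psi> (n + N0) (t (n + N0)) z)) \<in> borel_measurable ?\<nu>" for n
        by (rule fpsi_meas[OF _ t_in]) simp
    qed simp
    then have "(\<lambda>N. LINT z|?\<nu>. f (\<psi> N (t N) z)) \<longlonglongrightarrow> (LINT z|?\<nu>. f z)"
      by (rule LIMSEQ_offset)
    from tendstoD[OF this e] have "\<forall>\<^sub>F N in sequentially. ?P N (t N)" by (simp add: dist_real_def)
    then show ?thesis by eventually_elim (rule t_bad)
  qed simp
qed

lemma SUP_ennreal_tendsto: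
  fixes x :: "nat \<Rightarrow> real \<Rightarrow> real"
  assumes "\<Theta> \<noteq> {}" and h: "\<forall>\<^sub>F N in sequentially. \<forall>\<theta>\<in>\<Theta>. h N \<theta> = ennreal (x N \<theta>)"
    and x: "\<And>e. 0 < e \<Longrightarrow> \<forall>\<^sub>F N in sequentially. \<forall>\<theta>\<in>\<Theta>. \<bar>x N \<theta> - p\<bar> < e"
  shows "(\<lambda>N. SUP \<theta>\<in>\<Theta>. h N \<theta>) \<longlonglongrightarrow> ennreal p"
proof -
  obtain \<theta>0 where \<theta>0: "\<theta>0 \<in> \<Theta>" using assms(1) by blast
  have bounds: "\<forall>\<^sub>F N in sequentially. (SUP \<theta>\<in>\<Theta>. h N \<theta>) \<le> ennreal (p + e) \<and> ennreal (p - e) \<le> (SUP \<theta>\<in>\<Theta>. h N \<theta>)"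
    if "0 < e" for e
    using h x[OF that]
  proof eventually_elim
    case (elim N)
    have "h N \<theta> \<le> ennreal (p + e)" if "\<theta> \<in> \<Theta>" for \<theta> using elim that by (force intro!: ennreal_leI)
    moreover have "ennreal (p - e) \<le> h N \<theta>0" using elim \<theta>0 by (force intro!: ennreal_leI)
    ultimately show ?case using \<theta>0 by (auto intro!: SUP_least intro: SUP_upper2)
  qed
  show ?thesis
  proof (rule order_tendstoI)
    fix a assume a: "a < ennreal p"
    have "((\<lambda>e. ennreal (p - e)) \<longlongrightarrow> ennreal (p - 0)) (at_right 0)" by (intro tendsto_intros)
    then have "\<forall>\<^sub>F e in at_right 0. a < ennreal (p - e)" using a by (intro order_tendstoD(1)) auto
    then have "\<forall>\<^sub>F e::real in at_right 0. a < ennreal (p - e) \<and> 0 < e"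
      using eventually_at_right_less by eventually_elim simp
    then obtain e where "a < ennreal (p - e)" "0 < e"
      using eventually_happens[of _ "at_right (0::real)"] by auto
    with bounds[of e] show "\<forall>\<^sub>F N in sequentially. a < (SUP \<theta>\<in>\<Theta>. h N \<theta>)"
      by (auto elim!: eventually_mono intro: less_le_trans)
  next
    fix a assume a: "ennreal p < a"
    have "((\<lambda>e. ennreal (p + e)) \<longlongrightarrow> ennreal (p + 0)) (at_right 0)" by (intro tendsto_intros)
    then have "\<forall>\<^sub>F e in at_right 0. ennreal (p + e) < a" using a by (intro order_tendstoD(2)) auto
    then have "\<forall>\<^sub>F e::real in at_right 0. ennreal (p + e) < a \<and> 0 < e"
      using eventually_at_right_less by eventually_elim simp
    then obtain e where "ennreal (p + e) < a" "0 < e"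
      using eventually_happens[of _ "at_right (0::real)"] by auto
    with bounds[of e] show "\<forall>\<^sub>F N in sequentially. (SUP \<theta>\<in>\<Theta>. h N \<theta>) < a"
      by (auto elim!: eventually_mono intro: le_less_trans)
  qed
qed

lemma borel_measurable_AE_complete:
  fixes f g :: "'a \<Rightarrow> real"
  assumes "complete_measure M" and g: "g \<in> borel_measurable M" and AE: "AE \<omega> in M. f \<omega> = g \<omega>"
  shows "f \<in> borel_measurable M"
proof (rule measurableI)
  interpret complete_measure M by fact
  fix S :: "real set" assume S: "S \<in> sets borel"
  obtain N where N: "{\<omega> \<in> space M. \<not> f \<omega> = g \<omega>} \<subseteq> N" "N \<in> null_sets M"
    using AE by (auto simp: eventually_ae_filter)
  have "f -` S \<inter> space M = ((g -` S \<inter> space M) - N) \<union> (f -` S \<inter> space M \<inter> N)"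
    using N(1) by auto
  moreover have "f -` S \<inter> space M \<inter> N \<in> sets M"
    by (rule complete[OF _ N(2)]) auto
  moreover have "(g -` S \<inter> space M) - N \<in> sets M"
    using measurable_sets[OF g S] N(2) by auto
  ultimately show "f -` S \<inter> space M \<in> sets M" by (metis sets.Un)
qed simp

section \<open>Asymptotic normality and efficiency\<close>

theorem theorem4p3:
  fixes M :: "'a measure" and F :: "real \<Rightarrow> 'a measure"
    and w :: "nat \<Rightarrow> real \<Rightarrow> 'a \<Rightarrow> real"
    and \<mu> q :: "nat \<Rightarrow> real" and \<sigma> T :: real
    and u0 :: "nat \<Rightarrow> 'a \<Rightarrow> real"
    and u :: "real \<Rightarrow> nat \<Rightarrow> real \<Rightarrow> 'a \<Rightarrow> real"
    and B :: "real set" and \<rho> \<l> :: "real \<Rightarrow> real"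
    and I :: "nat \<Rightarrow> real"
    and \<theta>h \<beta> :: "real \<Rightarrow> nat \<Rightarrow> 'a \<Rightarrow> real"
    and \<xi> :: "nat \<Rightarrow> 'a \<Rightarrow> real"
  assumes basis: "stochastic_basis M F"
    and bm: "\<And>k. k \<ge> 1 \<Longrightarrow> brownian_motion M F (w k)"
    and indep: "independent_processes M w {1..}"
    and mu_pos: "\<And>k. k \<ge> 1 \<Longrightarrow> 0 < \<mu> k"
    and mu_lim: "filterlim \<mu> at_top sequentially"
    and q_pos: "\<And>k. k \<ge> 1 \<Longrightarrow> 0 < q k"
    and sigma_pos: "0 < \<sigma>" and T_pos: "0 < T"
    and u0_meas: "\<And>k. k \<ge> 1 \<Longrightarrow> u0 k \<in> borel_measurable (F 0)"
    and u0_nz: "\<And>k. k \<ge> 1 \<Longrightarrow> AE \<omega> in M. u0 k \<omega> \<noteq> 0"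
    and well_posed: "\<exists>\<theta>b>0. \<exists>N0::nat. \<exists>c>0. \<forall>k\<ge>N0. c \<le> 2 * \<theta>b - \<sigma>\<^sup>2 * (q k)\<^sup>2 / \<mu> k"
    and u_def: "u = (\<lambda>\<theta> k t \<omega>. u0 k \<omega> *
                  exp (- (\<theta> * \<mu> k + \<sigma>\<^sup>2 * (q k)\<^sup>2 / 2) * t + \<sigma> * q k * w k t \<omega>))"
    and I_def: "I = fisher_info T \<sigma> \<mu> q"
    and thetah_def: "\<theta>h = (\<lambda>\<theta>. theta_hat M T \<mu> q (u \<theta>))"
    and xi_def: "\<xi> = xi T \<sigma> \<mu> q w"
    and B: "compact B" "B \<subseteq> {0<..}"
    and prior: "\<rho> \<in> priors_Qp"
    and loss: "\<l> \<in> losses_Wp"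
    and norm_ok: "\<And>\<theta> N. 0 < \<theta> \<Longrightarrow> N \<ge> 1 \<Longrightarrow>
          AE \<omega> in M. 0 < posterior_norm \<rho> (I N) (\<theta>h \<theta> N \<omega>) \<and>
                     posterior_norm \<rho> (I N) (\<theta>h \<theta> N \<omega>) < \<infinity>"
    and strict_min: "\<And>\<theta> N. 0 < \<theta> \<Longrightarrow> N \<ge> 1 \<Longrightarrow>
          AE \<omega> in M. \<exists>!b. is_arg_min (posterior_risk \<rho> \<l> (I N) (\<theta>h \<theta> N \<omega>)) (\<lambda>b. 0 < b) b"
    and beta_def: "\<beta> = (\<lambda>\<theta> N \<omega>. bayes_estimator \<rho> \<l> (I N) (\<theta>h \<theta> N \<omega>))"
  shows
    "(\<forall>\<epsilon>>0. (\<lambda>N. SUP \<theta>\<^sub>0\<in>B. emeasure M {\<omega> \<in> space M. \<epsilon> < \<bar>\<beta> \<theta>\<^sub>0 N \<omega> - \<theta>\<^sub>0\<bar>}) \<longlonglongrightarrow> 0)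
   \<and> (\<forall>g::real \<Rightarrow> real. continuous_on UNIV g \<and> bounded (range g) \<longrightarrow>
        (\<lambda>N. SUP \<theta>\<^sub>0\<in>B. ennreal
            \<bar>(LINT \<omega>|M. g (sqrt (I N) * (\<beta> \<theta>\<^sub>0 N \<omega> - \<theta>\<^sub>0)))
              - (LINT x|std_normal_distribution. g x)\<bar>) \<longlonglongrightarrow> 0)
   \<and> (\<forall>\<epsilon>>0. (\<lambda>N. SUP \<theta>\<^sub>0\<in>B. emeasure M
          {\<omega> \<in> space M. \<epsilon> < \<bar>sqrt (I N) * (\<beta> \<theta>\<^sub>0 N \<omega> - \<theta>\<^sub>0) - \<xi> N \<omega>\<bar>}) \<longlonglongrightarrow> 0)
   \<and> (\<forall>\<pi>\<in>losses_Wp. \<forall>\<theta>\<^sub>0\<in>B.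
        ((\<lambda>\<delta>. liminf (\<lambda>N. SUP \<theta>\<in>{\<theta>. 0 < \<theta> \<and> \<bar>\<theta> - \<theta>\<^sub>0\<bar> < \<delta>}.
            \<integral>\<^sup>+\<omega>. ennreal (\<pi> (sqrt (I N) * (\<beta> \<theta> N \<omega> - \<theta>))) \<partial>M))
          \<longlongrightarrow> (\<integral>\<^sup>+x. ennreal (\<pi> x) \<partial>std_normal_distribution)) (at_right 0))"
proof -
  interpret fm: fourier_modes M F w \<mu> q \<sigma> T
    by unfold_locales (use basis bm indep mu_pos q_pos sigma_pos T_pos in auto)
  let ?Y = "fm.Y"
  let ?\<nu> = std_normal_distribution
  let ?err = "\<lambda>N \<theta> \<omega>. sqrt (I N) * (\<beta> \<theta> N \<omega> - \<theta>)"
  have I_pos: "0 < I N" if "1 \<le> N" for N using fm.fisher_pos[OF that] by (simp add: I_def)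
  have I_top: "filterlim I at_top sequentially"
    unfolding I_def by (rule fm.fisher_info_at_top[OF mu_lim well_posed])
  have I_ge: "\<forall>\<^sub>F N in sequentially. c \<le> I N" for c
    using I_top by (simp add: filterlim_at_top)
  have hat: "AE \<omega> in M. \<theta>h \<theta> N \<omega> = \<theta> + ?Y N \<omega> / sqrt (I N)" if "0 < \<theta>" "1 \<le> N" for \<theta> N
    unfolding thetah_def u_def I_def by (rule fm.theta_hat_eq[OF that(2,1) u0_meas u0_nz])
  have xi: "AE \<omega> in M. \<xi> N \<omega> = ?Y N \<omega>" for N unfolding xi_def by (rule fm.xi_eq_Y)

  \<comment> \<open>One outcome for one parameter value and one mode suffices to see that the prior is integrable near \<open>0\<close>.\<close>
  have int_0: "(\<integral>\<^sup>+\<eta>. ennreal (\<rho> \<eta>) * indicator {0<..1} \<eta> \<partial>lborel) < \<infinity>"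
  proof -
    have "AE \<omega> in M. posterior_norm \<rho> (I 1) (\<theta>h 1 1 \<omega>) < \<infinity>"
      using norm_ok[OF zero_less_one order_refl] by eventually_elim auto
    then obtain x where "posterior_norm \<rho> (I 1) x < \<infinity>"
      using eventually_happens[of _ "ae_filter M"] fm.ae_filter_bot by blast
    then show ?thesis using prior_integrable_near_0[OF prior, of "I 1" x] I_pos[of 1] by simp
  qed
  interpret bp: bayes_problem \<rho> \<l> by unfold_locales (use prior loss int_0 in auto)

  have good: "AE \<omega> in M. bp.good (I N) (\<theta> + ?Y N \<omega> / sqrt (I N))" if "0 < \<theta>" "1 \<le> N" for \<theta> N
    using norm_ok[OF that] strict_min[OF that] hat[OF that]
    by eventually_elim (simp add: bp.good_def)
  \<comment> \<open>The goodness of a point does not refer to the true parameter, so its density may be read off from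
    the parameter value \<open>1\<close>.\<close>
  have dense_I: "bp.dense_good (I N)" if N: "1 \<le> N" for N
    unfolding bp.dense_good_def
  proof (intro allI impI)
    fix c d :: real assume cd: "c < d"
    have s: "0 < sqrt (I N)" using I_pos[OF N] by simp
    have "sqrt (I N) * (c - 1) < sqrt (I N) * (d - 1)" using cd s by simp
    from fm.AE_Y_imp_point[OF N good[OF zero_less_one N] this]
    obtain z where z: "sqrt (I N) * (c - 1) < z" "z < sqrt (I N) * (d - 1)" "bp.good (I N) (1 + z / sqrt (I N))"
      by blast
    have "c < 1 + z / sqrt (I N)" "1 + z / sqrt (I N) < d"
      using z(1,2) s by (simp_all add: field_simps)
    then show "\<exists>y>c. y < d \<and> bp.good (I N) y" using z(3) by blast
  qed
  let ?\<psi> = "\<lambda>N. bp.\<psi> (I N)"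
  \<comment> \<open>From here on the estimator enters only through \<open>\<psi>\<close> and the exactly normal variable \<open>Y N\<close>.\<close>
  have beta: "AE \<omega> in M. ?err N \<theta> \<omega> = ?\<psi> N \<theta> (?Y N \<omega>)" if "0 < \<theta>" "1 \<le> N" for \<theta> N
    using hat[OF that] good[OF that]
    by eventually_elim (simp add: beta_def bp.\<psi>_def bp.b_ext_eq[OF I_pos[OF that(2)] dense_I[OF that(2)]])
  have \<psi>_meas: "?\<psi> N \<theta> \<in> borel_measurable borel" if "1 \<le> N" for N \<theta>
    by (rule bp.\<psi>_measurable[OF I_pos[OF that] dense_I[OF that]])
  have \<psi>_meas_ev: "\<forall>\<^sub>F N in sequentially. \<forall>\<theta>\<in>\<Theta>. ?\<psi> N \<theta> \<in> borel_measurable borel" for \<Theta>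
    using eventually_ge_at_top[of 1] by eventually_elim (use \<psi>_meas in blast)
  have \<psi>_lim: "\<forall>\<^sub>F N in sequentially. \<forall>\<theta>\<in>{a..d}. \<forall>z. \<bar>z\<bar> \<le> R \<longrightarrow> \<bar>?\<psi> N \<theta> z - z\<bar> < e"
    if ad: "0 < a" "a \<le> d" and e: "0 < e" for a d e R
  proof -
    obtain I0 where I0: "\<forall>i\<ge>I0. bp.dense_good i \<longrightarrow>
        (\<forall>\<theta> z. a \<le> \<theta> \<longrightarrow> \<theta> \<le> d \<longrightarrow> \<bar>z\<bar> \<le> R \<longrightarrow> \<bar>bp.\<psi> i \<theta> z - z\<bar> < e)"
      using bp.\<psi>_limit[OF ad e, of R] by (elim exE conjE)
    show ?thesis using I_ge[of I0] eventually_ge_at_top[of 1]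
      by eventually_elim (use I0 dense_I in auto)
  qed
  have \<psi>_gr: "\<exists>C. \<forall>\<^sub>F N in sequentially. \<forall>\<theta>\<in>{a..d}. \<forall>z. \<bar>?\<psi> N \<theta> z\<bar> \<le> C * (1 + \<bar>z\<bar>)"
    if ad: "0 < a" "a \<le> d" for a d
  proof -
    obtain C I0 where I0: "\<forall>i\<ge>I0. bp.dense_good i \<longrightarrow>
        (\<forall>\<theta> z. a \<le> \<theta> \<longrightarrow> \<theta> \<le> d \<longrightarrow> \<bar>bp.\<psi> i \<theta> z\<bar> \<le> C * (1 + \<bar>z\<bar>))"
      using bp.\<psi>_growth[OF ad] by (elim exE conjE)
    show ?thesis
      by (rule exI[of _ C], use I_ge[of I0] eventually_ge_at_top[of 1] in eventually_elim)
        (use I0 dense_I in auto)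
  qed

  have "\<exists>a d. 0 < a \<and> a \<le> d \<and> B \<subseteq> {a..d}"
  proof (cases "B = {}")
    case True then show ?thesis by (intro exI[of _ 1]) auto
  next
    case False
    obtain a where a: "a \<in> B" "\<And>x. x \<in> B \<Longrightarrow> a \<le> x" using compact_attains_inf[OF B(1) False] by blast
    obtain d where d: "d \<in> B" "\<And>x. x \<in> B \<Longrightarrow> x \<le> d" using compact_attains_sup[OF B(1) False] by blast
    have "0 < a" "a \<le> d" "B \<subseteq> {a..d}" using a d B(2) by auto
    then show ?thesis by blast
  qed
  then obtain a d where ad: "0 < a" "a \<le> d" and Bad: "B \<subseteq> {a..d}" by blast
  have B_pos: "0 < \<theta>" if "\<theta> \<in> B" for \<theta> using that B(2) by auto

  have consistency: "(\<lambda>N. SUP \<theta>\<^sub>0\<in>B. emeasure M {\<omega> \<in> space M. \<epsilon> < \<bar>\<beta> \<theta>\<^sub>0 N \<omega> - \<theta>\<^sub>0\<bar>}) \<longlonglongrightarrow> 0"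
    if \<epsilon>: "0 < \<epsilon>" for \<epsilon>
  proof (rule fm.SUP_emeasure_tendsto_0)
    fix R
    show "\<forall>\<^sub>F N in sequentially. \<forall>\<theta>\<in>B. AE \<omega> in M.
        \<omega> \<in> {\<omega> \<in> space M. \<epsilon> < \<bar>\<beta> \<theta> N \<omega> - \<theta>\<bar>} \<longrightarrow> R < \<bar>?Y N \<omega>\<bar>"
      using \<psi>_lim[OF ad zero_less_one, of R] I_ge[of "((\<bar>R\<bar> + 1) / \<epsilon>)\<^sup>2"] eventually_ge_at_top[of 1]
    proof eventually_elim
      case (elim N)
      have s: "0 < sqrt (I N)" using I_pos[OF elim(3)] by simp
      have "(\<bar>R\<bar> + 1) / \<epsilon> \<le> sqrt (I N)" using elim(2) by (rule real_le_rsqrt)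
      then have Rs: "\<bar>R\<bar> + 1 \<le> sqrt (I N) * \<epsilon>" using \<epsilon> by (simp add: divide_le_eq)
      show ?case
      proof
        fix \<theta> assume \<theta>: "\<theta> \<in> B"
        have lim: "\<bar>?\<psi> N \<theta> z - z\<bar> < 1" if "\<bar>z\<bar> \<le> R" for z using elim(1) \<theta> Bad that by blast
        from beta[OF B_pos[OF \<theta>] elim(3)]
        show "AE \<omega> in M. \<omega> \<in> {\<omega> \<in> space M. \<epsilon> < \<bar>\<beta> \<theta> N \<omega> - \<theta>\<bar>} \<longrightarrow> R < \<bar>?Y N \<omega>\<bar>"
        proof eventually_elim
          case (elim \<omega>)
          have eq: "sqrt (I N) * \<bar>\<beta> \<theta> N \<omega> - \<theta>\<bar> = \<bar>?\<psi> N \<theta> (?Y N \<omega>)\<bar>"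
            unfolding elim[symmetric] using s by (simp add: abs_mult)
          have "\<bar>\<beta> \<theta> N \<omega> - \<theta>\<bar> \<le> \<epsilon>" if Y: "\<bar>?Y N \<omega>\<bar> \<le> R"
          proof -
            have "\<bar>?\<psi> N \<theta> (?Y N \<omega>) - ?Y N \<omega>\<bar> < 1"
              using lim[OF Y] .
            then have "sqrt (I N) * \<bar>\<beta> \<theta> N \<omega> - \<theta>\<bar> \<le> \<bar>R\<bar> + 1"
              unfolding eq using Y by linarith
            then have "sqrt (I N) * \<bar>\<beta> \<theta> N \<omega> - \<theta>\<bar> \<le> sqrt (I N) * \<epsilon>" using Rs by simp
            then show ?thesis using s by simp
          qed
          then show ?case by force
        qed
      qed
    qed
  qed

  have clt: "(\<lambda>N. SUP \<theta>\<^sub>0\<in>B. ennreal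
            \<bar>(LINT \<omega>|M. g (?err N \<theta>\<^sub>0 \<omega>)) - (LINT x|?\<nu>. g x)\<bar>) \<longlonglongrightarrow> 0"
    if g: "continuous_on UNIV g" "bounded (range g)" for g :: "real \<Rightarrow> real"
  proof -
    obtain A where A: "\<And>y. \<bar>g y\<bar> \<le> A" using g(2) unfolding bounded_iff by auto
    have g_meas [measurable]: "g \<in> borel_measurable borel" by (rule borel_measurable_continuous_onI[OF g(1)])
    have g_cont: "AE z in lborel. isCont g z" using g(1) by (simp add: continuous_on_eq_continuous_at)
    have A': "\<bar>g y\<bar> \<le> A * (1 + \<bar>y\<bar>) ^ 0" for y using A by simp
    obtain C where C: "\<forall>\<^sub>F N in sequentially. \<forall>\<theta>\<in>{a..d}. \<forall>z. \<bar>?\<psi> N \<theta> z\<bar> \<le> C * (1 + \<bar>z\<bar>)"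
      using \<psi>_gr[OF ad] by blast
    have transfer: "(LINT \<omega>|M. g (?err N \<theta> \<omega>)) = (LINT z|?\<nu>. g (?\<psi> N \<theta> z))"
      if \<theta>: "\<theta> \<in> B" and N: "1 \<le> N" for N \<theta>
    proof -
      have [measurable]: "?Y N \<in> borel_measurable M" by (rule fm.Y_measurable[OF N])
      have [measurable]: "?\<psi> N \<theta> \<in> borel_measurable borel" by (rule \<psi>_meas[OF N])
      have cm: "complete_measure M" using basis by (simp add: stochastic_basis_def)
      \<comment> \<open>The Bochner integral of a non-measurable function would be \<open>0\<close>; completeness of the basis is what
        makes the estimator measurable.\<close>
      have [measurable]: "(\<lambda>\<omega>. ?err N \<theta> \<omega>) \<in> borel_measurable M"
        by (rule borel_measurable_AE_complete[OF cm _ beta[OF B_pos[OF \<theta>] N]]) measurable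
      have "(LINT \<omega>|M. g (?err N \<theta> \<omega>)) = (LINT \<omega>|M. g (?\<psi> N \<theta> (?Y N \<omega>)))"
      proof (rule integral_cong_AE)
        show "AE \<omega> in M. g (?err N \<theta> \<omega>) = g (?\<psi> N \<theta> (?Y N \<omega>))"
          using beta[OF B_pos[OF \<theta>] N] by eventually_elim simp
      qed measurable
      also have "\<dots> = (LINT z|distr M borel (?Y N). g (?\<psi> N \<theta> z))"
        by (rule integral_distr[symmetric]) measurable
      finally show ?thesis unfolding fm.Y_distr[OF N] .
    qed
    show ?thesis
    proof (rule order_tendstoI)
      fix e :: ennreal assume "0 < e"
      then obtain e' where e': "0 < e'" "e' < e" using dense by blast
      then obtain x where x: "e' = ennreal x" "0 < x" by (cases e') (auto simp: top.not_eq_extremum)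
      have "\<forall>\<^sub>F N in sequentially. \<forall>\<theta>\<in>{a..d}. \<bar>(LINT z|?\<nu>. g (?\<psi> N \<theta> z)) - (LINT z|?\<nu>. g z)\<bar> < x"
        by (rule std_normal_uniform_limit(2)[OF g_meas g_cont A' \<psi>_meas_ev \<psi>_lim[OF ad] C x(2)])
      then show "\<forall>\<^sub>F N in sequentially. (SUP \<theta>\<^sub>0\<in>B. ennreal
            \<bar>(LINT \<omega>|M. g (?err N \<theta>\<^sub>0 \<omega>)) - (LINT x|?\<nu>. g x)\<bar>) < e"
        using eventually_ge_at_top[of 1]
      proof eventually_elim
        case (elim N)
        have "(SUP \<theta>\<^sub>0\<in>B. ennreal \<bar>(LINT \<omega>|M. g (?err N \<theta>\<^sub>0 \<omega>)) - (LINT x|?\<nu>. g x)\<bar>) \<le> e'"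
        proof (rule SUP_least)
          fix \<theta> assume \<theta>: "\<theta> \<in> B"
          show "ennreal \<bar>(LINT \<omega>|M. g (?err N \<theta> \<omega>)) - (LINT x|?\<nu>. g x)\<bar> \<le> e'"
            unfolding transfer[OF \<theta> elim(2)] x(1) using elim(1) \<theta> Bad by (intro ennreal_leI less_imp_le) blast
        qed
        then show ?case using e'(2) by simp
      qed
    qed simp
  qed

  have approximation_xi: "(\<lambda>N. SUP \<theta>\<^sub>0\<in>B. emeasure M
          {\<omega> \<in> space M. \<epsilon> < \<bar>?err N \<theta>\<^sub>0 \<omega> - \<xi> N \<omega>\<bar>}) \<longlonglongrightarrow> 0"
    if \<epsilon>: "0 < \<epsilon>" for \<epsilon>
  proof (rule fm.SUP_emeasure_tendsto_0)
    fix R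
    show "\<forall>\<^sub>F N in sequentially. \<forall>\<theta>\<in>B. AE \<omega> in M.
        \<omega> \<in> {\<omega> \<in> space M. \<epsilon> < \<bar>?err N \<theta> \<omega> - \<xi> N \<omega>\<bar>} \<longrightarrow> R < \<bar>?Y N \<omega>\<bar>"
      using \<psi>_lim[OF ad \<epsilon>, of R] eventually_ge_at_top[of 1]
    proof eventually_elim
      case (elim N)
      show ?case
      proof
        fix \<theta> assume \<theta>: "\<theta> \<in> B"
        have lim: "\<bar>?\<psi> N \<theta> z - z\<bar> < \<epsilon>" if "\<bar>z\<bar> \<le> R" for z using elim(1) \<theta> Bad that by blast
        from beta[OF B_pos[OF \<theta>] elim(2)] xi[of N]
        show "AE \<omega> in M. \<omega> \<in> {\<omega> \<in> space M. \<epsilon> < \<bar>?err N \<theta> \<omega> - \<xi> N \<omega>\<bar>} \<longrightarrow> R < \<bar>?Y N \<omega>\<bar>"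
        proof eventually_elim
          case (elim \<omega>)
          show ?case unfolding mem_Collect_eq elim using lim[of "?Y N \<omega>"] by linarith
        qed
      qed
    qed
  qed

  have efficiency: "((\<lambda>\<delta>. liminf (\<lambda>N. SUP \<theta>\<in>{\<theta>. 0 < \<theta> \<and> \<bar>\<theta> - \<theta>\<^sub>0\<bar> < \<delta>}.
            \<integral>\<^sup>+\<omega>. ennreal (\<pi> (?err N \<theta> \<omega>)) \<partial>M))
          \<longlongrightarrow> (\<integral>\<^sup>+x. ennreal (\<pi> x) \<partial>?\<nu>)) (at_right 0)"
    if \<pi>: "\<pi> \<in> losses_Wp" and \<theta>0B: "\<theta>\<^sub>0 \<in> B" for \<pi> \<theta>\<^sub>0
  proof -
    have \<theta>0: "0 < \<theta>\<^sub>0" by (rule B_pos[OF \<theta>0B])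
    have \<pi>_meas [measurable]: "\<pi> \<in> borel_measurable borel" and \<pi>_nn: "\<And>x. 0 \<le> \<pi> x"
      using \<pi> by (auto simp: losses_Wp_def losses_W_def)
    obtain A k where A: "\<And>x. \<pi> x \<le> A * (1 + \<bar>x\<bar>) ^ k" using loss_growth[OF \<pi>] by blast
    have A': "\<bar>\<pi> x\<bar> \<le> A * (1 + \<bar>x\<bar>) ^ k" for x using A \<pi>_nn by simp
    note cont = loss_AE_isCont[OF \<pi>]
    define p where "p = (LINT z|?\<nu>. \<pi> z)"
    have "integrable ?\<nu> \<pi>"
      by (rule Bochner_Integration.integrable_bound[OF integrable_mult_right[OF std_normal_integrable_growth[of k], of A]])
        (use A' in \<open>auto intro: order_trans[OF _ abs_ge_self]\<close>)
    then have p: "(\<integral>\<^sup>+x. ennreal (\<pi> x) \<partial>?\<nu>) = ennreal p"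
      unfolding p_def by (rule nn_integral_eq_integral) (simp add: \<pi>_nn)
    have ad': "0 < \<theta>\<^sub>0 / 2" "\<theta>\<^sub>0 / 2 \<le> 2 * \<theta>\<^sub>0" using \<theta>0 by auto
    obtain C where C: "\<forall>\<^sub>F N in sequentially. \<forall>\<theta>\<in>{\<theta>\<^sub>0 / 2..2 * \<theta>\<^sub>0}. \<forall>z. \<bar>?\<psi> N \<theta> z\<bar> \<le> C * (1 + \<bar>z\<bar>)"
      using \<psi>_gr[OF ad'] by blast
    have int_ev: "\<forall>\<^sub>F N in sequentially. \<forall>\<theta>\<in>{\<theta>\<^sub>0 / 2..2 * \<theta>\<^sub>0}. integrable ?\<nu> (\<lambda>z. \<pi> (?\<psi> N \<theta> z))"
      by (rule std_normal_uniform_limit(1)[OF \<pi>_meas cont A' \<psi>_meas_ev \<psi>_lim[OF ad'] C])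
    have lim: "\<forall>\<^sub>F N in sequentially. \<forall>\<theta>\<in>{\<theta>\<^sub>0 / 2..2 * \<theta>\<^sub>0}. \<bar>(LINT z|?\<nu>. \<pi> (?\<psi> N \<theta> z)) - p\<bar> < e"
      if e: "0 < e" for e
      unfolding p_def by (rule std_normal_uniform_limit(2)[OF \<pi>_meas cont A' \<psi>_meas_ev \<psi>_lim[OF ad'] C e])
    have transfer: "(\<integral>\<^sup>+\<omega>. ennreal (\<pi> (?err N \<theta> \<omega>)) \<partial>M) = (\<integral>\<^sup>+z. ennreal (\<pi> (?\<psi> N \<theta> z)) \<partial>?\<nu>)"
      if \<theta>: "0 < \<theta>" and N: "1 \<le> N" for N \<theta>
    proof -
      have [measurable]: "?Y N \<in> borel_measurable M" by (rule fm.Y_measurable[OF N])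
      have [measurable]: "?\<psi> N \<theta> \<in> borel_measurable borel" by (rule \<psi>_meas[OF N])
      have "(\<integral>\<^sup>+\<omega>. ennreal (\<pi> (?err N \<theta> \<omega>)) \<partial>M) = (\<integral>\<^sup>+\<omega>. ennreal (\<pi> (?\<psi> N \<theta> (?Y N \<omega>))) \<partial>M)"
        by (rule nn_integral_cong_AE, use beta[OF \<theta> N] in eventually_elim) simp
      also have "\<dots> = (\<integral>\<^sup>+z. ennreal (\<pi> (?\<psi> N \<theta> z)) \<partial>distr M borel (?Y N))"
        by (rule nn_integral_distr[symmetric]) measurable
      finally show ?thesis unfolding fm.Y_distr[OF N] .
    qed
    \<comment> \<open>For each small \<open>\<delta>\<close> the maximal risk converges, and to the same value, so the limit in \<open>\<delta>\<close> is trivial.\<close>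
    have risk: "(\<lambda>N. SUP \<theta>\<in>{\<theta>. 0 < \<theta> \<and> \<bar>\<theta> - \<theta>\<^sub>0\<bar> < \<delta>}.
        \<integral>\<^sup>+\<omega>. ennreal (\<pi> (?err N \<theta> \<omega>)) \<partial>M) \<longlonglongrightarrow> ennreal p"
      if \<delta>: "0 < \<delta>" "\<delta> < \<theta>\<^sub>0 / 2" for \<delta>
    proof -
      let ?\<Theta> = "{\<theta>. 0 < \<theta> \<and> \<bar>\<theta> - \<theta>\<^sub>0\<bar> < \<delta>}"
      have sub: "?\<Theta> \<subseteq> {\<theta>\<^sub>0 / 2..2 * \<theta>\<^sub>0}" using \<delta> by (auto simp: abs_less_iff)
      show ?thesis
      proof (rule SUP_ennreal_tendsto[where x = "\<lambda>N \<theta>. LINT z|?\<nu>. \<pi> (?\<psi> N \<theta> z)"])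
        have "\<theta>\<^sub>0 \<in> ?\<Theta>" using \<theta>0 \<delta> by simp
        then show "?\<Theta> \<noteq> {}" by blast
        show "\<forall>\<^sub>F N in sequentially. \<forall>\<theta>\<in>?\<Theta>. (\<integral>\<^sup>+\<omega>. ennreal (\<pi> (?err N \<theta> \<omega>)) \<partial>M) =
            ennreal (LINT z|?\<nu>. \<pi> (?\<psi> N \<theta> z))"
          using int_ev eventually_ge_at_top[of 1]
        proof eventually_elim
          case (elim N)
          show ?case
          proof
            fix \<theta> assume \<theta>: "\<theta> \<in> ?\<Theta>"
            then have "integrable ?\<nu> (\<lambda>z. \<pi> (?\<psi> N \<theta> z))" using elim(1) sub by blast
            then have "(\<integral>\<^sup>+z. ennreal (\<pi> (?\<psi> N \<theta> z)) \<partial>?\<nu>) = ennreal (LINT z|?\<nu>. \<pi> (?\<psi> N \<theta> z))"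
              by (rule nn_integral_eq_integral) (simp add: \<pi>_nn)
            then show "(\<integral>\<^sup>+\<omega>. ennreal (\<pi> (?err N \<theta> \<omega>)) \<partial>M) =
                ennreal (LINT z|?\<nu>. \<pi> (?\<psi> N \<theta> z))"
              using \<theta> transfer[OF _ elim(2)] by simp
          qed
        qed
        show "\<forall>\<^sub>F N in sequentially. \<forall>\<theta>\<in>?\<Theta>. \<bar>(LINT z|?\<nu>. \<pi> (?\<psi> N \<theta> z)) - p\<bar> < e" if "0 < e" for e
          using lim[OF that] by (rule eventually_mono) (use sub in blast)
      qed
    qed
    have "\<forall>\<^sub>F \<delta> in at_right (0::real). \<delta> < \<theta>\<^sub>0 / 2"
      using \<theta>0 by (intro eventually_at_rightI[of 0 "\<theta>\<^sub>0 / 2"]) auto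
    then have "\<forall>\<^sub>F \<delta> in at_right 0. liminf (\<lambda>N. SUP \<theta>\<in>{\<theta>. 0 < \<theta> \<and> \<bar>\<theta> - \<theta>\<^sub>0\<bar> < \<delta>}.
            \<integral>\<^sup>+\<omega>. ennreal (\<pi> (?err N \<theta> \<omega>)) \<partial>M) = ennreal p"
      using eventually_at_right_less[of 0]
    proof eventually_elim
      case (elim \<delta>)
      show ?case by (rule lim_imp_Liminf[OF _ risk]) (use elim in auto)
    qed
    then show ?thesis unfolding p by (rule tendsto_eventually)
  qed

  show ?thesis using consistency clt approximation_xi efficiency by blast
qed

end
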